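(* Suppose that the central curve $\boldsymbol m(y)=\mathbb E[\boldsymbol X\mid Y=y]$ is weak $(K,\tau)$-sliced stable with respect to $Y$ (WSSC), that there is a constant $c_1>0$ with $\mathbb E[\xi_i^4]/\lambda_i^2\le c_1$ for all $i\ge1$, that $\mathrm{rank}(\Gamma_e)=d$, and that $\tau>\frac{6\|\Gamma_e\|}{\lambda_{\min}^+(\Gamma_e)}$. Then there are constants $C>0$ and $H_0\ge K$ such that, for all $H>H_0$ and all sufficiently large $n>1+4H/\gamma$, $$\mathbb P\left(\left|\left\langle(\widetilde\Gamma_e-\Gamma_e)(\boldsymbol u),\boldsymbol u\right\rangle\right|\le\tfrac3\tau\langle\Gamma_e(\boldsymbol u),\boldsymbol u\rangle,\ \forall \boldsymbol u\in\mathbb S_{\mathcal H}\right)\ge 1-CH^2\sqrt{n+1}\exp\left(\frac{-\gamma^2(n+1)}{32H^2}\right)$$ (this is the property defining $H_0$), and such that, for any fixed integer $H>H_0$ and any sufficiently large $n>1+4H/\gamma$, $$\mathbb E\left[\left\|P_{\widehat{\mathcal S}_e}-P_{\mathcal S_e}\right\|^2\right]\lesssim\frac1n,$$ where the expectation is with respect to the randomness of the sample.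
   Context: Setting. $\mathcal H=L^2[0,1]$ with its usual inner product and norm; $\mathbb S_{\mathcal H}=\{\boldsymbol u\in\mathcal H:\|\boldsymbol u\|=1\}$; for operators $\|\cdot\|$ is the operator norm; $x\otimes y(z)=\langle x,z\rangle y$; $P_S$ is the orthogonal projection onto a closed subspace $S$; $\mathrm{Im}(T)$ is the closure of the image of $T$; $\lambda^+_{\min}(T)$ is the infimum of the positive spectrum of a self-adjoint $T$. The pair $(\boldsymbol X,Y)\in\mathcal H\times\mathbb R$ follows the multiple-index model $Y=f(\langle\boldsymbol\beta_1,\boldsymbol X\rangle,\dots,\langle\boldsymbol\beta_d,\boldsymbol X\rangle,\varepsilon)$ with $f:\mathbb R^{d+1}\to\mathbb R$ an unknown link, $\boldsymbol\beta_i\in\mathcal H$, $\varepsilon$ a random noise independent of $\boldsymbol X$, and $d$ known and fixed. Assume $\mathbb E[\boldsymbol X]=0$ and $\mathbb E\|\boldsymbol X\|^4<\infty$. $\Gamma=\mathrm{var}(\boldsymbol X)$ is the covariance operator, assumed non-singular, with decreasing eigenvalues $\lambda_1\ge\lambda_2\ge\dots>0$ and orthonormal eigenfunctions $\{\phi_i\}$; $\xi_i=\langle\boldsymbol X,\phi_i\rangle$. $\Gamma_e=\mathrm{var}(\mathbb E[\boldsymbol X\mid Y])$, and the inverse regression subspace is $\mathcal S_e=\mathrm{Im}(\Gamma_e)$. Slicing. Given i.i.d. samples $(\boldsymbol X_i,Y_i)_{i=1}^n$ with $n=Hc$ ($c$ a positive integer, $H\ge d$), let $Y_{(1)}\le\dots\le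 Y_{(n)}$ be the order statistics, $\boldsymbol X_{(k)}$ the concomitant of $Y_{(k)}$, $Y_{h,j}=Y_{(c(h-1)+j)}$, $\boldsymbol X_{h,j}=\boldsymbol X_{(c(h-1)+j)}$. The slices are $\mathcal S_1=(-\infty,Y_{1,c}]$, $\mathcal S_h=(Y_{h-1,c},Y_{h,c}]$ for $2\le h\le H-1$, $\mathcal S_H=(Y_{H-1,c},\infty)$. With $\overline{\boldsymbol X}_{h,\cdot}=\frac1c\sum_{j=1}^c\boldsymbol X_{h,j}$, set $\widehat\Gamma_e=\frac1H\sum_{h=1}^H\overline{\boldsymbol X}_{h,\cdot}\otimes\overline{\boldsymbol X}_{h,\cdot}$; $\widehat{\mathcal S}_e$ is the span of the top $d$ eigenfunctions of $\widehat\Gamma_e$. With $\overline{\boldsymbol m}_h=\mathbb E[\boldsymbol X\mid Y\in\mathcal S_h]$ (the conditional mean under the law of $(\boldsymbol X,Y)$, the interval $\mathcal S_h$ being regarded as fixed), set $\widetilde\Gamma_e=\frac1H\sum_{h=1}^H\overline{\boldsymbol m}_h\otimes\overline{\boldsymbol m}_h$. WSSC. Throughout, $\gamma$ is a fixed small positive constant. A partition $-\infty=a_0<a_1<\dots<a_H=\infty$ of $\mathbb R$ is a $\gamma$-partition if $\frac{1-\gamma}{H}\le\mathbb P(a_h\le Y\le a_{h+1})\le\frac{1+\gamma}{H}$ for $h=0,\dots,H-1$. For a positive integer $K$ and $\tau>1$, a continuous curve $\boldsymbol\kappa:\mathbb R\to\mathcal H$ is weak $(K,\tau)$-sliced stable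 w.r.t. $Y$ if for every $H\ge K$, every $\gamma$-partition and every $\boldsymbol u\in\mathbb S_{\mathcal H}$: $\frac1H\sum_{h=0}^{H-1}\mathrm{var}(\langle\boldsymbol u,\boldsymbol\kappa(Y)\rangle\mid a_h\le Y\le a_{h+1})\le\frac1\tau\mathrm{var}(\langle\boldsymbol u,\boldsymbol\kappa(Y)\rangle)$. $a_n\lesssim b_n$ means $a_n\le C'b_n$ for a positive constant $C'$ not depending on $n$.
   Formalization: The formal theorem assumes in addition that Y has no atoms (P(Y=y)=0 for every y); with an atom, for large H some slices are empty, their conditional means are undefined, and the first bound fails, e.g. for Y=sign⟨β,X⟩ with X Gaussian. *)

theory Defs
  imports "HOL-Probability.Probability"
begin

section \<open>The Hilbert space of square-integrable functions on the unit interval\<close>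

text \<open>
  Lebesgue measurable square-integrable functions modulo equality almost everywhere. Completeness
  and separability are established because Bochner integrals of \<open>l2\<close>-valued random variables
  require the type to be of class \<open>banach\<close> and \<open>second_countable_topology\<close>.
\<close>

abbreviation leb01 :: "real measure" where
  "leb01 \<equiv> lebesgue_on {0..1}"

definition square_integrable01 :: "(real \<Rightarrow> real) \<Rightarrow> bool" where
  "square_integrable01 f \<longleftrightarrow> f \<in> borel_measurable leb01 \<and> integrable leb01 (\<lambda>t. (f t)\<^sup>2)"

definition l2_rel :: "(real \<Rightarrow> real) \<Rightarrow> (real \<Rightarrow> real) \<Rightarrow> bool" where
  "l2_rel f g \<longleftrightarrow> square_integrable01 f \<and> square_integrable01 g \<and> (AE t in leb01. f t = g t)"

lemma finite_measure_leb01: "finite_measure leb01"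
  by (rule finite_measure_lebesgue_on) simp

lemma square_integrable01_mult:
  assumes "square_integrable01 f" "square_integrable01 g"
  shows "integrable leb01 (\<lambda>t. f t * g t)"
proof (rule Bochner_Integration.integrable_bound)
  show "integrable leb01 (\<lambda>t. (f t)\<^sup>2 + (g t)\<^sup>2)"
    using assms by (auto simp: square_integrable01_def)
  show "(\<lambda>t. f t * g t) \<in> borel_measurable leb01"
    using assms by (auto simp: square_integrable01_def)
  have "\<bar>a * b\<bar> \<le> a\<^sup>2 + b\<^sup>2" for a b :: real
  proof -
    have "2 * (\<bar>a\<bar> * \<bar>b\<bar>) \<le> a\<^sup>2 + b\<^sup>2"
      using sum_squares_bound[of "\<bar>a\<bar>" "\<bar>b\<bar>"] by simp
    moreover have "0 \<le> \<bar>a\<bar> * \<bar>b\<bar>" by simp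
    ultimately show ?thesis by (simp only: abs_mult)
  qed
  then show "AE t in leb01. norm (f t * g t) \<le> norm ((f t)\<^sup>2 + (g t)\<^sup>2)"
    by (auto intro!: AE_I2)
qed

lemma square_integrable01_zero: "square_integrable01 (\<lambda>_. 0)"
  by (simp add: square_integrable01_def)

lemma square_integrable01_add:
  assumes "square_integrable01 f" "square_integrable01 g"
  shows "square_integrable01 (\<lambda>t. f t + g t)"
  using assms square_integrable01_mult[OF assms]
  by (auto simp: square_integrable01_def power2_sum mult.assoc
      intro!: Bochner_Integration.integrable_add)

lemma square_integrable01_scale:
  "square_integrable01 f \<Longrightarrow> square_integrable01 (\<lambda>t. c * f t)"
  by (auto simp: square_integrable01_def power_mult_distrib)

lemma square_integrable01_minus:
  "square_integrable01 f \<Longrightarrow> square_integrable01 (\<lambda>t. - f t)"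
  using square_integrable01_scale[of f "-1"] by simp

lemma square_integrable01_diff:
  assumes "square_integrable01 f" "square_integrable01 g"
  shows "square_integrable01 (\<lambda>t. f t - g t)"
  using square_integrable01_add[OF assms(1) square_integrable01_minus[OF assms(2)]] by simp

lemma square_integrable01_bounded:
  assumes "f \<in> borel_measurable leb01" "\<And>t. \<bar>f t\<bar> \<le> B"
  shows "square_integrable01 f"
  unfolding square_integrable01_def
proof
  interpret finite_measure leb01 by (rule finite_measure_leb01)
  have "\<bar>(f t)\<^sup>2\<bar> \<le> B\<^sup>2" for t
    using assms(2)[of t] by (simp add: abs_le_square_iff[symmetric])
  then show "integrable leb01 (\<lambda>t. (f t)\<^sup>2)"
    using assms(1) by (intro integrable_const_bound[of _ "B\<^sup>2"]) auto
qed (rule assms)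

quotient_type l2 = "real \<Rightarrow> real" / partial: l2_rel
proof (rule part_equivpI)
  show "\<exists>f. l2_rel f f"
    using square_integrable01_zero by (auto simp: l2_rel_def)
  show "symp l2_rel" by (auto simp: symp_def l2_rel_def)
  show "transp l2_rel" by (auto simp: transp_def l2_rel_def)
qed

instantiation l2 :: real_inner
begin

lift_definition zero_l2 :: l2 is "\<lambda>_. 0"
  by (simp add: l2_rel_def square_integrable01_zero)

lift_definition plus_l2 :: "l2 \<Rightarrow> l2 \<Rightarrow> l2" is "\<lambda>f g t. f t + g t"
  by (auto simp: l2_rel_def square_integrable01_add)

lift_definition uminus_l2 :: "l2 \<Rightarrow> l2" is "\<lambda>f t. - f t"
  by (auto simp: l2_rel_def square_integrable01_minus)

lift_definition minus_l2 :: "l2 \<Rightarrow> l2 \<Rightarrow> l2" is "\<lambda>f g t. f t - g t"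
  by (auto simp: l2_rel_def square_integrable01_diff)

lift_definition scaleR_l2 :: "real \<Rightarrow> l2 \<Rightarrow> l2" is "\<lambda>c f t. c * f t"
  by (auto simp: l2_rel_def square_integrable01_scale)

lift_definition inner_l2 :: "l2 \<Rightarrow> l2 \<Rightarrow> real" is "\<lambda>f g. LINT t|leb01. f t * g t"
  by (rule integral_cong_AE) (auto simp: l2_rel_def square_integrable01_def)

definition norm_l2 :: "l2 \<Rightarrow> real" where "norm_l2 u = sqrt (u \<bullet> u)"

definition dist_l2 :: "l2 \<Rightarrow> l2 \<Rightarrow> real" where "dist_l2 u v = norm (u - v)"

definition sgn_l2 :: "l2 \<Rightarrow> l2" where "sgn_l2 u = inverse (norm u) *\<^sub>R u"

definition uniformity_l2 :: "(l2 \<times> l2) filter" where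
  "uniformity_l2 = (INF e\<in>{0 <..}. principal {(x, y). dist x y < e})"

definition open_l2 :: "l2 set \<Rightarrow> bool" where
  "open_l2 S = (\<forall>x\<in>S. \<forall>\<^sub>F (x', y) in uniformity. x' = x \<longrightarrow> y \<in> S)"

instance
proof
  fix u v w :: l2 and a b :: real
  show "u + v + w = u + (v + w)"
    by transfer (auto simp: l2_rel_def algebra_simps intro!: square_integrable01_add)
  show "u + v = v + u"
    by transfer (auto simp: l2_rel_def algebra_simps intro!: square_integrable01_add)
  show "0 + u = u" by transfer (auto simp: l2_rel_def)
  show "- u + u = 0" by transfer (auto simp: l2_rel_def square_integrable01_zero)
  show "u - v = u + - v"
    by transfer (auto simp: l2_rel_def intro!: square_integrable01_diff)
  show "a *\<^sub>R (u + v) = a *\<^sub>R u + a *\<^sub>R v"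
    by transfer (auto simp: l2_rel_def algebra_simps
        intro!: square_integrable01_scale square_integrable01_add)
  show "(a + b) *\<^sub>R u = a *\<^sub>R u + b *\<^sub>R u"
    by transfer (auto simp: l2_rel_def distrib_right
        intro!: square_integrable01_scale square_integrable01_add)
  show "a *\<^sub>R b *\<^sub>R u = (a * b) *\<^sub>R u"
    by transfer (auto simp: l2_rel_def algebra_simps intro!: square_integrable01_scale)
  show "1 *\<^sub>R u = u" by transfer (auto simp: l2_rel_def)
  show "dist u v = norm (u - v)" by (rule dist_l2_def)
  show "sgn u = inverse (norm u) *\<^sub>R u" by (rule sgn_l2_def)
  show "uniformity = (INF e\<in>{0 <..}. principal {(x, y :: l2). dist x y < e})"
    by (rule uniformity_l2_def)
  show "open U = (\<forall>x\<in>U. \<forall>\<^sub>F (x', y) in uniformity. x' = x \<longrightarrow> y \<in> U)" for U :: "l2 set"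
    by (rule open_l2_def)
  show "u \<bullet> v = v \<bullet> u" by transfer (simp add: mult.commute)
  show "(u + v) \<bullet> w = u \<bullet> w + v \<bullet> w"
    by transfer (simp add: l2_rel_def distrib_right square_integrable01_mult)
  show "(a *\<^sub>R u) \<bullet> v = a * (u \<bullet> v)"
    by transfer (simp add: l2_rel_def mult.assoc)
  show "0 \<le> u \<bullet> u" by transfer simp
  show "norm u = sqrt (u \<bullet> u)" by (rule norm_l2_def)
  show "(u \<bullet> u = 0) = (u = 0)"
  proof transfer
    fix f assume "l2_rel f f"
    then have f: "square_integrable01 f" by (simp add: l2_rel_def)
    have "((LINT t|leb01. f t * f t) = 0) = (AE t in leb01. f t * f t = 0)"
      by (intro integral_nonneg_eq_0_iff_AE square_integrable01_mult f) auto
    then show "((LINT t|leb01. f t * f t) = 0) = l2_rel f (\<lambda>_. 0)"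
      using f by (simp add: l2_rel_def square_integrable01_zero)
  qed
qed

end


lemma square_integrable01_rep: "square_integrable01 (rep_l2 u)"
  using Quotient3_rep_reflp[OF Quotient3_l2, of u] by (simp add: l2_rel_def)

lemma abs_rep_l2: "abs_l2 (rep_l2 u) = u"
  by (rule Quotient3_abs_rep[OF Quotient3_l2])

lemma l2_rel_refl: "square_integrable01 f \<Longrightarrow> l2_rel f f"
  by (simp add: l2_rel_def)

lemma abs_l2_diff:
  "square_integrable01 f \<Longrightarrow> square_integrable01 g \<Longrightarrow>
    abs_l2 f - abs_l2 g = abs_l2 (\<lambda>t. f t - g t)"
  by (rule minus_l2.abs_eq) (simp_all add: l2_rel_refl)

lemma norm_abs_l2:
  "square_integrable01 f \<Longrightarrow> (norm (abs_l2 f))\<^sup>2 = (LINT t|leb01. (f t)\<^sup>2)"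
  by (simp add: power2_norm_eq_inner inner_l2.abs_eq l2_rel_refl) (simp add: power2_eq_square)

lemma nn_integral_l2:
  assumes "square_integrable01 f"
  shows "(\<integral>\<^sup>+t. ennreal ((f t)\<^sup>2) \<partial>leb01) = ennreal ((norm (abs_l2 f))\<^sup>2)"
  unfolding norm_abs_l2[OF assms]
  using assms by (intro nn_integral_eq_integral) (auto simp: square_integrable01_def)

lemma integral_abs_le_norm_l2:
  assumes "square_integrable01 f"
  shows "(\<integral>\<^sup>+t. ennreal \<bar>f t\<bar> \<partial>leb01) \<le> ennreal (norm (abs_l2 f))"
proof -
  have one: "square_integrable01 (\<lambda>_. 1)"
    by (rule square_integrable01_bounded[of _ 1]) auto
  have ab: "square_integrable01 (\<lambda>t. \<bar>f t\<bar>)"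
    using assms by (auto simp: square_integrable01_def)
  have int: "integrable leb01 (\<lambda>t. \<bar>f t\<bar>)"
    using square_integrable01_mult[OF ab one] by simp
  have n1: "norm (abs_l2 (\<lambda>_. 1)) = 1"
    using norm_abs_l2[OF one] norm_ge_zero[of "abs_l2 (\<lambda>_. 1)"]
    by (simp add: measure_restrict_space power2_eq_1_iff)
  have n2: "norm (abs_l2 (\<lambda>t. \<bar>f t\<bar>)) = norm (abs_l2 f)"
    using norm_abs_l2[OF ab] norm_abs_l2[OF assms]
    by (intro power2_eq_imp_eq[OF _ norm_ge_zero norm_ge_zero]) simp
  have "(LINT t|leb01. \<bar>f t\<bar>) = abs_l2 (\<lambda>t. \<bar>f t\<bar>) \<bullet> abs_l2 (\<lambda>_. 1)"
    using ab one by (simp add: inner_l2.abs_eq l2_rel_refl)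
  also have "\<dots> \<le> norm (abs_l2 f)"
    using norm_cauchy_schwarz[of "abs_l2 (\<lambda>t. \<bar>f t\<bar>)" "abs_l2 (\<lambda>_. 1)"] n1 n2 by simp
  finally show ?thesis
    using nn_integral_eq_integral[OF int] by (simp add: ennreal_leI)
qed

instance l2 :: complete_space
proof
  fix X :: "nat \<Rightarrow> l2" assume X: "Cauchy X"
  have "\<exists>N. \<forall>m\<ge>N. \<forall>n\<ge>N. dist (X m) (X n) < (1/2) ^ k" for k
    using metric_CauchyD[OF X, of "(1/2) ^ k"] by auto
  then obtain N where N: "\<And>k m n. m \<ge> N k \<Longrightarrow> n \<ge> N k \<Longrightarrow> dist (X m) (X n) < (1/2) ^ k"
    by metis
  define r where "r k = (\<Sum>i\<le>k. N i)" for k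
  have rN: "N j \<le> r k" if "j \<le> k" for j k
    unfolding r_def using that by (intro member_le_sum) auto
  define f where "f n = rep_l2 (X n)" for n
  have sf: "square_integrable01 (f n)" for n
    by (simp add: f_def square_integrable01_rep)
  have [measurable]: "f n \<in> borel_measurable leb01" for n
    using sf by (auto simp: square_integrable01_def)
  have nf: "norm (abs_l2 (\<lambda>t. f m t - f n t)) = dist (X m) (X n)" for m n
    using abs_l2_diff[OF sf sf, of m n] by (simp add: f_def abs_rep_l2 dist_norm)
  define g where "g k t = \<bar>f (r (Suc k)) t - f (r k) t\<bar>" for k t
  have [measurable]: "g k \<in> borel_measurable leb01" for k
    unfolding g_def by measurable
  have g: "(\<integral>\<^sup>+t. ennreal (g k t) \<partial>leb01) \<le> ennreal ((1/2) ^ k)" for k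
  proof -
    have "(\<integral>\<^sup>+t. ennreal (g k t) \<partial>leb01) \<le> ennreal (dist (X (r (Suc k))) (X (r k)))"
      using integral_abs_le_norm_l2[OF square_integrable01_diff[OF sf sf], of "r (Suc k)" "r k"]
      by (simp add: g_def nf)
    also have "\<dots> \<le> ennreal ((1/2) ^ k)"
      using N[OF rN rN, of k "Suc k" k] by (intro ennreal_leI less_imp_le) simp
    finally show ?thesis .
  qed
  have "(\<integral>\<^sup>+t. (\<Sum>k. ennreal (g k t)) \<partial>leb01) = (\<Sum>k. \<integral>\<^sup>+t. ennreal (g k t) \<partial>leb01)"
    by (rule nn_integral_suminf) measurable
  also have "\<dots> \<le> (\<Sum>k. ennreal ((1/2) ^ k))"
    by (intro suminf_le g) auto
  also have "\<dots> < \<infinity>"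
    by (subst suminf_ennreal2) (auto intro: summable_geometric)
  finally have "AE t in leb01. (\<Sum>k. ennreal (g k t)) \<noteq> \<infinity>"
    by (intro nn_integral_PInf_AE) auto
  then have conv: "AE t in leb01. convergent (\<lambda>k. f (r k) t)"
  proof eventually_elim
    fix t assume "(\<Sum>k. ennreal (g k t)) \<noteq> \<infinity>"
    then have "summable (\<lambda>k. g k t)"
      by (intro summable_suminf_not_top) (auto simp: g_def)
    then have "summable (\<lambda>k. f (r (Suc k)) t - f (r k) t)"
      unfolding g_def by (rule summable_rabs_cancel)
    then have "convergent (\<lambda>n. \<Sum>k<n. f (r (Suc k)) t - f (r k) t)"
      by (simp add: summable_iff_convergent)
    then have "convergent (\<lambda>n. f (r n) t - f (r 0) t)"
      by (simp only: sum_lessThan_telescope[of "\<lambda>n. f (r n) t"])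
    then show "convergent (\<lambda>n. f (r n) t)"
      using convergent_add[OF _ convergent_const[of "f (r 0) t"]] by force
  qed
  define F where "F t = lim (\<lambda>k. f (r k) t)" for t
  have [measurable]: "F \<in> borel_measurable leb01"
    unfolding F_def by measurable
  have bound: "(\<integral>\<^sup>+t. ennreal ((F t - f n t)\<^sup>2) \<partial>leb01) \<le> ennreal (((1/2) ^ k)\<^sup>2)"
    if n: "n \<ge> N k" for n k
  proof -
    have "AE t in leb01. ennreal ((F t - f n t)\<^sup>2) = liminf (\<lambda>j. ennreal ((f (r j) t - f n t)\<^sup>2))"
      using conv
    proof eventually_elim
      fix t assume "convergent (\<lambda>k. f (r k) t)"
      then have "(\<lambda>k. f (r k) t) \<longlonglongrightarrow> F t"
        by (simp add: F_def convergent_LIMSEQ_iff)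
      then have "(\<lambda>j. ennreal ((f (r j) t - f n t)\<^sup>2)) \<longlonglongrightarrow> ennreal ((F t - f n t)\<^sup>2)"
        by (intro tendsto_ennrealI tendsto_intros)
      then show "ennreal ((F t - f n t)\<^sup>2) = liminf (\<lambda>j. ennreal ((f (r j) t - f n t)\<^sup>2))"
        by (intro lim_imp_Liminf[symmetric]) auto
    qed
    then have "(\<integral>\<^sup>+t. ennreal ((F t - f n t)\<^sup>2) \<partial>leb01)
        = (\<integral>\<^sup>+t. liminf (\<lambda>j. ennreal ((f (r j) t - f n t)\<^sup>2)) \<partial>leb01)"
      by (rule nn_integral_cong_AE)
    also have "\<dots> \<le> liminf (\<lambda>j. \<integral>\<^sup>+t. ennreal ((f (r j) t - f n t)\<^sup>2) \<partial>leb01)"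
      by (rule nn_integral_liminf) measurable
    also have "\<dots> = liminf (\<lambda>j. ennreal ((dist (X (r j)) (X n))\<^sup>2))"
      by (simp add: nn_integral_l2[OF square_integrable01_diff[OF sf sf]] nf)
    also have "\<dots> \<le> liminf (\<lambda>j. ennreal (((1/2) ^ k)\<^sup>2))"
    proof (rule Liminf_mono)
      show "\<forall>\<^sub>F j in sequentially. ennreal ((dist (X (r j)) (X n))\<^sup>2) \<le> ennreal (((1/2) ^ k)\<^sup>2)"
        using eventually_ge_at_top[of k]
      proof eventually_elim
        fix j assume "k \<le> j"
        then have "dist (X (r j)) (X n) < (1/2) ^ k"
          using N[OF rN n] by auto
        then show "ennreal ((dist (X (r j)) (X n))\<^sup>2) \<le> ennreal (((1/2) ^ k)\<^sup>2)"
          by (intro ennreal_leI power_mono) auto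
      qed
    qed
    also have "\<dots> = ennreal (((1/2) ^ k)\<^sup>2)"
      by (simp add: Liminf_const)
    finally show ?thesis .
  qed
  have sd: "square_integrable01 (\<lambda>t. F t - f n t)" if "n \<ge> N k" for n k
    unfolding square_integrable01_def
  proof
    show "integrable leb01 (\<lambda>t. (F t - f n t)\<^sup>2)"
      using le_less_trans[OF bound[OF that]] by (intro integrableI_nonneg) auto
  qed measurable
  have sF: "square_integrable01 F"
    using square_integrable01_add[OF sd[of 0 "N 0"] sf[of "N 0"]] by simp
  have "X \<longlonglongrightarrow> abs_l2 F"
  proof (rule metric_LIMSEQ_I)
    fix e :: real assume "0 < e"
    then obtain k where k: "(1/2) ^ k < e"
      using real_arch_pow_inv[of e "1/2"] by auto
    have "dist (X n) (abs_l2 F) < e" if n: "n \<ge> N k" for n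
    proof -
      have "dist (X n) (abs_l2 F) = norm (abs_l2 F - abs_l2 (f n))"
        by (simp add: f_def abs_rep_l2 dist_norm norm_minus_commute)
      also have "\<dots> = norm (abs_l2 (\<lambda>t. F t - f n t))"
        by (simp add: abs_l2_diff sF sf)
      also have "\<dots> \<le> (1/2) ^ k"
        using bound[OF n] nn_integral_l2[OF sd[OF n]]
        by (simp add: ennreal_le_iff power2_le_iff_abs_le)
      finally show ?thesis using k by simp
    qed
    then show "\<exists>no. \<forall>n\<ge>no. dist (X n) (abs_l2 F) < e" by blast
  qed
  then show "convergent X" by (rule convergentI)
qed

instance l2 :: banach ..

lemma abs_l2_tendsto:
  assumes sf: "\<And>n. square_integrable01 (f n)" and sh: "square_integrable01 h"
    and lim: "AE t in leb01. (\<lambda>n. f n t) \<longlonglongrightarrow> h t"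
    and w: "integrable leb01 w" "\<And>n t. (f n t - h t)\<^sup>2 \<le> w t"
  shows "(\<lambda>n. abs_l2 (f n)) \<longlonglongrightarrow> abs_l2 h"
proof -
  have [measurable]: "f n \<in> borel_measurable leb01" "h \<in> borel_measurable leb01" for n
    using sf sh by (auto simp: square_integrable01_def)
  have "(\<lambda>n. LINT t|leb01. (f n t - h t)\<^sup>2) \<longlonglongrightarrow> (LINT t|leb01. 0)"
  proof (rule integral_dominated_convergence[where w = w])
    show "AE t in leb01. (\<lambda>n. (f n t - h t)\<^sup>2) \<longlonglongrightarrow> 0"
      using lim
    proof eventually_elim
      fix t assume "(\<lambda>n. f n t) \<longlonglongrightarrow> h t"
      then have "(\<lambda>n. (f n t - h t)\<^sup>2) \<longlonglongrightarrow> (h t - h t)\<^sup>2"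
        by (intro tendsto_intros)
      then show "(\<lambda>n. (f n t - h t)\<^sup>2) \<longlonglongrightarrow> 0" by simp
    qed
  qed (use w in auto)
  then have "(\<lambda>n. (norm (abs_l2 (f n) - abs_l2 h))\<^sup>2) \<longlonglongrightarrow> 0"
    using norm_abs_l2[OF square_integrable01_diff[OF sf sh]] by (simp add: abs_l2_diff sf sh)
  then have "(\<lambda>n. sqrt ((norm (abs_l2 (f n) - abs_l2 h))\<^sup>2)) \<longlonglongrightarrow> sqrt 0"
    by (rule tendsto_real_sqrt)
  then show ?thesis
    by (simp add: tendsto_norm_zero_iff LIM_zero_iff)
qed

definition step01 :: "nat \<Rightarrow> rat list \<Rightarrow> real \<Rightarrow> real" where
  "step01 N qs t = (\<Sum>i<length qs. of_rat (qs ! i) * indicator {real i / real N..<real (Suc i) / real N} t)"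

lemma square_integrable01_step01: "square_integrable01 (step01 N qs)"
proof (rule square_integrable01_bounded)
  have "step01 N qs \<in> borel_measurable borel"
    unfolding step01_def[abs_def] by measurable
  then show "step01 N qs \<in> borel_measurable leb01"
    by (simp add: measurable_restrict_space1 measurable_completion)
  show "\<bar>step01 N qs t\<bar> \<le> (\<Sum>i<length qs. \<bar>of_rat (qs ! i)\<bar>)" for t
    unfolding step01_def
    by (intro order_trans[OF sum_abs] sum_mono) (auto simp: abs_mult indicator_def)
qed

lemma step01_eq:
  assumes N: "0 < N" and i: "i < length qs" and t: "real i / N \<le> t" "t < real (Suc i) / N"
  shows "step01 N qs t = of_rat (qs ! i)"
proof -
  have *: "indicator {real j / N..<real (Suc j) / N} t = (if j = i then 1 else 0 :: real)" for j
  proof (cases "j = i")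
    case False
    have "\<not> (real j / N \<le> t \<and> t < real (Suc j) / N)"
    proof
      assume j: "real j / N \<le> t \<and> t < real (Suc j) / N"
      have "real i / N < real (Suc j) / N" "real j / N < real (Suc i) / N"
        using j t by linarith+
      then have "real i < real (Suc j)" "real j < real (Suc i)"
        using N by (simp_all only: divide_less_cancel)
      then show False using False by simp
    qed
    then show ?thesis using False by (auto simp: indicator_def)
  qed (use t in simp)
  have "step01 N qs t = (\<Sum>j<length qs. if j = i then of_rat (qs ! j) else 0)"
    unfolding step01_def * by (intro sum.cong) auto
  then show ?thesis
    using i by (simp add: sum.delta)
qed

lemma l2_dense:
  fixes u :: l2 assumes e: "0 < e"
  shows "\<exists>N qs. dist u (abs_l2 (step01 N qs)) < e"
proof -
  define f where "f = rep_l2 u"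
  have sf: "square_integrable01 f" by (simp add: f_def square_integrable01_rep)
  have [measurable]: "f \<in> borel_measurable leb01"
    using sf by (simp add: square_integrable01_def)
  define cl where "cl B x = max (- B) (min B x)" for B x :: real
  have clB: "\<bar>cl B x\<bar> \<le> B" if "0 \<le> B" for B x
    using that by (auto simp: cl_def)
  have [measurable]: "cl B \<in> borel_measurable borel" for B
    unfolding cl_def by measurable
  have scl: "square_integrable01 (\<lambda>t. cl B (k t))"
    if "0 \<le> B" "k \<in> borel_measurable leb01" for B k
    using that by (intro square_integrable01_bounded[of _ B] clB) (measurable, auto)
  have "(\<lambda>n. abs_l2 (\<lambda>t. cl (real n) (f t))) \<longlonglongrightarrow> abs_l2 f"
  proof (rule abs_l2_tendsto[where w = "\<lambda>t. (f t)\<^sup>2"])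
    show "AE t in leb01. (\<lambda>n. cl (real n) (f t)) \<longlonglongrightarrow> f t"
    proof (rule AE_I2)
      fix t
      obtain m :: nat where m: "\<bar>f t\<bar> \<le> real m" using real_arch_simple by blast
      have "\<forall>\<^sub>F n in sequentially. cl (real n) (f t) = f t"
        using eventually_ge_at_top[of m] by eventually_elim (use m in \<open>auto simp: cl_def\<close>)
      then show "(\<lambda>n. cl (real n) (f t)) \<longlonglongrightarrow> f t" by (rule tendsto_eventually)
    qed
    show "(cl (real n) (f t) - f t)\<^sup>2 \<le> (f t)\<^sup>2" for n t
      by (rule abs_le_square_iff[THEN iffD1]) (auto simp: cl_def)
    show "integrable leb01 (\<lambda>t. (f t)\<^sup>2)" using sf by (simp add: square_integrable01_def)
  qed (auto intro: scl sf)
  then obtain n where n: "dist (abs_l2 (\<lambda>t. cl (real n) (f t))) (abs_l2 f) < e / 3"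
    using e by (auto dest!: metric_LIMSEQ_D[where r = "e / 3"])
  define B where "B = real n"
  have B: "0 \<le> B" by (simp add: B_def)
  define h where "h t = cl B (f t)" for t
  have [measurable]: "h \<in> borel_measurable leb01" unfolding h_def by measurable
  have sh: "square_integrable01 h" unfolding h_def by (rule scl[OF B]) simp
  have "h measurable_on {0..1}"
    by (subst measurable_on_iff_borel_measurable) auto
  then obtain Z g where Z: "negligible Z" and cg: "\<And>m. continuous_on UNIV (g m)"
    and gh: "\<And>t. t \<notin> Z \<Longrightarrow> (\<lambda>m. g m t) \<longlonglongrightarrow> (if t \<in> {0..1} then h t else 0)"
    unfolding measurable_on_def by blast
  have [measurable]: "g m \<in> borel_measurable leb01" for m
    using borel_measurable_continuous_onI[OF cg]
    by (simp add: measurable_restrict_space1 measurable_completion)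
  have "(\<lambda>m. abs_l2 (\<lambda>t. cl B (g m t))) \<longlonglongrightarrow> abs_l2 h"
  proof (rule abs_l2_tendsto[where w = "\<lambda>t. (2 * B)\<^sup>2"])
    have "AE t in lebesgue. t \<notin> Z"
      using Z by (auto simp: negligible_iff_null_sets intro: AE_not_in)
    then have "AE t in lebesgue. t \<in> {0..1} \<longrightarrow> (\<lambda>m. cl B (g m t)) \<longlonglongrightarrow> h t"
    proof eventually_elim
      fix t assume t: "t \<notin> Z"
      show "t \<in> {0..1} \<longrightarrow> (\<lambda>m. cl B (g m t)) \<longlonglongrightarrow> h t"
      proof
        assume "t \<in> {0..1}"
        then have "(\<lambda>m. cl B (g m t)) \<longlonglongrightarrow> cl B (h t)"
          unfolding cl_def using gh[OF t] by (intro tendsto_intros) auto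
        moreover have "cl B (h t) = h t" using B by (auto simp: h_def cl_def)
        ultimately show "(\<lambda>m. cl B (g m t)) \<longlonglongrightarrow> h t" by simp
      qed
    qed
    then show "AE t in leb01. (\<lambda>m. cl B (g m t)) \<longlonglongrightarrow> h t"
      by (simp add: AE_restrict_space_iff)
    show "(cl B (g m t) - h t)\<^sup>2 \<le> (2 * B)\<^sup>2" for m t
      unfolding h_def using clB[OF B, of "g m t"] clB[OF B, of "f t"] B
      by (intro abs_le_square_iff[THEN iffD1]) linarith
    interpret finite_measure leb01 by (rule finite_measure_leb01)
    show "integrable leb01 (\<lambda>t. (2 * B)\<^sup>2)" by simp
  qed (auto intro: scl B sh)
  then obtain m where m: "dist (abs_l2 (\<lambda>t. cl B (g m t))) (abs_l2 h) < e / 3"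
    using e by (auto dest!: metric_LIMSEQ_D[where r = "e / 3"])
  define k where "k t = cl B (g m t)" for t
  have sk: "square_integrable01 k" unfolding k_def by (rule scl[OF B]) simp
  have "continuous_on {0..2} k"
    unfolding k_def cl_def
    by (intro continuous_intros continuous_on_subset[OF cg]) auto
  then have "uniformly_continuous_on {0..2} k"
    by (rule compact_uniformly_continuous) simp
  from uniformly_continuous_onE[OF this, of "e / 8"] e obtain d where d: "0 < d"
    and kd: "\<And>s t. s \<in> {0..2} \<Longrightarrow> t \<in> {0..2} \<Longrightarrow> dist t s < d \<Longrightarrow> dist (k t) (k s) < e / 8"
    by auto
  obtain N where N: "0 < N" "1 / real N < d"
    using real_arch_inverse[of d] d by (auto simp: inverse_eq_divide)
  have "\<exists>q. \<bar>of_rat q - k (real i / real N)\<bar> < e / 8" for i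
  proof -
    obtain q where "k (real i / real N) < of_rat q" "of_rat q < k (real i / real N) + e / 8"
      using of_rat_dense[of "k (real i / real N)" "k (real i / real N) + e / 8"] e by auto
    then show ?thesis by (intro exI[of _ q]) auto
  qed
  then obtain q where q: "\<And>i. \<bar>of_rat (q i) - k (real i / real N)\<bar> < e / 8" by metis
  define qs where "qs = map q [0..<Suc N]"
  have ap: "\<bar>k t - step01 N qs t\<bar> \<le> e / 4" if t: "t \<in> {0..1}" for t
  proof -
    define i where "i = nat \<lfloor>real N * t\<rfloor>"
    have "0 \<le> real N * t" using t by simp
    then have i: "real i \<le> real N * t" "real N * t < real (Suc i)"
      unfolding i_def by linarith+
    have iN: "i \<le> N"
    proof -
      have "real N * t \<le> real N" using t by (simp add: mult_left_le)
      with i(1) show ?thesis by linarith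
    qed
    have it: "real i / real N \<le> t" "t < real (Suc i) / real N"
      using i N(1) by (simp_all add: field_simps)
    have "step01 N qs t = of_rat (qs ! i)"
      using iN by (intro step01_eq N it) (auto simp: qs_def)
    also have "qs ! i = q i"
      using iN by (simp add: qs_def nth_append del: upt_Suc)
    finally have s: "step01 N qs t = of_rat (q i)" .
    have "real (Suc i) / real N = real i / real N + 1 / real N"
      by (simp add: add_divide_distrib)
    then have "dist t (real i / real N) < d"
      using it N by (simp add: dist_real_def)
    moreover have "real i / real N \<in> {0..2}"
      using iN N by (auto simp: field_simps)
    ultimately have "dist (k t) (k (real i / real N)) < e / 8"
      using t by (intro kd) auto
    then have "\<bar>k t - k (real i / real N)\<bar> < e / 8" by (simp add: dist_real_def)
    then show ?thesis using q[of i] unfolding s by linarith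
  qed
  have ss: "square_integrable01 (step01 N qs)" by (rule square_integrable01_step01)
  have "(norm (abs_l2 (\<lambda>t. k t - step01 N qs t)))\<^sup>2 = (LINT t|leb01. (k t - step01 N qs t)\<^sup>2)"
    by (rule norm_abs_l2[OF square_integrable01_diff[OF sk ss]])
  also have "\<dots> \<le> (LINT t|leb01. (e / 4)\<^sup>2)"
  proof (rule integral_mono)
    interpret finite_measure leb01 by (rule finite_measure_leb01)
    show "integrable leb01 (\<lambda>t. (k t - step01 N qs t)\<^sup>2)"
      using square_integrable01_diff[OF sk ss] by (simp add: square_integrable01_def)
    show "integrable leb01 (\<lambda>t. (e / 4)\<^sup>2)" by simp
    show "(k t - step01 N qs t)\<^sup>2 \<le> (e / 4)\<^sup>2" if "t \<in> space leb01" for t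
      using ap[of t] that e by (intro abs_le_square_iff[THEN iffD1]) auto
  qed
  also have "\<dots> = (e / 4)\<^sup>2" by (simp add: measure_restrict_space)
  finally have "norm (abs_l2 (\<lambda>t. k t - step01 N qs t)) \<le> e / 4"
    using e by (auto intro: power2_le_imp_le)
  then have 3: "dist (abs_l2 k) (abs_l2 (step01 N qs)) < e / 3"
    using e by (simp add: dist_norm abs_l2_diff sk ss)
  have 1: "dist u (abs_l2 h) < e / 3"
    using n by (simp add: dist_commute h_def[abs_def] B_def f_def abs_rep_l2)
  have 2: "dist (abs_l2 h) (abs_l2 k) < e / 3"
    using m by (simp add: dist_commute k_def[abs_def])
  have "dist u (abs_l2 (step01 N qs)) < e"
    using 1 2 3 dist_triangle[of u "abs_l2 (step01 N qs)" "abs_l2 h"]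
      dist_triangle[of "abs_l2 h" "abs_l2 (step01 N qs)" "abs_l2 k"] by linarith
  then show ?thesis by blast
qed

instance l2 :: second_countable_topology
proof
  define D where "D = range (\<lambda>(N, qs). abs_l2 (step01 N qs))"
  define B where "B = (\<lambda>(d, n). ball d (1 / real (Suc n))) ` (D \<times> UNIV)"
  have "countable B" by (simp add: B_def D_def)
  moreover have "topological_basis B"
  proof (rule topological_basisI)
    show "open b" if "b \<in> B" for b using that by (auto simp: B_def)
    fix U :: "l2 set" and u assume "open U" "u \<in> U"
    then obtain e where e: "0 < e" "ball u e \<subseteq> U" by (meson openE)
    obtain n where n: "1 / real (Suc n) < e / 2"
      using reals_Archimedean[of "e / 2"] e by (auto simp: inverse_eq_divide)
    obtain N qs where "dist u (abs_l2 (step01 N qs)) < 1 / real (Suc n)"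
      using l2_dense[of "1 / real (Suc n)" u] by auto
    then obtain d where d: "d \<in> D" "dist u d < 1 / real (Suc n)"
      by (force simp: D_def)
    have "ball d (1 / real (Suc n)) \<subseteq> ball u e"
    proof
      fix v assume "v \<in> ball d (1 / real (Suc n))"
      then show "v \<in> ball u e"
        using d(2) n dist_triangle[of u v d] by (simp only: mem_ball)
    qed
    then show "\<exists>b\<in>B. u \<in> b \<and> b \<subseteq> U"
      using d e by (intro bexI[of _ "ball d (1 / real (Suc n))"]) (auto simp: B_def dist_commute)
  qed
  ultimately show "\<exists>B :: l2 set set. countable B \<and> open = generate_topology B"
    using topological_basis_imp_subbasis by blast
qed

section \<open>Operators on a Hilbert space\<close>

definition tensor :: "'h::real_inner \<Rightarrow> 'h \<Rightarrow> 'h \<Rightarrow> 'h" where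
  "tensor x y = (\<lambda>z. (x \<bullet> z) *\<^sub>R y)"

definition orth_proj :: "'h::real_inner set \<Rightarrow> 'h \<Rightarrow> 'h" where
  "orth_proj S u = (THE p. p \<in> S \<and> (\<forall>s\<in>S. (u - p) \<bullet> s = 0))"

text \<open>The spectrum is taken over the reals; for self-adjoint operators nothing is lost.\<close>

definition spectrum_op :: "('h::real_normed_vector \<Rightarrow> 'h) \<Rightarrow> real set" where
  "spectrum_op T = {\<mu>. \<not> (\<exists>R. bounded_linear R \<and>
     (\<forall>u. R (T u - \<mu> *\<^sub>R u) = u) \<and> (\<forall>u. T (R u) - \<mu> *\<^sub>R R u = u))}"

definition lambda_min_pos :: "('h::real_normed_vector \<Rightarrow> 'h) \<Rightarrow> real" where
  "lambda_min_pos T = Inf {\<mu> \<in> spectrum_op T. 0 < \<mu>}"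

text \<open>
  \<open>eigensystem T \<mu> \<phi>\<close>: the \<open>\<phi> i\<close> are a complete orthonormal system of eigenvectors, listed with
  decreasing eigenvalues \<open>\<mu> i\<close> (indexed from 0).
\<close>

definition eigensystem :: "('h::real_inner \<Rightarrow> 'h) \<Rightarrow> (nat \<Rightarrow> real) \<Rightarrow> (nat \<Rightarrow> 'h) \<Rightarrow> bool" where
  "eigensystem T \<mu> \<phi> \<longleftrightarrow> decseq \<mu> \<and> (\<forall>i j. \<phi> i \<bullet> \<phi> j = (if i = j then 1 else 0)) \<and>
     (\<forall>i. T (\<phi> i) = \<mu> i *\<^sub>R \<phi> i) \<and> closure (span (range \<phi>)) = UNIV"

text \<open>
  With a tie at position \<open>d\<close> the span of the top \<open>d\<close> eigenvectors is not unique, so this is a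
  relation between an operator and its admissible top eigenspaces.
\<close>

definition top_eigenspace :: "('h::real_inner \<Rightarrow> 'h) \<Rightarrow> nat \<Rightarrow> 'h set \<Rightarrow> bool" where
  "top_eigenspace T d S \<longleftrightarrow> (\<exists>\<mu> \<phi>. eigensystem T \<mu> \<phi> \<and> S = span (\<phi> ` {..<d}))"


section \<open>Moments and conditioning\<close>

definition var_real :: "'w measure \<Rightarrow> ('w \<Rightarrow> real) \<Rightarrow> real" where
  "var_real M Z = (LINT \<omega>|M. (Z \<omega> - (LINT \<omega>'|M. Z \<omega>'))\<^sup>2)"

definition cov_op ::
  "'w measure \<Rightarrow> ('w \<Rightarrow> 'h::{real_inner, banach, second_countable_topology}) \<Rightarrow> 'h \<Rightarrow> 'h" where
  "cov_op M Z u = (LINT \<omega>|M. tensor (Z \<omega> - integral\<^sup>L M Z) (Z \<omega> - integral\<^sup>L M Z) u)"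

definition cond_law :: "'w measure \<Rightarrow> ('w \<Rightarrow> real) \<Rightarrow> real set \<Rightarrow> 'w measure" where
  "cond_law M Y A = uniform_measure M (Y -` A \<inter> space M)"

text \<open>\<open>m\<close> is a version of the regression function \<open>y \<mapsto> E[X | Y = y]\<close>.\<close>

definition cond_mean_curve ::
  "'w measure \<Rightarrow> ('w \<Rightarrow> 'h::{real_inner, banach, second_countable_topology}) \<Rightarrow> ('w \<Rightarrow> real)
     \<Rightarrow> (real \<Rightarrow> 'h) \<Rightarrow> bool" where
  "cond_mean_curve M X Y m \<longleftrightarrow> m \<in> borel_measurable borel \<and> integrable M (\<lambda>\<omega>. m (Y \<omega>)) \<and>
     (\<forall>B\<in>sets borel. (LINT \<omega>:(Y -` B \<inter> space M)|M. m (Y \<omega>)) = (LINT \<omega>:(Y -` B \<inter> space M)|M. X \<omega>))"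


section \<open>Weak sliced stability\<close>

definition closed_slice :: "(nat \<Rightarrow> ereal) \<Rightarrow> nat \<Rightarrow> real set" where
  "closed_slice a h = {y. a h \<le> ereal y \<and> ereal y \<le> a (Suc h)}"

definition gamma_partition ::
  "real \<Rightarrow> 'w measure \<Rightarrow> ('w \<Rightarrow> real) \<Rightarrow> nat \<Rightarrow> (nat \<Rightarrow> ereal) \<Rightarrow> bool" where
  "gamma_partition \<gamma> M Y H a \<longleftrightarrow> a 0 = -\<infinity> \<and> a H = \<infinity> \<and> (\<forall>h<H. a h < a (Suc h)) \<and>
     (\<forall>h<H. (1 - \<gamma>) / real H \<le> measure M (Y -` closed_slice a h \<inter> space M) \<and>
            measure M (Y -` closed_slice a h \<inter> space M) \<le> (1 + \<gamma>) / real H)"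

definition weak_sliced_stable ::
  "real \<Rightarrow> nat \<Rightarrow> real \<Rightarrow> 'w measure \<Rightarrow> ('w \<Rightarrow> real) \<Rightarrow> (real \<Rightarrow> 'h::real_inner) \<Rightarrow> bool" where
  "weak_sliced_stable \<gamma> K \<tau> M Y \<kappa> \<longleftrightarrow> 0 < K \<and> 1 < \<tau> \<and> continuous_on UNIV \<kappa> \<and>
     (\<forall>H\<ge>K. \<forall>a. gamma_partition \<gamma> M Y H a \<longrightarrow> (\<forall>u. norm u = 1 \<longrightarrow>
        1 / real H * (\<Sum>h<H. var_real (cond_law M Y (closed_slice a h)) (\<lambda>\<omega>. u \<bullet> \<kappa> (Y \<omega>)))
          \<le> 1 / \<tau> * var_real M (\<lambda>\<omega>. u \<bullet> \<kappa> (Y \<omega>))))"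


section \<open>Slices of a sample\<close>

text \<open>
  A sample of size \<open>n\<close> is given by \<open>x i\<close>, \<open>y i\<close> for \<open>i < n\<close>; order statistics, slices and positions
  within slices are numbered from 1. Ties (a null event when \<open>Y\<close> has no atoms) are broken by index,
  \<open>sort_key\<close> being stable.
\<close>

definition order_index :: "nat \<Rightarrow> (nat \<Rightarrow> real) \<Rightarrow> nat \<Rightarrow> nat" where
  "order_index n y k = sort_key y [0..<n] ! (k - 1)"

definition order_stat :: "nat \<Rightarrow> (nat \<Rightarrow> real) \<Rightarrow> nat \<Rightarrow> real" where
  "order_stat n y k = y (order_index n y k)"

definition concomitant :: "nat \<Rightarrow> (nat \<Rightarrow> 'h) \<Rightarrow> (nat \<Rightarrow> real) \<Rightarrow> nat \<Rightarrow> 'h" where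
  "concomitant n x y k = x (order_index n y k)"

definition slice :: "nat \<Rightarrow> nat \<Rightarrow> (nat \<Rightarrow> real) \<Rightarrow> nat \<Rightarrow> real set" where
  "slice H c y h = {t. (h = 1 \<or> order_stat (H * c) y (c * (h - 1)) < t) \<and>
                       (h = H \<or> t \<le> order_stat (H * c) y (c * h))}"

definition slice_mean ::
  "nat \<Rightarrow> nat \<Rightarrow> (nat \<Rightarrow> 'h::real_vector) \<Rightarrow> (nat \<Rightarrow> real) \<Rightarrow> nat \<Rightarrow> 'h" where
  "slice_mean H c x y h = (1 / real c) *\<^sub>R (\<Sum>j=1..c. concomitant (H * c) x y (c * (h - 1) + j))"

definition Gamma_hat ::
  "nat \<Rightarrow> nat \<Rightarrow> (nat \<Rightarrow> 'h::real_inner) \<Rightarrow> (nat \<Rightarrow> real) \<Rightarrow> 'h \<Rightarrow> 'h" where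
  "Gamma_hat H c x y u =
     (1 / real H) *\<^sub>R (\<Sum>h=1..H. tensor (slice_mean H c x y h) (slice_mean H c x y h) u)"

definition Gamma_tilde ::
  "'w measure \<Rightarrow> ('w \<Rightarrow> 'h::{real_inner, banach, second_countable_topology}) \<Rightarrow> ('w \<Rightarrow> real)
     \<Rightarrow> nat \<Rightarrow> nat \<Rightarrow> (nat \<Rightarrow> real) \<Rightarrow> 'h \<Rightarrow> 'h" where
  "Gamma_tilde M X Y H c y u = (1 / real H) *\<^sub>R (\<Sum>h=1..H.
     tensor (integral\<^sup>L (cond_law M Y (slice H c y h)) X)
            (integral\<^sup>L (cond_law M Y (slice H c y h)) X) u)"

end

theory Submission
  imports Defs
begin

text \<open>
  Write \<open>V(u) = E (u \<bullet> m(Y))\<^sup>2\<close> for the quadratic form of \<open>\<Gamma>e\<close> (\<open>central_form\<close>) and \<open>F\<close> for the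
  distribution function of \<open>Y\<close>, which is continuous.

  Both claims rest on one deterministic fact, \<open>slice_form_close\<close>: if \<open>H\<close> is large and the cut points
  \<open>b h\<close> satisfy \<open>\<bar>F(b h) - h/H\<bar> \<le> \<gamma>/(2H)\<close>, then the quadratic form of the slice means
  \<open>E[X | Y \<in> slice]\<close>, averaged with weights \<open>1/H\<close>, differs from \<open>V\<close> by at most \<open>(3/\<tau>) V\<close>. Such cuts form a
  \<open>\<gamma>\<close>-partition, so sliced stability bounds the average variance within the slices by \<open>V/\<tau>\<close>. What is
  left is the error of weighting every slice by \<open>1/H\<close> instead of its probability. It equals
  \<open>E[w(Y) (u \<bullet> m(Y))\<^sup>2]\<close> for a weight \<open>w\<close> that is constant on slices, bounded by \<open>\<gamma>/(1-\<gamma>)\<close>, and has integral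
  at most \<open>2/H\<close> in absolute value over every half-line \<open>{Y \<le> x}\<close>. Since \<open>m\<close> is continuous and \<open>m(Y)\<close> is
  square-integrable, \<open>m\<close> is approximated in mean square by a step function with finitely many steps, and
  against a step function such a weight is negligible once \<open>H\<close> is large (\<open>weighted_moment_small\<close>). This
  gives at most \<open>(2/\<tau>) V\<close>, uniformly in \<open>u\<close>, because \<open>V\<close> is bounded below by the smallest positive
  eigenvalue on the finite-dimensional range of \<open>\<Gamma>e\<close> (\<open>lambda_min_pos_coercive\<close>) and vanishes on its
  complement.

  For the first claim, Hoeffding's inequality for the number of observations below the points where
  \<open>F = h/H \<plusminus> \<gamma>/(2H)\<close> shows that the order statistics that cut the sample are admissible cut points, except on
  an event of probability at most \<open>2H exp(-\<gamma>\<^sup>2 n/(2H\<^sup>2))\<close> (\<open>prob_tame\<close>), which is below the required bound.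

  For the second claim the same fact is applied to the exact quantiles \<open>q h\<close> with \<open>F(q h) = h/H\<close>. The
  resulting deterministic operator vanishes on the complement of the range of \<open>\<Gamma>e\<close> and, as \<open>\<tau> > 6\<close>, is
  at least half the smallest positive eigenvalue of \<open>\<Gamma>e\<close> on that range. By the Davis-Kahan argument the
  squared projection error is at most a constant times the sum of the squared deviations of the sample slice
  means from the slice means at the quantiles (\<open>projection_error_bound\<close>). On the event above such a deviation
  has three parts (\<open>slice_mean_deviation\<close>): the residuals \<open>X - m(Y)\<close> summed over a sample slice, which are
  uncorrelated even though the slice is random, because it is determined by the responses alone; the effect of
  moving the cuts from the order statistics to the quantiles, which is controlled by the number of observations
  below a quantile because \<open>m\<close> is bounded near the quantiles; and a centred sum of independent terms. Each
  has mean square of order \<open>1/n\<close>, and the exceptional event has exponentially small probability.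
\<close>

section \<open>Orthonormal systems and finite-rank operators\<close>

definition orthonormal :: "'h::real_inner set \<Rightarrow> bool" where
  "orthonormal E \<longleftrightarrow> (\<forall>x\<in>E. \<forall>y\<in>E. x \<bullet> y = (if x = y then 1 else 0))"

text \<open>For orthonormal \<open>E\<close> this is the orthogonal projection onto \<open>span E\<close>, in a form that is linear by
  definition; \<open>orth_proj_span\<close> links it to the abstract projection.\<close>

definition proj :: "'h::real_inner set \<Rightarrow> 'h \<Rightarrow> 'h" where
  "proj E u = (\<Sum>e\<in>E. (u \<bullet> e) *\<^sub>R e)"

lemma orthonormal_norm: "orthonormal E \<Longrightarrow> e \<in> E \<Longrightarrow> norm e = 1"
  by (simp add: orthonormal_def norm_eq_sqrt_inner)

lemma inner_orthonormal_sum: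
  assumes "finite E" "orthonormal E" "e \<in> E"
  shows "(\<Sum>x\<in>E. c x *\<^sub>R x) \<bullet> e = c e"
proof -
  have "(\<Sum>x\<in>E. c x *\<^sub>R x) \<bullet> e = (\<Sum>x\<in>E. if x = e then c x else 0)"
    unfolding inner_sum_left using assms by (intro sum.cong) (auto simp: orthonormal_def)
  then show ?thesis using assms by simp
qed

lemma norm_orthonormal_sum:
  assumes "finite E" "orthonormal E"
  shows "(norm (\<Sum>x\<in>E. c x *\<^sub>R x))\<^sup>2 = (\<Sum>x\<in>E. (c x)\<^sup>2)"
proof -
  have "(norm (\<Sum>x\<in>E. c x *\<^sub>R x))\<^sup>2 = (\<Sum>y\<in>E. c y * ((\<Sum>x\<in>E. c x *\<^sub>R x) \<bullet> y))"
    by (simp add: power2_norm_eq_inner inner_sum_right)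
  then show ?thesis using assms
    by (simp add: inner_orthonormal_sum power2_eq_square)
qed

lemma linear_proj: "linear (proj E)"
  unfolding proj_def
  by (rule linearI) (simp_all add: inner_add_left scaleR_add_left sum.distrib scaleR_sum_right)

lemma proj_in_span: "proj E u \<in> span E"
  unfolding proj_def by (intro span_sum span_scale span_base)

lemma inner_proj:
  assumes "finite E" "orthonormal E" "e \<in> E"
  shows "proj E u \<bullet> e = u \<bullet> e"
  using inner_orthonormal_sum[OF assms] by (simp add: proj_def)

lemma orth_span:
  assumes "\<And>e. e \<in> E \<Longrightarrow> u \<bullet> e = 0" "s \<in> span E"
  shows "u \<bullet> s = 0"
  using assms(2)
proof (induction rule: span_induct_alt)
  case (step c x y) then show ?case by (simp add: inner_add_right assms(1))
qed simp

lemma proj_residual: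
  assumes "finite E" "orthonormal E" "s \<in> span E"
  shows "(u - proj E u) \<bullet> s = 0"
  by (rule orth_span[OF _ assms(3)]) (simp add: inner_diff_left inner_proj[OF assms(1,2)])

lemma proj_id:
  assumes "finite E" "orthonormal E" "u \<in> span E"
  shows "proj E u = u"
proof -
  have "u - proj E u \<in> span E" by (intro span_diff assms proj_in_span)
  from proj_residual[OF assms(1,2) this, of u] show ?thesis by simp
qed

lemma proj_null: "(\<And>e. e \<in> E \<Longrightarrow> u \<bullet> e = 0) \<Longrightarrow> proj E u = 0"
  by (simp add: proj_def)

lemma inner_proj_commute: "proj E u \<bullet> v = u \<bullet> proj E v"
  by (simp add: proj_def inner_sum_left inner_sum_right inner_commute mult.commute)

lemma norm_proj:
  assumes "finite E" "orthonormal E"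
  shows "(norm u)\<^sup>2 = (norm (proj E u))\<^sup>2 + (norm (u - proj E u))\<^sup>2"
  using proj_residual[OF assms proj_in_span, of u u]
  by (simp add: power2_norm_eq_inner inner_diff_left inner_diff_right inner_commute)

lemma norm_proj_le:
  assumes "finite E" "orthonormal E"
  shows "norm (proj E u) \<le> norm u" "norm (u - proj E u) \<le> norm u"
  using norm_proj[OF assms, of u] by (auto intro: power2_le_imp_le)

lemma bounded_linear_proj:
  assumes "finite E" "orthonormal E"
  shows "bounded_linear (proj E)"
  using linear_proj[of E] norm_proj_le[OF assms]
  by (auto simp: bounded_linear_def bounded_linear_axioms_def intro!: exI[of _ 1])

lemma closed_span_orthonormal:
  assumes "finite E" "orthonormal E"
  shows "closed (span E)"
proof -
  have "span E = {u. proj E u = u}"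
    using proj_id[OF assms] proj_in_span by (metis (mono_tags) mem_Collect_eq set_eqI)
  then show ?thesis
    using linear_continuous_on[OF bounded_linear_proj[OF assms]]
    by (auto intro!: closed_Collect_eq)
qed

lemma orth_proj_span:
  assumes "finite E" "orthonormal E"
  shows "orth_proj (span E) u = proj E u"
  unfolding orth_proj_def
proof (rule the_equality)
  show "proj E u \<in> span E \<and> (\<forall>s\<in>span E. (u - proj E u) \<bullet> s = 0)"
    using proj_in_span proj_residual[OF assms] by auto
  fix p assume p: "p \<in> span E \<and> (\<forall>s\<in>span E. (u - p) \<bullet> s = 0)"
  let ?r = "p - proj E u"
  have r: "?r \<in> span E" using p proj_in_span by (auto intro: span_diff)
  have "?r \<bullet> ?r = (u - proj E u) \<bullet> ?r - (u - p) \<bullet> ?r" by (simp add: inner_diff_left)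
  also have "\<dots> = 0" using p r proj_residual[OF assms r] by auto
  finally show "p = proj E u" by simp
qed

lemma orthonormal_independent:
  assumes "finite E" "orthonormal E"
  shows "independent E"
proof (rule independent_if_scalars_zero[OF assms(1)])
  fix f x assume "(\<Sum>x\<in>E. f x *\<^sub>R x) = 0" "x \<in> E"
  then show "f x = 0" using inner_orthonormal_sum[OF assms, of x f] by simp
qed

lemma orthonormal_insert:
  assumes "orthonormal E" "norm v = 1" "\<And>e. e \<in> E \<Longrightarrow> v \<bullet> e = 0"
  shows "orthonormal (insert v E)" "v \<notin> E"
proof -
  have vv: "v \<bullet> v = 1" using assms(2) by (simp add: power2_norm_eq_inner[symmetric])
  then show "v \<notin> E" using assms(3) by fastforce
  have "e \<bullet> v = 0" if "e \<in> E" for e using assms(3)[OF that] by (simp add: inner_commute)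
  with vv \<open>v \<notin> E\<close> show "orthonormal (insert v E)" using assms(1,3)
    by (auto simp: orthonormal_def)
qed

text \<open>Cardinalities of orthonormal subsets of \<open>span B\<close> are bounded by \<open>card B\<close>, so one of largest
  cardinality exists among those with property \<open>P\<close>; no unit vector with property \<open>P\<close> can then be orthogonal
  to all of it. With \<open>P\<close> membership in a subspace this replaces the Gram-Schmidt process; with \<open>P\<close> the
  property of being an eigenvector it gives the spectral theorem.\<close>

lemma orthonormal_maximal:
  fixes B :: "'h::real_inner set"
  assumes "finite B" and P: "\<And>v. P v \<Longrightarrow> v \<in> span B"
  obtains E where "finite E" "orthonormal E" "\<And>e. e \<in> E \<Longrightarrow> P e"
    "\<And>v. P v \<Longrightarrow> norm v = 1 \<Longrightarrow> \<exists>e\<in>E. v \<bullet> e \<noteq> 0"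
proof -
  let ?Q = "\<lambda>E. finite E \<and> orthonormal E \<and> (\<forall>e\<in>E. P e)"
  have b: "card E \<le> card B" if "?Q E" for E
    using that independent_span_bound[OF assms(1) orthonormal_independent, of E] P by auto
  have "?Q {}" by (simp add: orthonormal_def)
  then obtain E where E: "?Q E" "\<And>E'. ?Q E' \<Longrightarrow> card E' \<le> card E"
    using ex_has_greatest_nat[of ?Q "{}" card "Suc (card B)"] b by (auto simp: less_Suc_eq_le)
  have "\<exists>e\<in>E. v \<bullet> e \<noteq> 0" if v: "P v" "norm v = 1" for v
  proof (rule ccontr)
    assume "\<not> ?thesis"
    then have "orthonormal (insert v E)" "v \<notin> E"
      using orthonormal_insert[of E v] E(1) v by auto
    then show False using E(2)[of "insert v E"] E(1) v by auto
  qed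
  with E(1) show ?thesis by (intro that[of E]) auto
qed

lemma orthonormal_basis_exists:
  fixes S :: "'h::real_inner set"
  assumes "finite B" "S \<subseteq> span B" "subspace S"
  obtains E where "finite E" "orthonormal E" "span E = S"
proof -
  obtain E where E: "finite E" "orthonormal E" "\<And>e. e \<in> E \<Longrightarrow> e \<in> S"
    "\<And>v. v \<in> S \<Longrightarrow> norm v = 1 \<Longrightarrow> \<exists>e\<in>E. v \<bullet> e \<noteq> 0"
    by (rule orthonormal_maximal[OF assms(1), of "\<lambda>v. v \<in> S"]) (use assms(2) in auto)
  have sub: "span E \<subseteq> S" using E(3) assms(3) by (auto intro: span_minimal[THEN subsetD])
  have "s \<in> span E" if s: "s \<in> S" for s
  proof (rule ccontr)
    assume ns: "s \<notin> span E"
    define r where "r = s - proj E s"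
    have r: "r \<in> S" "r \<noteq> 0"
      using s sub proj_in_span[of E s] ns by (auto simp: r_def intro: subspace_diff assms)
    have "\<exists>e\<in>E. (r /\<^sub>R norm r) \<bullet> e \<noteq> 0"
      using r by (intro E(4)) (auto intro: subspace_scale assms)
    then show False using proj_residual[OF E(1,2) span_base] by (auto simp: r_def)
  qed
  with sub have "span E = S" by blast
  with E(1,2) show ?thesis by (rule that)
qed

text \<open>A step towards compactness of finite-dimensional unit spheres, in a space that is not itself
  locally compact: the set is a continuous image of a cube, treated one coordinate at a time.\<close>

lemma compact_bounded_combinations:
  fixes E :: "'h::real_inner set"
  assumes "finite E"
  shows "compact {\<Sum>e\<in>E. c e *\<^sub>R e |c. \<forall>e\<in>E. \<bar>c e\<bar> \<le> (1::real)}"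
  using assms
proof (induction E)
  case (insert v E)
  let ?K = "{\<Sum>e\<in>E. c e *\<^sub>R e |c. \<forall>e\<in>E. \<bar>c e\<bar> \<le> (1::real)}"
  have "compact ((\<lambda>(a, k). a *\<^sub>R v + k) ` ({-1..1} \<times> ?K))"
    by (intro compact_continuous_image compact_Times insert.IH compact_Icc)
      (auto intro!: continuous_intros simp: case_prod_beta)
  also have "(\<lambda>(a, k). a *\<^sub>R v + k) ` ({-1..1} \<times> ?K)
      = {\<Sum>e\<in>insert v E. c e *\<^sub>R e |c. \<forall>e\<in>insert v E. \<bar>c e\<bar> \<le> (1::real)}" (is "?L = ?R")
  proof
    show "?L \<subseteq> ?R"
    proof safe
      fix a :: real and c :: "'h \<Rightarrow> real" assume a: "a \<in> {-1..1}" and c: "\<forall>e\<in>E. \<bar>c e\<bar> \<le> 1"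
      have "(\<Sum>e\<in>E. (c(v := a)) e *\<^sub>R e) = (\<Sum>e\<in>E. c e *\<^sub>R e)"
        using insert by (intro sum.cong) auto
      then show "\<exists>c'. a *\<^sub>R v + (\<Sum>e\<in>E. c e *\<^sub>R e) = (\<Sum>e\<in>insert v E. c' e *\<^sub>R e)
          \<and> (\<forall>e\<in>insert v E. \<bar>c' e\<bar> \<le> 1)"
        using a c insert by (intro exI[of _ "c(v := a)"]) auto
    qed
    show "?R \<subseteq> ?L"
    proof safe
      fix c :: "'h \<Rightarrow> real" assume c: "\<forall>e\<in>insert v E. \<bar>c e\<bar> \<le> 1"
      show "(\<Sum>e\<in>insert v E. c e *\<^sub>R e) \<in> ?L"
        using c insert by (intro image_eqI[of _ _ "(c v, \<Sum>e\<in>E. c e *\<^sub>R e)"]) auto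
    qed
  qed
  finally show ?case .
qed simp

lemma compact_unit_sphere_span:
  assumes "finite E" "orthonormal E"
  shows "compact {u \<in> span E. norm u = 1}"
proof -
  let ?K = "{\<Sum>e\<in>E. c e *\<^sub>R e |c. \<forall>e\<in>E. \<bar>c e\<bar> \<le> (1::real)}"
  have "{u \<in> span E. norm u = 1} = ?K \<inter> {u \<in> span E. norm u = 1}"
  proof -
    have "u \<in> ?K" if "u \<in> span E" "norm u = 1" for u
    proof -
      have "\<bar>u \<bullet> e\<bar> \<le> 1" if "e \<in> E" for e
        using Cauchy_Schwarz_ineq2[of u e] orthonormal_norm[OF assms(2) that] \<open>norm u = 1\<close> by simp
      then show ?thesis using proj_id[OF assms that(1)] by (force simp: proj_def)
    qed
    then show ?thesis by blast
  qed
  also have "{u \<in> span E. norm u = 1} = span E \<inter> {u. norm u = 1}" by auto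
  also have "compact (?K \<inter> (span E \<inter> {u. norm u = 1}))"
    by (intro compact_Int_closed compact_bounded_combinations assms closed_Int closed_span_orthonormal
        closed_Collect_eq continuous_intros)
  finally show ?thesis by (simp add: Collect_conj_eq)
qed

text \<open>A dimension count: if no such vector existed, the linear map \<open>proj W\<close> would embed \<open>span U\<close> into the
  smaller space \<open>span W\<close>. This supplies the test vectors for the min-max comparison of eigenvalues.\<close>

lemma exists_orthogonal_vector:
  fixes U :: "'h::real_inner set"
  assumes U: "finite U" "orthonormal U" and W: "finite W" "card W < card U"
  obtains u where "u \<in> span U" "norm u = 1" "\<And>w. w \<in> W \<Longrightarrow> u \<bullet> w = 0"
proof -
  have "\<exists>u\<in>span U. u \<noteq> 0 \<and> (\<forall>w\<in>W. u \<bullet> w = 0)"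
  proof (rule ccontr)
    assume no: "\<not> ?thesis"
    have inj: "inj_on (proj W) (span U)"
    proof (subst linear_inj_on_iff_eq_0[OF linear_proj subspace_span], safe)
      fix u assume u: "u \<in> span U" "proj W u = 0"
      have "(\<Sum>w\<in>W. (u \<bullet> w)\<^sup>2) = u \<bullet> proj W u"
        by (simp add: proj_def inner_sum_right power2_eq_square)
      then have "\<forall>w\<in>W. u \<bullet> w = 0" using u W by (simp add: sum_nonneg_eq_0_iff)
      with no u show "u = 0" by blast
    qed
    have "independent (proj W ` U)"
      using linear_independent_injective_image[OF linear_proj orthonormal_independent[OF U]] inj by blast
    from independent_span_bound[OF W(1) this] have "card (proj W ` U) \<le> card W"
      using proj_in_span by blast
    moreover have "card (proj W ` U) = card U"
      by (rule card_image) (rule inj_on_subset[OF inj span_superset])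
    ultimately show False using W by simp
  qed
  then obtain u where u: "u \<in> span U" "u \<noteq> 0" "\<forall>w\<in>W. u \<bullet> w = 0" by blast
  show ?thesis
    by (rule that[of "u /\<^sub>R norm u"]) (use u in \<open>auto intro: span_scale\<close>)
qed

definition psd :: "('h::real_inner \<Rightarrow> 'h) \<Rightarrow> bool" where
  "psd A \<longleftrightarrow> linear A \<and> (\<forall>u v. A u \<bullet> v = u \<bullet> A v) \<and> (\<forall>u. 0 \<le> A u \<bullet> u)"

text \<open>The discriminant of the non-negative quadratic \<open>t \<mapsto> A(u + t v) \<bullet> (u + t v)\<close>. Non-negativity is
  asked only on a subspace, since the form is later shifted by an eigenvalue and is then non-negative only on
  part of the space.\<close>

lemma cauchy_schwarz_form:
  fixes A :: "'h::real_inner \<Rightarrow> 'h"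
  assumes A: "linear A" "\<And>u v. A u \<bullet> v = u \<bullet> A v" and V: "subspace V"
    and nonneg: "\<And>u. u \<in> V \<Longrightarrow> 0 \<le> A u \<bullet> u" and uv: "u \<in> V" "v \<in> V"
  shows "(A u \<bullet> v)\<^sup>2 \<le> (A u \<bullet> u) * (A v \<bullet> v)"
proof -
  let ?a = "A u \<bullet> u" and ?b = "A u \<bullet> v" and ?c = "A v \<bullet> v"
  have q: "0 \<le> ?a + 2 * t * ?b + t\<^sup>2 * ?c" for t
  proof -
    have "0 \<le> A (u + t *\<^sub>R v) \<bullet> (u + t *\<^sub>R v)"
      by (intro nonneg subspace_add subspace_scale V uv)
    also have "\<dots> = ?a + 2 * t * ?b + t\<^sup>2 * ?c"
      using A(2)[of v u] by (simp add: linear_add[OF A(1)] linear_scale[OF A(1)] inner_add_left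
          inner_add_right power2_eq_square algebra_simps inner_commute)
    finally show ?thesis .
  qed
  show ?thesis
  proof (cases "?c = 0")
    case True
    have "?b = 0"
    proof (rule ccontr)
      assume b: "?b \<noteq> 0"
      have "2 * (- (?a + 1) / (2 * ?b)) * ?b = - (?a + 1)" using b by simp
      then show False using q[of "- (?a + 1) / (2 * ?b)"] True by simp
    qed
    then show ?thesis using True by simp
  next
    case False
    then have c: "0 < ?c" using nonneg[OF uv(2)] by simp
    have "0 \<le> ?c * (?a + 2 * (- ?b / ?c) * ?b + (- ?b / ?c)\<^sup>2 * ?c)"
      using q[of "- ?b / ?c"] c by (intro mult_nonneg_nonneg) linarith+
    also have "\<dots> = ?a * ?c - ?b\<^sup>2" using c by (simp add: field_simps power2_eq_square)
    finally show ?thesis by simp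
  qed
qed

lemma psd_null:
  assumes "psd A" "A u \<bullet> u = 0" shows "A u = 0"
proof -
  have "(A u \<bullet> A u)\<^sup>2 \<le> (A u \<bullet> u) * (A (A u) \<bullet> A u)"
    using assms(1) by (intro cauchy_schwarz_form[of A UNIV]) (auto simp: psd_def)
  then show ?thesis using assms(2) by simp
qed

text \<open>Take a maximal orthonormal set of eigenvectors with positive eigenvalue in the range. If it did not
  span the range, its complement \<open>V\<close> within the range would be invariant, and a minimiser of the Rayleigh
  quotient on the compact unit sphere of \<open>V\<close> would be one more such eigenvector.\<close>

lemma spectral_psd:
  fixes A :: "'h::real_inner \<Rightarrow> 'h"
  assumes A: "psd A" and B: "finite B" "range A \<subseteq> span B"
  obtains E l where "finite E" "orthonormal E" "span E = range A"
    "\<And>e. e \<in> E \<Longrightarrow> A e = l e *\<^sub>R e" "\<And>e. e \<in> E \<Longrightarrow> 0 < l e"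
proof -
  have lin: "linear A" and sym: "\<And>u v. A u \<bullet> v = u \<bullet> A v" and pos: "\<And>u. 0 \<le> A u \<bullet> u"
    using A by (auto simp: psd_def)
  have sr: "subspace (range A)" by (simp add: lin linear_subspace_image)
  obtain E0 where E0: "finite E0" "orthonormal E0" "span E0 = range A"
    by (rule orthonormal_basis_exists[OF B sr])
  let ?P = "\<lambda>v. v \<in> range A \<and> (\<exists>l>0. A v = l *\<^sub>R v)"
  obtain E where E: "finite E" "orthonormal E" "\<And>e. e \<in> E \<Longrightarrow> ?P e"
    "\<And>v. ?P v \<Longrightarrow> norm v = 1 \<Longrightarrow> \<exists>e\<in>E. v \<bullet> e \<noteq> 0"
    by (rule orthonormal_maximal[OF E0(1), of ?P]) (use E0(3) in auto)
  define V where "V = {v \<in> range A. \<forall>e\<in>E. v \<bullet> e = 0}"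
  have V: "subspace V"
    using sr by (auto simp: V_def subspace_def inner_add_left)
  have AV: "A v \<in> V" if "v \<in> V" for v
  proof -
    have "A v \<bullet> e = 0" if "e \<in> E" for e
      using E(3)[OF that] \<open>v \<in> V\<close> that by (auto simp: V_def sym)
    then show ?thesis by (auto simp: V_def)
  qed
  have V0: "v = 0" if v: "v \<in> V" for v
  proof (rule ccontr)
    assume nz: "v \<noteq> 0"
    let ?S = "{u \<in> V. norm u = 1}"
    have "closed V"
    proof -
      have "V = span E0 \<inter> (\<Inter>e\<in>E. {v. v \<bullet> e = 0})" by (auto simp: V_def E0)
      moreover have "closed \<dots>"
        by (intro closed_Int closed_INT ballI closed_span_orthonormal E0 closed_Collect_eq continuous_intros)
      ultimately show ?thesis by simp
    qed
    have "?S = {u \<in> span E0. norm u = 1} \<inter> V" by (auto simp: V_def E0)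
    then have comp: "compact ?S"
      using compact_Int_closed[OF compact_unit_sphere_span[OF E0(1,2)] \<open>closed V\<close>] by simp
    have ne: "?S \<noteq> {}" using v nz subspace_scale[OF V, of v "inverse (norm v)"]
      by (auto intro!: exI[of _ "v /\<^sub>R norm v"])
    have "continuous_on ?S (\<lambda>u. A u \<bullet> u)"
    proof -
      have "continuous_on (span E0) A"
      proof -
        have "A u = (\<Sum>e\<in>E0. (u \<bullet> e) *\<^sub>R A e)" if "u \<in> span E0" for u
        proof -
          have "A u = A (proj E0 u)" by (simp add: proj_id[OF E0(1,2) that])
          then show ?thesis by (simp add: proj_def linear_sum[OF lin] linear_scale[OF lin])
        qed
        then show ?thesis
          by (subst continuous_on_cong[OF refl]) (auto intro!: continuous_intros)
      qed
      then have "continuous_on ?S A"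
        by (rule continuous_on_subset) (auto simp: V_def E0)
      then show ?thesis by (intro continuous_intros)
    qed
    from continuous_attains_inf[OF comp ne this] obtain u0 where
      u0: "u0 \<in> V" "norm u0 = 1" and min: "\<And>u. u \<in> V \<Longrightarrow> norm u = 1 \<Longrightarrow> A u0 \<bullet> u0 \<le> A u \<bullet> u" by auto
    define l where "l = A u0 \<bullet> u0"
    \<comment> \<open>The shifted form is non-negative on \<open>V\<close> and vanishes at the minimiser, so by Cauchy-Schwarz \<open>A' u0\<close> is orthogonal to \<open>V\<close>.\<close>
    define A' where "A' u = A u - l *\<^sub>R u" for u
    have lin': "linear A'" unfolding A'_def
      by (intro linear_compose_sub lin linear_scaleR)
    have sym': "A' u \<bullet> v = u \<bullet> A' v" for u v
      by (simp add: A'_def inner_diff_left inner_diff_right sym)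
    have nonneg: "0 \<le> A' u \<bullet> u" if u: "u \<in> V" for u
    proof (cases "u = 0")
      case False
      let ?n = "u /\<^sub>R norm u"
      have "l \<le> A ?n \<bullet> ?n" unfolding l_def
        using u False by (intro min subspace_scale V) auto
      also have "\<dots> = (A u \<bullet> u) / (norm u)\<^sup>2"
        by (simp add: linear_scale[OF lin] power2_eq_square divide_inverse)
      finally have "l * (norm u)\<^sup>2 \<le> A u \<bullet> u" using False by (simp add: pos_le_divide_eq)
      then show ?thesis by (simp add: A'_def inner_diff_left power2_norm_eq_inner)
    qed (simp add: A'_def)
    have A'V: "A' u0 \<in> V" unfolding A'_def by (intro subspace_diff subspace_scale V AV u0)
    have "A' u0 \<bullet> u0 = 0"
      using u0 by (simp add: A'_def inner_diff_left l_def power2_norm_eq_inner[symmetric])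
    then have "(A' u0 \<bullet> A' u0)\<^sup>2 \<le> 0"
      using cauchy_schwarz_form[OF lin' sym' V nonneg u0(1) A'V] by simp
    then have eig: "A u0 = l *\<^sub>R u0" by (simp add: A'_def)
    have "l \<noteq> 0"
    proof
      assume "l = 0"
      then have "A u0 = 0" using eig by simp
      obtain w where "u0 = A w" using u0 by (auto simp: V_def)
      then have "u0 \<bullet> u0 = w \<bullet> A u0" by (metis sym)
      then show False using \<open>A u0 = 0\<close> u0 by auto
    qed
    then have "0 < l" using pos[of u0] by (simp add: l_def)
    then have "\<exists>e\<in>E. u0 \<bullet> e \<noteq> 0" using u0 eig by (intro E(4)) (auto simp: V_def)
    then show False using u0 by (auto simp: V_def)
  qed
  have "span E = range A"
  proof
    show sub: "span E \<subseteq> range A" using E(3) sr by (auto intro: span_minimal[THEN subsetD])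
    show "range A \<subseteq> span E"
    proof
      fix s assume s: "s \<in> range A"
      have "s - proj E s \<in> V"
        using s sub proj_in_span[of E s] proj_residual[OF E(1,2) span_base, of _ s] unfolding V_def
        by (auto intro: subspace_diff[OF sr])
      from V0[OF this] have "s = proj E s" by simp
      then show "s \<in> span E" using proj_in_span[of E s] by simp
    qed
  qed
  moreover obtain l where "\<And>e. e \<in> E \<Longrightarrow> A e = l e *\<^sub>R e \<and> 0 < l e" using E(3) by metis
  ultimately show ?thesis using E(1,2) by (intro that[of E l]) auto
qed

section \<open>Smallest positive eigenvalue and perturbation of eigenspaces\<close>

lemma psd_eigen_expansion:
  assumes A: "psd A" and E: "finite E" "orthonormal E" "span E = range A"
    and l: "\<And>e. e \<in> E \<Longrightarrow> A e = l e *\<^sub>R e"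
  shows "A u = (\<Sum>e\<in>E. (l e * (u \<bullet> e)) *\<^sub>R e)"
proof -
  have "A u = proj E (A u)" using proj_id[OF E(1,2), of "A u"] E(3) by auto
  also have "\<dots> = (\<Sum>e\<in>E. (l e * (u \<bullet> e)) *\<^sub>R e)"
    unfolding proj_def using A l by (intro sum.cong) (auto simp: psd_def)
  finally show ?thesis .
qed

lemma psd_eigen_quadratic:
  assumes "psd A" "finite E" "orthonormal E" "span E = range A"
    and "\<And>e. e \<in> E \<Longrightarrow> A e = l e *\<^sub>R e"
  shows "A u \<bullet> u = (\<Sum>e\<in>E. l e * (u \<bullet> e)\<^sup>2)"
proof -
  have "A u \<bullet> u = (\<Sum>e\<in>E. (l e * (u \<bullet> e)) *\<^sub>R e) \<bullet> u"
    by (rule arg_cong[where f = "\<lambda>x. x \<bullet> u"]) (rule psd_eigen_expansion[OF assms])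
  then show ?thesis unfolding inner_sum_left
    by (simp add: power2_eq_square inner_commute[of u] mult_ac)
qed

lemma norm_proj_eq_sum:
  assumes "finite E" "orthonormal E"
  shows "(norm (proj E u))\<^sup>2 = (\<Sum>e\<in>E. (u \<bullet> e)\<^sup>2)"
  unfolding proj_def by (rule norm_orthonormal_sum[OF assms])

lemma eigenvalue_in_spectrum:
  assumes "A e = l *\<^sub>R e" "e \<noteq> 0"
  shows "l \<in> spectrum_op A"
proof -
  have "\<not> (\<exists>R. bounded_linear R \<and> (\<forall>u. R (A u - l *\<^sub>R u) = u) \<and> (\<forall>u. A (R u) - l *\<^sub>R R u = u))"
  proof
    assume "\<exists>R. bounded_linear R \<and> (\<forall>u. R (A u - l *\<^sub>R u) = u) \<and> (\<forall>u. A (R u) - l *\<^sub>R R u = u)"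
    then obtain R where R: "bounded_linear R" "\<And>u. R (A u - l *\<^sub>R u) = u" by blast
    have "e = R 0" using R(2)[of e] assms(1) by simp
    then show False using assms(2) linear_0[OF bounded_linear.linear[OF R(1)]] by simp
  qed
  then show ?thesis by (simp add: spectrum_op_def)
qed

text \<open>For \<open>\<mu>\<close> neither zero nor an eigenvalue, the resolvent can be written down in the eigenbasis: it
  divides by \<open>l e - \<mu>\<close> along \<open>e\<close> and by \<open>-\<mu>\<close> on the orthogonal complement of the range.\<close>

lemma spectrum_pos_subset_eigenvalues:
  assumes A: "psd A" and E: "finite E" "orthonormal E" "span E = range A"
    and l: "\<And>e. e \<in> E \<Longrightarrow> A e = l e *\<^sub>R e"
    and \<mu>: "\<mu> \<in> spectrum_op A" "0 < \<mu>"
  shows "\<mu> \<in> l ` E"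
proof (rule ccontr)
  assume no: "\<mu> \<notin> l ` E"
  have Aeq: "A u = (\<Sum>e\<in>E. (l e * (u \<bullet> e)) *\<^sub>R e)" for u
    by (rule psd_eigen_expansion[OF A E l])
  define R where "R u = (\<Sum>e\<in>E. ((u \<bullet> e) / (l e - \<mu>)) *\<^sub>R e) - (1 / \<mu>) *\<^sub>R (u - proj E u)" for u
  have bl: "bounded_linear R"
    unfolding R_def by (intro bounded_linear_intros bounded_linear_proj E)
       (auto intro!: bounded_linear_intros simp: divide_inverse)
  have AE: "A u \<bullet> e = l e * (u \<bullet> e)" if "e \<in> E" for u e
    unfolding Aeq[of u] by (rule inner_orthonormal_sum[OF E(1,2) that])
  have pA: "proj E (A u) = A u" for u using proj_id[OF E(1,2), of "A u"] E(3) by auto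
  have 1: "R (A u - \<mu> *\<^sub>R u) = u" for u
  proof -
    have "(\<Sum>e\<in>E. (((A u - \<mu> *\<^sub>R u) \<bullet> e) / (l e - \<mu>)) *\<^sub>R e) = proj E u"
      unfolding proj_def using no
      by (intro sum.cong) (auto simp: inner_diff_left AE left_diff_distrib[symmetric])
    moreover have "(A u - \<mu> *\<^sub>R u) - proj E (A u - \<mu> *\<^sub>R u) = - \<mu> *\<^sub>R (u - proj E u)"
      by (simp add: linear_diff[OF linear_proj] linear_scale[OF linear_proj] pA algebra_simps)
    ultimately show ?thesis using \<mu>(2) by (simp add: R_def)
  qed
  have 2: "A (R u) - \<mu> *\<^sub>R R u = u" for u
  proof -
    have Re: "R u \<bullet> e = (u \<bullet> e) / (l e - \<mu>)" if "e \<in> E" for e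
      using inner_orthonormal_sum[OF E(1,2) that] that
      by (simp add: R_def inner_diff_left inner_proj[OF E(1,2) that])
    have "A (R u) - \<mu> *\<^sub>R R u
        = (\<Sum>e\<in>E. (l e * ((u \<bullet> e) / (l e - \<mu>)) - \<mu> * ((u \<bullet> e) / (l e - \<mu>))) *\<^sub>R e) + (u - proj E u)"
      unfolding Aeq[of "R u"] using \<mu>(2)
      by (simp add: Re scaleR_left_diff_distrib sum_subtractf)
        (simp add: R_def scaleR_sum_right algebra_simps)
    also have "(\<Sum>e\<in>E. (l e * ((u \<bullet> e) / (l e - \<mu>)) - \<mu> * ((u \<bullet> e) / (l e - \<mu>))) *\<^sub>R e) = proj E u"
      unfolding proj_def using no
      by (intro sum.cong) (auto simp: left_diff_distrib[symmetric] diff_divide_distrib[symmetric])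
    finally show ?thesis by simp
  qed
  show False using \<mu>(1) bl 1 2 by (auto simp: spectrum_op_def)
qed

text \<open>By the two preceding lemmas the positive spectrum is the finite set of non-zero eigenvalues, so
  the infimum in \<open>lambda_min_pos\<close> is attained and bounds the form from below on the range.\<close>

lemma lambda_min_pos_coercive:
  fixes A :: "'h::real_inner \<Rightarrow> 'h"
  assumes A: "psd A" "bounded_linear A" and B: "finite B" "range A \<subseteq> span B" and nz: "range A \<noteq> {0}"
  obtains E where "finite E" "orthonormal E" "span E = range A"
    "\<And>u. lambda_min_pos A * (norm (proj E u))\<^sup>2 \<le> A u \<bullet> u"
    "0 < lambda_min_pos A" "lambda_min_pos A \<le> onorm A"
proof -
  obtain E l where E: "finite E" "orthonormal E" "span E = range A"
    and l: "\<And>e. e \<in> E \<Longrightarrow> A e = l e *\<^sub>R e" and lp: "\<And>e. e \<in> E \<Longrightarrow> 0 < l e"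
    by (rule spectral_psd[OF A(1) B]) blast
  have ne: "E \<noteq> {}" using E(3) nz by auto
  have "e \<noteq> 0" if "e \<in> E" for e using orthonormal_norm[OF E(2) that] by auto
  then have eq: "{\<mu> \<in> spectrum_op A. 0 < \<mu>} = l ` E"
    using spectrum_pos_subset_eigenvalues[OF A(1) E, of l] eigenvalue_in_spectrum[of A] l lp by blast
  have Min: "lambda_min_pos A = Min (l ` E)"
    unfolding lambda_min_pos_def eq using E(1) ne by (intro cInf_eq_Min) auto
  have le: "lambda_min_pos A \<le> l e" if "e \<in> E" for e
    unfolding Min using E(1) that by simp
  show ?thesis
  proof (rule that[OF E])
    show "lambda_min_pos A * (norm (proj E u))\<^sup>2 \<le> A u \<bullet> u" for u
    proof -
      have "A u \<bullet> u = (\<Sum>e\<in>E. l e * (u \<bullet> e)\<^sup>2)"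
        by (rule psd_eigen_quadratic[OF A(1) E l])
      then show ?thesis unfolding norm_proj_eq_sum[OF E(1,2)] sum_distrib_left
        by (auto intro!: sum_mono mult_right_mono le)
    qed
    show "0 < lambda_min_pos A" unfolding Min using E(1) ne lp by simp
    obtain e where e: "e \<in> E" using ne by blast
    have "norm (A e) \<le> onorm A * norm e" by (rule onorm[OF A(2)])
    then have "l e \<le> onorm A" using l[OF e] lp[OF e] orthonormal_norm[OF E(2) e] by simp
    with le[OF e] show "lambda_min_pos A \<le> onorm A" by simp
  qed
qed

lemma eigensystem_orthonormal:
  assumes "eigensystem B \<mu> \<phi>"
  shows "inj \<phi>" "orthonormal (\<phi> ` I)"
proof -
  have ip: "\<phi> i \<bullet> \<phi> j = (if i = j then 1 else 0)" for i j
    using assms by (simp add: eigensystem_def)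
  show inj: "inj \<phi>"
  proof (rule injI)
    fix i j assume "\<phi> i = \<phi> j"
    then have "\<phi> i \<bullet> \<phi> j = \<phi> i \<bullet> \<phi> i" by simp
    then show "i = j" using ip by (simp split: if_splits)
  qed
  show "orthonormal (\<phi> ` I)" using ip inj by (auto simp: orthonormal_def inj_eq)
qed

text \<open>For finite combinations of eigenvectors this is a comparison of coefficients; it extends to all
  vectors because the set of vectors satisfying it is closed.\<close>

lemma eigensystem_tail_bound:
  fixes B :: "'h::real_inner \<Rightarrow> 'h"
  assumes es: "eigensystem B \<mu> \<phi>" and B: "bounded_linear B" and pos: "\<And>i. 0 \<le> \<mu> i"
  shows "norm (B (v - proj (\<phi> ` {..<k}) v)) \<le> \<mu> k * norm (v - proj (\<phi> ` {..<k}) v)"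
proof -
  interpret B: bounded_linear B by (rule B)
  let ?p = "proj (\<phi> ` {..<k})"
  have on: "orthonormal (\<phi> ` I)" for I by (rule eigensystem_orthonormal[OF es])
  have inj: "inj_on \<phi> I" for I using eigensystem_orthonormal(1)[OF es] by (rule inj_on_subset) simp
  let ?G = "{v. norm (B (v - ?p v)) \<le> \<mu> k * norm (v - ?p v)}"
  have "closed ?G"
  proof -
    have 1: "continuous_on UNIV ?p"
      by (rule linear_continuous_on[OF bounded_linear_proj[OF _ on]]) simp
    have 2: "continuous_on UNIV (\<lambda>v. B (v - ?p v))"
      by (intro B.continuous_on continuous_intros 1)
    show ?thesis by (intro closed_Collect_le continuous_intros 1 2)
  qed
  moreover have "span (range \<phi>) \<subseteq> ?G"
  proof
    fix v assume "v \<in> span (range \<phi>)"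
    then have "\<exists>N. v \<in> span (\<phi> ` {..<N})"
    proof (induction rule: span_induct_alt)
      case base
      then show ?case by (auto intro: span_zero)
    next
      case (step c x y)
      then obtain i N where "x = \<phi> i" "y \<in> span (\<phi> ` {..<N})" by blast
      moreover have "\<phi> ` {..<N} \<subseteq> \<phi> ` {..<max N (Suc i)}" by auto
      ultimately have "c *\<^sub>R x + y \<in> span (\<phi> ` {..<max N (Suc i)})"
        using span_mono[of "\<phi> ` {..<N}" "\<phi> ` {..<max N (Suc i)}"]
        by (intro span_add span_scale) (auto intro: span_base)
      then show ?case by blast
    qed
    then obtain N0 where N0: "v \<in> span (\<phi> ` {..<N0})" by blast
    define N where "N = max N0 k"
    have v: "v \<in> span (\<phi> ` {..<N})"
      using N0 span_mono[of "\<phi> ` {..<N0}" "\<phi> ` {..<N}"] by (force simp: N_def)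
    have "v = (\<Sum>i<N. (v \<bullet> \<phi> i) *\<^sub>R \<phi> i)"
      using proj_id[OF _ on v] by (simp add: proj_def sum.reindex[OF inj])
    also have "\<dots> = ?p v + (\<Sum>i\<in>{k..<N}. (v \<bullet> \<phi> i) *\<^sub>R \<phi> i)"
      using sum.atLeastLessThan_concat[of 0 k N "\<lambda>i. (v \<bullet> \<phi> i) *\<^sub>R \<phi> i"]
      by (simp add: proj_def sum.reindex[OF inj] N_def atLeast0LessThan)
    finally have r: "v - ?p v = (\<Sum>i\<in>{k..<N}. (v \<bullet> \<phi> i) *\<^sub>R \<phi> i)" by (simp add: algebra_simps)
    have nrm: "(norm (\<Sum>i\<in>{k..<N}. c i *\<^sub>R \<phi> i))\<^sup>2 = (\<Sum>i\<in>{k..<N}. (c i)\<^sup>2)" for c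
      using norm_orthonormal_sum[of "\<phi> ` {k..<N}" "\<lambda>x. c (the_inv \<phi> x)", OF _ on]
      by (simp add: sum.reindex[OF inj] the_inv_f_f[OF inj])
    have "B (v - ?p v) = (\<Sum>i\<in>{k..<N}. ((v \<bullet> \<phi> i) * \<mu> i) *\<^sub>R \<phi> i)"
      using es by (simp add: r B.sum B.scale eigensystem_def)
    then have "(norm (B (v - ?p v)))\<^sup>2 = (\<Sum>i\<in>{k..<N}. ((v \<bullet> \<phi> i) * \<mu> i)\<^sup>2)" by (simp only: nrm)
    also have "\<dots> \<le> (\<Sum>i\<in>{k..<N}. (v \<bullet> \<phi> i)\<^sup>2 * (\<mu> k)\<^sup>2)"
      using es pos by (intro sum_mono) (auto simp: eigensystem_def power_mult_distrib decseq_def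
          intro!: mult_left_mono power_mono)
    also have "\<dots> = (\<mu> k * norm (v - ?p v))\<^sup>2"
      unfolding power_mult_distrib r nrm by (simp add: sum_distrib_left mult.commute)
    finally show "v \<in> ?G" using pos[of k] by (auto intro: power2_le_imp_le)
  qed
  ultimately have "closure (span (range \<phi>)) \<subseteq> ?G" by (rule closure_minimal[rotated])
  then show ?thesis using es by (auto simp: eigensystem_def)
qed

lemma eigensystem_head_bound:
  fixes B :: "'h::real_inner \<Rightarrow> 'h"
  assumes es: "eigensystem B \<mu> \<phi>" and B: "psd B" and k: "0 < k" and u: "u \<in> span (\<phi> ` {..<k})"
  shows "\<mu> (k - 1) * (norm u)\<^sup>2 \<le> B u \<bullet> u"
proof -
  have lin: "linear B" using B by (simp add: psd_def)
  have on: "orthonormal (\<phi> ` I)" for I by (rule eigensystem_orthonormal[OF es])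
  have inj: "inj_on \<phi> I" for I using eigensystem_orthonormal(1)[OF es] by (rule inj_on_subset) simp
  have ueq: "u = (\<Sum>i<k. (u \<bullet> \<phi> i) *\<^sub>R \<phi> i)"
    using proj_id[OF _ on u] by (simp add: proj_def sum.reindex[OF inj])
  have n: "(norm u)\<^sup>2 = (\<Sum>i<k. (u \<bullet> \<phi> i)\<^sup>2)"
    using norm_proj_eq_sum[OF _ on, of "{..<k}" u] proj_id[OF _ on u] by (simp add: sum.reindex[OF inj])
  have "B u \<bullet> u = (\<Sum>i<k. \<mu> i * (u \<bullet> \<phi> i)\<^sup>2)"
  proof -
    have "B u = (\<Sum>i<k. (u \<bullet> \<phi> i) *\<^sub>R B (\<phi> i))"
      by (subst ueq) (simp add: linear_sum[OF lin] linear_scale[OF lin])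
    then have "B u \<bullet> u = (\<Sum>i<k. (u \<bullet> \<phi> i) *\<^sub>R (\<mu> i *\<^sub>R \<phi> i)) \<bullet> u"
      using es by (simp add: eigensystem_def)
    then show ?thesis unfolding inner_sum_left
      by (simp add: power2_eq_square inner_commute[of u] mult_ac)
  qed
  moreover have "(\<Sum>i<k. \<mu> (k - 1) * (u \<bullet> \<phi> i)\<^sup>2) \<le> (\<Sum>i<k. \<mu> i * (u \<bullet> \<phi> i)\<^sup>2)"
    using es by (intro sum_mono mult_right_mono) (auto simp: eigensystem_def decseq_def)
  ultimately show ?thesis by (simp add: n sum_distrib_left)
qed

text \<open>Subspace perturbation without spectral calculus. By min-max comparison \<open>B\<close> is at most \<open>\<delta>\<close> off its
  top eigenspace, with projection \<open>Q\<close>, while \<open>A\<close> is at least \<open>\<rho>\<close> on \<open>span E\<close>, with projection \<open>P\<close>. So for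
  \<open>v\<close> in the range of \<open>I - Q\<close> the chain \<open>\<rho> \<bar>P v\<bar> \<le> \<bar>A v\<bar> \<le> \<bar>B v\<bar> + \<delta> \<bar>v\<bar> \<le> 2 \<delta> \<bar>v\<bar>\<close> controls \<open>P (I - Q)\<close>, and
  exchanging the roles of the operators controls \<open>(I - P) Q\<close>; the difference of these two is \<open>Q - P\<close>.\<close>

lemma davis_kahan:
  fixes A B :: "'h::real_inner \<Rightarrow> 'h"
  assumes E: "finite E" "orthonormal E" "card E = d" "0 < d"
    and A: "psd A" "\<And>u. (\<And>e. e \<in> E \<Longrightarrow> u \<bullet> e = 0) \<Longrightarrow> A u = 0"
    and \<rho>: "0 < \<rho>" "\<And>u. u \<in> span E \<Longrightarrow> \<rho> * (norm u)\<^sup>2 \<le> A u \<bullet> u"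
    and B: "psd B" "bounded_linear B" and es: "eigensystem B \<mu> \<phi>"
    and \<delta>: "\<And>u. norm (B u - A u) \<le> \<delta> * norm u"
  shows "norm (proj (\<phi> ` {..<d}) u - proj E u) \<le> 4 * \<delta> / \<rho> * norm u"
proof -
  let ?F = "\<phi> ` {..<d}"
  let ?P = "proj E" and ?Q = "proj ?F"
  have F: "finite ?F" "orthonormal ?F" using eigensystem_orthonormal(2)[OF es] by auto
  have inj: "inj_on \<phi> I" for I using eigensystem_orthonormal(1)[OF es] by (rule inj_on_subset) simp
  have linA: "linear A" and linB: "linear B" using A(1) B(1) by (auto simp: psd_def)
  have eigB: "B (\<phi> i) = \<mu> i *\<^sub>R \<phi> i" and n\<phi>: "\<phi> i \<bullet> \<phi> i = 1" for i using es by (auto simp: eigensystem_def)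
  have mpos: "0 \<le> \<mu> i" for i
  proof -
    have "0 \<le> B (\<phi> i) \<bullet> \<phi> i" using B(1) unfolding psd_def by blast
    then show ?thesis by (simp add: eigB n\<phi>)
  qed
  have dpos: "0 \<le> \<delta>"
    using order_trans[OF norm_ge_zero \<delta>[of "\<phi> 0"]] n\<phi>[of 0] by (simp add: norm_eq_sqrt_inner)
  have Null: "A (v - ?P v) = 0" for v
    by (rule A(2)) (simp add: inner_diff_left inner_proj[OF E(1,2)])
  \<comment> \<open>Eigenvalues are indexed from 0. Among \<open>d + 1\<close> eigenvectors there is a direction orthogonal to \<open>E\<close>, where \<open>A\<close> vanishes.\<close>
  have mud: "\<mu> d \<le> \<delta>"
  proof -
    have fin: "finite (\<phi> ` {..<Suc d})" by simp
    have "card E < card (\<phi> ` {..<Suc d})" by (simp add: card_image[OF inj] E)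
    then obtain v where v: "v \<in> span (\<phi> ` {..<Suc d})" "norm v = 1" "\<And>e. e \<in> E \<Longrightarrow> v \<bullet> e = 0"
      using exists_orthogonal_vector[OF fin eigensystem_orthonormal(2)[OF es] E(1)] by blast
    have "\<mu> d \<le> B v \<bullet> v" using eigensystem_head_bound[OF es B(1) _ v(1)] v(2) by simp
    also have "\<dots> = (B v - A v) \<bullet> v" using A(2)[OF v(3)] by simp
    also have "\<dots> \<le> norm (B v - A v) * norm v" by (rule norm_cauchy_schwarz)
    also have "\<dots> \<le> \<delta>" using \<delta>[of v] v(2) by simp
    finally show ?thesis .
  qed
  \<comment> \<open>In the same way the \<open>d\<close>-th eigenvalue of \<open>B\<close> is at least \<open>\<rho> - \<delta>\<close>.\<close>
  have mud1: "\<rho> - \<delta> \<le> \<mu> (d - 1)"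
  proof -
    have "card (\<phi> ` {..<d - 1}) < card E" by (simp add: card_image[OF inj] E)
    then obtain s where s: "s \<in> span E" "norm s = 1" "\<And>e. e \<in> \<phi> ` {..<d - 1} \<Longrightarrow> s \<bullet> e = 0"
      using exists_orthogonal_vector[OF E(1,2), of "\<phi> ` {..<d - 1}"] by blast
    have "proj (\<phi> ` {..<d - 1}) s = 0" by (rule proj_null) (rule s(3))
    then have "norm (B s) \<le> \<mu> (d - 1)"
      using eigensystem_tail_bound[OF es B(2) mpos, of s "d - 1"] s(2) by simp
    moreover have "\<rho> \<le> A s \<bullet> s" using \<rho>(2)[OF s(1)] s(2) by simp
    moreover have "A s \<bullet> s \<le> norm (A s) * norm s" by (rule norm_cauchy_schwarz)
    moreover have "norm (A s) \<le> norm (B s) + \<delta>"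
      using norm_triangle_sub[of "A s" "B s"] \<delta>[of s] s(2) by (simp add: norm_minus_commute)
    ultimately show ?thesis using s(2) by simp
  qed
  have 1: "norm (?P (u - ?Q u)) \<le> 2 * \<delta> / \<rho> * norm u"
  proof -
    let ?v = "u - ?Q u"
    have "\<rho> * (norm (?P ?v))\<^sup>2 \<le> A (?P ?v) \<bullet> ?P ?v" by (rule \<rho>(2)[OF proj_in_span])
    also have "A (?P ?v) = A ?v" using Null[of ?v] by (simp add: linear_diff[OF linA])
    also have "A ?v \<bullet> ?P ?v \<le> norm (A ?v) * norm (?P ?v)" by (rule norm_cauchy_schwarz)
    finally have "(\<rho> * norm (?P ?v)) * norm (?P ?v) \<le> norm (A ?v) * norm (?P ?v)"
      by (simp add: power2_eq_square mult.assoc)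
    then have "\<rho> * norm (?P ?v) \<le> norm (A ?v)"
      by (cases "norm (?P ?v) = 0") (simp_all add: mult_le_cancel_right)
    also have "\<dots> \<le> norm (B ?v) + \<delta> * norm ?v"
      using norm_triangle_sub[of "A ?v" "B ?v"] \<delta>[of ?v] by (simp add: norm_minus_commute)
    also have "norm (B ?v) \<le> \<delta> * norm ?v"
      using eigensystem_tail_bound[OF es B(2) mpos, of u d] mult_right_mono[OF mud norm_ge_zero, of ?v]
      by simp
    also have "\<delta> * norm ?v + \<delta> * norm ?v \<le> 2 * \<delta> * norm u"
      using mult_left_mono[OF norm_proj_le(2)[OF F, of u] dpos] by simp
    finally show ?thesis using \<rho>(1) by (simp add: field_simps)
  qed
  have 2: "norm (?Q u - ?P (?Q u)) \<le> 2 * \<delta> / \<rho> * norm u"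
  \<comment> \<open>For larger \<open>\<delta>\<close> the bound exceeds the trivial one; otherwise the \<open>d\<close>-th eigenvalue is at least \<open>\<rho>/2\<close>.\<close>
  proof (cases "\<delta> \<le> \<rho> / 2")
    case True
    let ?w = "?Q u - ?P (?Q u)"
    let ?m = "\<mu> (d - 1)"
    have m: "\<rho> / 2 \<le> ?m" using mud1 True by simp
    have Aw: "A ?w = 0" by (rule Null)
    have Bv: "B (?w - ?Q ?w) \<bullet> ?Q ?w = 0"
    proof -
      have "B (?Q ?w) \<in> span ?F"
      proof -
        have "B (?Q ?w) = (\<Sum>e\<in>?F. (?w \<bullet> e) *\<^sub>R B e)"
          unfolding proj_def[of ?F ?w] by (simp add: linear_sum[OF linB] linear_scale[OF linB])
        also have "\<dots> \<in> span ?F"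
          by (intro span_sum span_scale) (auto simp: eigB intro!: span_scale[OF span_base])
        finally show ?thesis .
      qed
      then have "(?w - ?Q ?w) \<bullet> B (?Q ?w) = 0" by (rule proj_residual[OF F])
      then show ?thesis using B(1) by (simp add: psd_def)
    qed
    have "?m * (norm (?Q ?w))\<^sup>2 \<le> B (?Q ?w) \<bullet> ?Q ?w"
      by (rule eigensystem_head_bound[OF es B(1) E(4) proj_in_span])
    also have "\<dots> = B ?w \<bullet> ?Q ?w" using Bv by (simp add: linear_diff[OF linB] inner_diff_left)
    also have "\<dots> \<le> norm (B ?w) * norm (?Q ?w)" by (rule norm_cauchy_schwarz)
    also have "norm (B ?w) \<le> \<delta> * norm ?w" using \<delta>[of ?w] Aw by simp
    finally have "(?m * norm (?Q ?w)) * norm (?Q ?w) \<le> (\<delta> * norm ?w) * norm (?Q ?w)"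
      by (simp add: power2_eq_square mult.assoc mult_right_mono)
    then have "?m * norm (?Q ?w) \<le> \<delta> * norm ?w"
      using dpos by (cases "norm (?Q ?w) = 0") (simp_all add: mult_le_cancel_right)
    then have "\<rho> / 2 * norm (?Q ?w) \<le> \<delta> * norm ?w"
      using mult_right_mono[OF m norm_ge_zero, of "?Q ?w"] by linarith
    then have Qw: "norm (?Q ?w) \<le> 2 * \<delta> / \<rho> * norm ?w" using \<rho>(1) by (simp add: field_simps)
    have "(norm ?w)\<^sup>2 = ?w \<bullet> ?Q u"
      using proj_residual[OF E(1,2) proj_in_span, of "?Q u" "?Q u"]
      by (simp add: power2_norm_eq_inner inner_diff_right)
    also have "\<dots> = ?Q ?w \<bullet> u" by (rule inner_proj_commute[symmetric])
    also have "\<dots> \<le> norm (?Q ?w) * norm u" by (rule norm_cauchy_schwarz)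
    also have "\<dots> \<le> 2 * \<delta> / \<rho> * norm ?w * norm u" by (intro mult_right_mono Qw) simp
    finally have le: "norm ?w * norm ?w \<le> (2 * \<delta> / \<rho> * norm u) * norm ?w"
      by (simp add: power2_eq_square mult_ac)
    show ?thesis
    proof (cases "norm ?w = 0")
      case True
      then show ?thesis using dpos \<rho>(1) by simp
    next
      case False
      then show ?thesis using le by (intro mult_right_le_imp_le[OF le]) simp
    qed
  next
    case False
    have "norm (?Q u - ?P (?Q u)) \<le> norm u"
      using norm_proj_le(2)[OF E(1,2), of "?Q u"] norm_proj_le(1)[OF F, of u] by linarith
    also have "1 * norm u \<le> 2 * \<delta> / \<rho> * norm u"
      using False \<rho>(1) by (intro mult_right_mono) (auto simp: field_simps)
    finally show ?thesis by simp
  qed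
  have "?Q u - ?P u = (?Q u - ?P (?Q u)) - ?P (u - ?Q u)"
    by (simp add: linear_diff[OF linear_proj])
  then have "norm (?Q u - ?P u) \<le> norm (?Q u - ?P (?Q u)) + norm (?P (u - ?Q u))"
    by (metis norm_triangle_ineq4)
  also have "\<dots> \<le> 2 * \<delta> / \<rho> * norm u + 2 * \<delta> / \<rho> * norm u" by (intro add_mono 1 2)
  also have "\<dots> = 4 * \<delta> / \<rho> * norm u" by (simp add: field_simps)
  finally show ?thesis .
qed

section \<open>Conditional means given a slice and the central curve\<close>

text \<open>This also holds for slices of probability zero: the conditional law is then the zero measure, and
  division by zero yields zero on the right.\<close>

lemma (in prob_space) integral_cond_law:
  fixes f :: "'a \<Rightarrow> 'b::{banach, second_countable_topology}"
  assumes [measurable]: "Y \<in> borel_measurable M" "f \<in> borel_measurable M" "A \<in> sets borel"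
  shows "integral\<^sup>L (cond_law M Y A) f
    = (1 / prob (Y -` A \<inter> space M)) *\<^sub>R (LINT \<omega>|M. indicator A (Y \<omega>) *\<^sub>R f \<omega>)"
proof -
  let ?A = "Y -` A \<inter> space M"
  have A[measurable]: "?A \<in> sets M" by measurable
  show ?thesis
  proof (cases "prob ?A = 0")
    case True
    have "emeasure (uniform_measure M ?A) (space M) = 0"
    proof -
      have "emeasure (uniform_measure M ?A) (space M) = (\<integral>\<^sup>+x. indicator ?A x / emeasure M ?A \<partial>M)"
        unfolding uniform_measure_def by (subst emeasure_density) (auto intro!: nn_integral_cong)
      also have "\<dots> = 0"
      proof (subst nn_integral_0_iff_AE)
        have "AE x in M. x \<notin> ?A"
          using True by (intro AE_not_in) (auto simp: null_sets_def emeasure_eq_measure)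
        then show "AE x in M. indicator ?A x / emeasure M ?A = 0" by eventually_elim simp
      qed auto
      finally show ?thesis .
    qed
    then have "AE x in uniform_measure M ?A. f x = 0"
      by (intro AE_I[of _ _ "space M"]) auto
    then have "integral\<^sup>L (uniform_measure M ?A) f = 0" by (rule integral_eq_zero_AE)
    then show ?thesis using True by (simp add: cond_law_def)
  next
    case False
    have "uniform_measure M ?A = density M (\<lambda>x. ennreal (indicator ?A x / prob ?A))"
      unfolding uniform_measure_def using False
      by (intro density_cong) (auto simp: emeasure_eq_measure divide_ennreal[symmetric] zero_less_measure_iff
          split: split_indicator)
    then have "integral\<^sup>L (cond_law M Y A) f = (LINT x|M. (indicator ?A x / prob ?A) *\<^sub>R f x)"
      unfolding cond_law_def by (simp, subst integral_density) auto
    also have "\<dots> = (LINT x|M. (1 / prob ?A) *\<^sub>R indicator A (Y x) *\<^sub>R f x)"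
      by (intro Bochner_Integration.integral_cong) (auto split: split_indicator)
    also have "\<dots> = (1 / prob ?A) *\<^sub>R (LINT x|M. indicator A (Y x) *\<^sub>R f x)"
      by (rule Bochner_Integration.integral_scaleR_right)
    finally show ?thesis .
  qed
qed

locale inverse_regression = prob_space M for M :: "'w measure" +
  fixes X :: "'w \<Rightarrow> 'h::{real_inner, banach, second_countable_topology}"
    and Y :: "'w \<Rightarrow> real" and m :: "real \<Rightarrow> 'h"
  assumes X[measurable]: "X \<in> borel_measurable M" and Y[measurable]: "Y \<in> borel_measurable M"
    and no_atoms: "\<And>y. prob {\<omega> \<in> space M. Y \<omega> = y} = 0"
    and mean_zero: "expectation X = 0"
    and second_moment: "integrable M (\<lambda>\<omega>. (norm (X \<omega>))\<^sup>2)"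
    and m: "cond_mean_curve M X Y m"
    and m_continuous: "continuous_on UNIV m"
begin

lemma m_measurable[measurable]: "m \<in> borel_measurable borel"
  using m by (simp add: cond_mean_curve_def)

lemma integrable_norm_X: "integrable M (\<lambda>\<omega>. norm (X \<omega>))"
proof (rule Bochner_Integration.integrable_bound[of _ "\<lambda>\<omega>. 1 + (norm (X \<omega>))\<^sup>2"])
  have "x \<le> 1 + x\<^sup>2" if "0 \<le> x" for x :: real
    using zero_le_power2[of "x - 1"] that by (simp add: power2_eq_square algebra_simps)
  then show "AE \<omega> in M. norm (norm (X \<omega>)) \<le> norm (1 + (norm (X \<omega>))\<^sup>2)" by auto
qed (use second_moment in auto)

lemma integrable_X: "integrable M X"
  using integrable_norm_X by (simp add: integrable_norm_iff)

lemma integrable_mY: "integrable M (\<lambda>\<omega>. m (Y \<omega>))"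
  using m by (simp add: cond_mean_curve_def)

lemma integrable_bounded_comp:
  assumes [measurable]: "f \<in> borel_measurable borel" and "\<And>y. \<bar>f y\<bar> \<le> (C::real)"
  shows "integrable M (\<lambda>\<omega>. f (Y \<omega>))"
  using assms by (intro integrable_const_bound[of _ C]) auto

lemma integrable_bounded_mult:
  fixes g :: "'w \<Rightarrow> real"
  assumes w[measurable]: "w \<in> borel_measurable borel" and wb: "\<And>y. \<bar>w y\<bar> \<le> C" and g: "integrable M g"
  shows "integrable M (\<lambda>\<omega>. w (Y \<omega>) * g \<omega>)"
proof (rule Bochner_Integration.integrable_bound)
  show "integrable M (\<lambda>\<omega>. C * g \<omega>)" using g by simp
  show "AE \<omega> in M. norm (w (Y \<omega>) * g \<omega>) \<le> norm (C * g \<omega>)"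
    using wb by (auto simp: abs_mult intro!: mult_right_mono order_trans[OF wb abs_ge_self])
qed (use g in measurable)

lemma integral_indicator_Y:
  assumes [measurable]: "S \<in> sets borel"
  shows "(LINT \<omega>|M. indicator S (Y \<omega>) :: real) = prob (Y -` S \<inter> space M)"
proof -
  have "(LINT \<omega>|M. indicator S (Y \<omega>) :: real) = (LINT \<omega>|M. indicator (Y -` S \<inter> space M) \<omega>)"
    by (intro Bochner_Integration.integral_cong) (auto split: split_indicator)
  then show ?thesis by simp
qed

lemma integrable_indicator_m:
  "S \<in> sets borel \<Longrightarrow> integrable M (\<lambda>\<omega>. indicator S (Y \<omega>) *\<^sub>R m (Y \<omega>))"
  by (rule Bochner_Integration.integrable_bound[OF integrable_mY]) (auto split: split_indicator)

lemma integral_indicator_m: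
  assumes "B \<in> sets borel"
  shows "(LINT \<omega>|M. indicator B (Y \<omega>) *\<^sub>R m (Y \<omega>)) = (LINT \<omega>|M. indicator B (Y \<omega>) *\<^sub>R X \<omega>)"
proof -
  have "(LINT \<omega>:(Y -` B \<inter> space M)|M. f \<omega>) = (LINT \<omega>|M. indicator B (Y \<omega>) *\<^sub>R f \<omega>)" for f :: "'w \<Rightarrow> 'h"
    unfolding set_lebesgue_integral_def by (intro Bochner_Integration.integral_cong) (auto split: split_indicator)
  from this[of "\<lambda>\<omega>. m (Y \<omega>)"] this[of X] show ?thesis using m assms by (simp add: cond_mean_curve_def)
qed

definition sigY :: "'w measure" where "sigY = vimage_algebra (space M) Y borel"

lemma subalgebra_sigY: "subalgebra M sigY"
  unfolding subalgebra_def sigY_def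
  using measurable_sets[OF Y] by (auto simp: sets_vimage_algebra2)

sublocale cond: finite_measure_subalgebra M sigY
  by unfold_locales (rule subalgebra_sigY)

lemma measurable_sigY:
  assumes "g \<in> borel_measurable borel"
  shows "(\<lambda>\<omega>. g (Y \<omega>)) \<in> borel_measurable sigY"
  unfolding sigY_def
  by (rule measurable_compose[OF measurable_vimage_algebra1 assms]) auto

text \<open>The vector-valued curve is reduced to real conditional expectations by testing against \<open>u\<close>.\<close>

lemma cond_exp_inner:
  "AE \<omega> in M. real_cond_exp M sigY (\<lambda>\<omega>. u \<bullet> X \<omega>) \<omega> = u \<bullet> m (Y \<omega>)"
proof (rule cond.real_cond_exp_charact)
  fix A assume "A \<in> sets sigY"
  then obtain B where B: "B \<in> sets borel" "A = Y -` B \<inter> space M"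
    by (auto simp: sigY_def sets_vimage_algebra2)
  have eq: "(LINT \<omega>:A|M. u \<bullet> f \<omega>) = u \<bullet> (LINT \<omega>|M. indicator B (Y \<omega>) *\<^sub>R f \<omega>)"
    if f: "integrable M f" for f :: "'w \<Rightarrow> 'h"
  proof -
    have "integrable M (\<lambda>\<omega>. indicator B (Y \<omega>) *\<^sub>R f \<omega>)"
      using f B(1) by (intro Bochner_Integration.integrable_bound[OF f]) (auto split: split_indicator)
    from integral_inner_right[OF this, of u, symmetric] show ?thesis
      unfolding set_lebesgue_integral_def B(2)
      by (auto intro!: Bochner_Integration.integral_cong split: split_indicator)
  qed
  show "(LINT \<omega>:A|M. u \<bullet> X \<omega>) = (LINT \<omega>:A|M. u \<bullet> m (Y \<omega>))"
    by (simp add: eq integrable_X integrable_mY integral_indicator_m[OF B(1)])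
next
  show "integrable M (\<lambda>\<omega>. u \<bullet> X \<omega>)" by (rule integrable_inner_right) (rule integrable_X)
  show "integrable M (\<lambda>\<omega>. u \<bullet> m (Y \<omega>))" by (rule integrable_inner_right) (rule integrable_mY)
  show "(\<lambda>\<omega>. u \<bullet> m (Y \<omega>)) \<in> borel_measurable sigY"
    by (rule measurable_sigY) measurable
qed

text \<open>The defining property of \<open>m\<close> concerns indicators of sets only; passing through the real
  conditional expectation extends it to all bounded weights that depend on \<open>Y\<close>.\<close>

lemma residual_orthogonal:
  assumes w[measurable]: "w \<in> borel_measurable borel" and wb: "\<And>y. \<bar>w y\<bar> \<le> C"
  shows "(LINT \<omega>|M. w (Y \<omega>) * ((X \<omega> - m (Y \<omega>)) \<bullet> e)) = 0"
proof -
  have iX: "integrable M (\<lambda>\<omega>. e \<bullet> X \<omega>)" by (rule integrable_inner_right) (rule integrable_X)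
  have im: "integrable M (\<lambda>\<omega>. e \<bullet> m (Y \<omega>))" by (rule integrable_inner_right) (rule integrable_mY)
  have "(LINT \<omega>|M. w (Y \<omega>) * (e \<bullet> X \<omega>)) = (LINT \<omega>|M. w (Y \<omega>) * real_cond_exp M sigY (\<lambda>\<omega>. e \<bullet> X \<omega>) \<omega>)"
    by (rule cond.real_cond_exp_intg(2)[symmetric, OF integrable_bounded_mult[OF w wb iX] measurable_sigY[OF w]]) simp
  also have "\<dots> = (LINT \<omega>|M. w (Y \<omega>) * (e \<bullet> m (Y \<omega>)))"
    using cond_exp_inner[of e] by (intro integral_cong_AE) (auto intro!: borel_measurable_cond_exp2 elim!: eventually_mono)
  finally show ?thesis
    using integrable_bounded_mult[OF w wb iX] integrable_bounded_mult[OF w wb im] by (simp add: inner_diff_right right_diff_distrib inner_commute[of _ e])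
qed

text \<open>Conditional Jensen for the norm: \<open>u \<bullet> m(Y) \<le> \<bar>u\<bar> E[\<bar>X\<bar> | Y]\<close> holds almost surely for all \<open>u\<close> in a
  countable dense set at once, hence by continuity for \<open>u = m(Y)\<close>.\<close>

lemma norm_m_le_cond_exp:
  "AE \<omega> in M. (norm (m (Y \<omega>)))\<^sup>2 \<le> (real_cond_exp M sigY (\<lambda>\<omega>. norm (X \<omega>)) \<omega>)\<^sup>2"
proof -
  let ?r = "real_cond_exp M sigY (\<lambda>\<omega>. norm (X \<omega>))"
  obtain D :: "'h set" where D: "countable D" "\<And>S. open S \<Longrightarrow> S \<noteq> {} \<Longrightarrow> \<exists>d\<in>D. d \<in> S"
    using countable_dense_setE by blast
  have 1: "AE \<omega> in M. u \<bullet> m (Y \<omega>) \<le> norm u * ?r \<omega>" for u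
  proof -
    have "AE \<omega> in M. real_cond_exp M sigY (\<lambda>\<omega>. u \<bullet> X \<omega>) \<omega> \<le> real_cond_exp M sigY (\<lambda>\<omega>. norm u * norm (X \<omega>)) \<omega>"
      using integrable_norm_X
      by (intro cond.real_cond_exp_mono) (auto simp: integrable_X intro: norm_cauchy_schwarz)
    with cond_exp_inner[of u] cond.real_cond_exp_cmult[OF integrable_norm_X, of "norm u"]
    show ?thesis by eventually_elim simp
  qed
  have "AE \<omega> in M. \<forall>u\<in>D. u \<bullet> m (Y \<omega>) \<le> norm u * ?r \<omega>"
    using D(1) 1 by (subst AE_ball_countable) auto
  then show ?thesis
  proof eventually_elim
    fix \<omega> assume le: "\<forall>u\<in>D. u \<bullet> m (Y \<omega>) \<le> norm u * ?r \<omega>"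
    let ?G = "{u. u \<bullet> m (Y \<omega>) \<le> norm u * ?r \<omega>}"
    have "closed ?G" by (intro closed_Collect_le continuous_intros)
    then have "open (- ?G)" by (simp add: open_Compl)
    then have "- ?G = {}" using D(2)[of "- ?G"] le by blast
    then have "m (Y \<omega>) \<bullet> m (Y \<omega>) \<le> norm (m (Y \<omega>)) * ?r \<omega>" by blast
    then have "norm (m (Y \<omega>)) * norm (m (Y \<omega>)) \<le> norm (m (Y \<omega>)) * ?r \<omega>"
      by (simp add: power2_norm_eq_inner[symmetric] power2_eq_square)
    then have "norm (m (Y \<omega>)) \<le> \<bar>?r \<omega>\<bar>"
      by (cases "m (Y \<omega>) = 0") (auto simp: mult_le_cancel_left)
    then show "(norm (m (Y \<omega>)))\<^sup>2 \<le> (?r \<omega>)\<^sup>2"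
      by (metis norm_ge_zero power2_abs power_mono)
  qed
qed

lemma m_second_moment: "integrable M (\<lambda>\<omega>. (norm (m (Y \<omega>)))\<^sup>2)"
proof -
  let ?r = "real_cond_exp M sigY (\<lambda>\<omega>. norm (X \<omega>))"
  let ?s = "real_cond_exp M sigY (\<lambda>\<omega>. (norm (X \<omega>))\<^sup>2)"
  have "AE \<omega> in M. (?r \<omega>)\<^sup>2 \<le> ?s \<omega>"
    by (rule cond.real_cond_exp_jensens_inequality(2)[OF integrable_norm_X, of UNIV])
      (use second_moment in \<open>auto simp: convex_power2\<close>)
  with norm_m_le_cond_exp have le: "AE \<omega> in M. (norm (m (Y \<omega>)))\<^sup>2 \<le> ?s \<omega>" by eventually_elim simp
  show ?thesis
  proof (rule Bochner_Integration.integrable_bound)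
    show "integrable M ?s" by (rule cond.real_cond_exp_int(1)[OF second_moment])
    show "AE \<omega> in M. norm ((norm (m (Y \<omega>)))\<^sup>2) \<le> norm (?s \<omega>)" using le by eventually_elim auto
  qed measurable
qed

end

section \<open>Weights that are small in distribution\<close>

lemma square_inner_diff_le:
  fixes u a b :: "'h::real_inner"
  shows "\<bar>(u \<bullet> a)\<^sup>2 - (u \<bullet> b)\<^sup>2\<bar> \<le> (norm u)\<^sup>2 * (norm (a - b) * (norm a + norm b))"
proof -
  have "(u \<bullet> a)\<^sup>2 - (u \<bullet> b)\<^sup>2 = (u \<bullet> (a - b)) * (u \<bullet> (a + b))"
    by (simp add: inner_diff_right inner_add_right power2_eq_square algebra_simps)
  then have "\<bar>(u \<bullet> a)\<^sup>2 - (u \<bullet> b)\<^sup>2\<bar> = \<bar>u \<bullet> (a - b)\<bar> * \<bar>u \<bullet> (a + b)\<bar>" by (simp add: abs_mult)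
  also have "\<dots> \<le> (norm u * norm (a - b)) * (norm u * norm (a + b))"
    by (intro mult_mono Cauchy_Schwarz_ineq2) auto
  also have "\<dots> \<le> (norm u * norm (a - b)) * (norm u * (norm a + norm b))"
    by (intro mult_left_mono norm_triangle_ineq) auto
  finally show ?thesis by (simp add: power2_eq_square mult_ac)
qed

lemma square_inner_le: "(u \<bullet> v)\<^sup>2 \<le> (norm u)\<^sup>2 * (norm (v::'h::real_inner))\<^sup>2"
  using Cauchy_Schwarz_ineq2[of u v] by (metis abs_ge_zero power2_abs power_mono power_mult_distrib)

context inverse_regression begin

lemma integrable_square_inner: "integrable M (\<lambda>\<omega>. (u \<bullet> m (Y \<omega>))\<^sup>2)"
proof (rule Bochner_Integration.integrable_bound)
  show "integrable M (\<lambda>\<omega>. (norm u)\<^sup>2 * (norm (m (Y \<omega>)))\<^sup>2)" using m_second_moment by simp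
qed (use square_inner_le in auto)

text \<open>Replace \<open>m\<close> by its value at the next point of a fine grid on \<open>[-k, k]\<close> and by zero outside. Uniform
  continuity and the second moment keep the effect of this below \<open>2\<epsilon>/3\<close> for weights bounded by \<open>\<rho>\<close>; the step function is
  a combination of finitely many differences of indicators of half-lines, against which \<open>w\<close> integrates to at
  most \<open>\<eta>\<close>. The bounds are uniform in \<open>u\<close> because they are made for the vector \<open>m\<close> itself.\<close>

lemma weighted_moment_small:
  assumes \<epsilon>: "0 < \<epsilon>" and \<rho>: "0 < \<rho>"
  obtains \<eta> where "0 < \<eta>"
    "\<And>w u. w \<in> borel_measurable borel \<Longrightarrow> (\<And>y. \<bar>w y\<bar> \<le> \<rho>) \<Longrightarrow>
       (\<And>x. \<bar>LINT \<omega>|M. w (Y \<omega>) * indicator {..x} (Y \<omega>)\<bar> \<le> \<eta>) \<Longrightarrow>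
       \<bar>LINT \<omega>|M. w (Y \<omega>) * (u \<bullet> m (Y \<omega>))\<^sup>2\<bar> \<le> \<epsilon> * (norm u)\<^sup>2"
proof -
  define T where "T k \<omega> = indicator {y. real k \<le> \<bar>y\<bar>} (Y \<omega>) * (norm (m (Y \<omega>)))\<^sup>2" for k :: nat and \<omega>
  have T_meas[measurable]: "T k \<in> borel_measurable M" for k unfolding T_def by measurable
  have T_int: "integrable M (T k)" for k
    by (rule Bochner_Integration.integrable_bound[OF m_second_moment])
      (auto simp: T_def split: split_indicator)
  have "(\<lambda>k. integral\<^sup>L M (T k)) \<longlonglongrightarrow> (LINT \<omega>|M. 0)"
  proof (rule integral_dominated_convergence[where w = "\<lambda>\<omega>. (norm (m (Y \<omega>)))\<^sup>2"])
    show "AE \<omega> in M. (\<lambda>k. T k \<omega>) \<longlonglongrightarrow> 0"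
    proof (rule AE_I2, rule tendsto_eventually)
      fix \<omega>
      obtain k0 :: nat where "\<bar>Y \<omega>\<bar> < real k0" using reals_Archimedean2 by blast
      then show "\<forall>\<^sub>F k in sequentially. T k \<omega> = 0"
        by (intro eventually_sequentiallyI[of k0]) (auto simp: T_def split: split_indicator)
    qed
  qed (use m_second_moment in \<open>auto simp: T_def split: split_indicator\<close>)
  then have "\<forall>\<^sub>F k in sequentially. integral\<^sup>L M (T k) < \<epsilon> / (3 * \<rho>)"
    using \<epsilon> \<rho> by (intro order_tendstoD(2)) auto
  then obtain k0 where k0: "\<And>k. k \<ge> k0 \<Longrightarrow> integral\<^sup>L M (T k) < \<epsilon> / (3 * \<rho>)"
    by (auto simp: eventually_sequentially)
  define k where "k = max k0 1"
  have k: "0 < k" "integral\<^sup>L M (T k) < \<epsilon> / (3 * \<rho>)" using k0[of k] by (auto simp: k_def)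
  let ?I = "{- real k..real k}"
  have cont: "continuous_on ?I m" using m_continuous continuous_on_subset by blast
  have "\<exists>B0. \<forall>y\<in>?I. norm (m y) \<le> B0"
    using compact_imp_bounded[OF compact_continuous_image[OF cont compact_Icc]]
    by (simp add: bounded_iff)
  then obtain B0 where B0: "\<And>y. y \<in> ?I \<Longrightarrow> norm (m y) \<le> B0" by blast
  define B where "B = max B0 1"
  have B: "1 \<le> B" "\<And>y. y \<in> ?I \<Longrightarrow> norm (m y) \<le> B" using B0 by (auto simp: B_def intro: max.coboundedI1)
  have e: "0 < \<epsilon> / (6 * \<rho> * B)" using \<epsilon> \<rho> B(1) by simp
  obtain \<delta> where \<delta>: "0 < \<delta>" "\<And>s t. s \<in> ?I \<Longrightarrow> t \<in> ?I \<Longrightarrow> dist t s < \<delta> \<Longrightarrow> dist (m t) (m s) < \<epsilon> / (6 * \<rho> * B)"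
    by (rule uniformly_continuous_onE[OF compact_uniformly_continuous[OF cont compact_Icc] e]) blast
  obtain L :: nat where L: "real k / \<delta> < real L" using reals_Archimedean2 by blast
  have Lpos: "0 < L" using L k \<delta>(1) by (cases L) (auto simp: field_simps)
  define g where "g = real k / real L"
  have g: "0 < g" "g < \<delta>" "g * real L = real k"
    using L k Lpos \<delta>(1) by (auto simp: g_def field_simps)
  let ?J = "{1 - int L..int L}"
  define cell where "cell j = {g * (of_int j - 1)<..g * of_int j}" for j :: int
  have cell_iff: "y \<in> cell j \<longleftrightarrow> \<lceil>y / g\<rceil> = j" for y j
    using g(1) by (auto simp: cell_def ceiling_eq_iff field_simps)
  have [measurable]: "cell j \<in> sets borel" for j by (simp add: cell_def)
  define s where "s u y = (\<Sum>j\<in>?J. (u \<bullet> m (g * of_int j))\<^sup>2 * indicator (cell j) y)" for u :: 'h and y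
  have [measurable]: "s u \<in> borel_measurable borel" for u unfolding s_def by measurable
  have s_eq: "s u y = (if \<lceil>y / g\<rceil> \<in> ?J then (u \<bullet> m (g * of_int \<lceil>y / g\<rceil>))\<^sup>2 else 0)" for u y
  proof -
    have "s u y = (\<Sum>j\<in>?J. if j = \<lceil>y / g\<rceil> then (u \<bullet> m (g * of_int j))\<^sup>2 else 0)"
      unfolding s_def by (intro sum.cong) (auto simp: indicator_def cell_iff)
    then show ?thesis by simp
  qed
  have in_I: "g * of_int j \<in> ?I" if "j \<in> ?J" for j
  proof -
    have "- real L \<le> of_int j" "of_int j \<le> real L" using that by auto
    then have "g * (- real L) \<le> g * of_int j" "g * of_int j \<le> g * real L"
      using g(1) by (intro mult_left_mono; simp)+
    then show ?thesis using g(3) by auto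
  qed
  have mB: "norm (m (g * of_int j)) \<le> B" if "j \<in> ?J" for j by (rule B(2)[OF in_I[OF that]])
  have s_bound: "\<bar>s u y\<bar> \<le> (norm u)\<^sup>2 * B\<^sup>2" for u y
    unfolding s_eq using B mB[of "\<lceil>y / g\<rceil>"]
    by (auto intro!: order_trans[OF square_inner_le] mult_left_mono power_mono)
  have approx: "\<bar>(u \<bullet> m y)\<^sup>2 - s u y\<bar>
      \<le> (norm u)\<^sup>2 * (\<epsilon> / (3 * \<rho>) + indicator {y. real k \<le> \<bar>y\<bar>} y * (norm (m y))\<^sup>2)" for u y
  proof (cases "\<lceil>y / g\<rceil> \<in> ?J")
    case True
    let ?p = "g * of_int \<lceil>y / g\<rceil>"
    have c: "y \<in> cell \<lceil>y / g\<rceil>" by (simp add: cell_iff)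
    then have d: "dist y ?p < \<delta>" using g by (auto simp: cell_def dist_real_def algebra_simps)
    have p: "?p \<in> ?I" by (rule in_I[OF True])
    have y: "y \<in> ?I"
    proof -
      have "- real L \<le> of_int \<lceil>y / g\<rceil> - 1" using True by auto
      then have "g * (- real L) \<le> g * (of_int \<lceil>y / g\<rceil> - 1)" using g(1) by (intro mult_left_mono; simp)
      then show ?thesis using c p g(3) by (auto simp: cell_def)
    qed
    have "\<bar>(u \<bullet> m y)\<^sup>2 - s u y\<bar> \<le> (norm u)\<^sup>2 * (norm (m y - m ?p) * (norm (m y) + norm (m ?p)))"
      unfolding s_eq using True square_inner_diff_le by auto
    also have "\<dots> \<le> (norm u)\<^sup>2 * (\<epsilon> / (6 * \<rho> * B) * (B + B))"
      using \<delta>(2)[OF p y d] B(2)[OF y] B(2)[OF p] B(1) \<epsilon> \<rho>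
      by (intro mult_left_mono mult_mono add_mono) (auto simp: dist_norm)
    also have "\<epsilon> / (6 * \<rho> * B) * (B + B) = \<epsilon> / (3 * \<rho>)" using B(1) \<rho> by (simp add: field_simps)
    also have "(norm u)\<^sup>2 * (\<epsilon> / (3 * \<rho>))
        \<le> (norm u)\<^sup>2 * (\<epsilon> / (3 * \<rho>) + indicator {y. real k \<le> \<bar>y\<bar>} y * (norm (m y))\<^sup>2)"
      by (intro mult_left_mono) auto
    finally show ?thesis .
  next
    case False
    have "real k \<le> \<bar>y\<bar>"
    proof (rule ccontr)
      assume "\<not> ?thesis"
      then have yk: "- real k < y" "y < real k" by auto
      then have "- real L < y / g" "y / g < real L"
        using g(1) by (auto simp: g(3)[symmetric] field_simps)
      then have "- int L < \<lceil>y / g\<rceil>" "\<lceil>y / g\<rceil> \<le> int L"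
        by (auto simp: less_ceiling_iff ceiling_le_iff)
      with False show False by auto
    qed
    moreover have "(u \<bullet> m y)\<^sup>2 \<le> (norm u)\<^sup>2 * (norm (m y))\<^sup>2" by (rule square_inner_le)
    moreover have "0 \<le> (norm u)\<^sup>2 * (\<epsilon> / (3 * \<rho>))" using \<epsilon> \<rho> by simp
    moreover have "s u y = 0" using False by (subst s_eq) (rule if_not_P)
    ultimately show ?thesis by (simp add: algebra_simps)
  qed
  \<comment> \<open>There are \<open>2 L\<close> cells, each with coefficient at most \<open>B\<^sup>2\<close> and weight integral at most \<open>2 \<eta>\<close>, for a total of \<open>\<epsilon>/3\<close>.\<close>
  define \<eta> where "\<eta> = \<epsilon> / (12 * real L * B\<^sup>2)"
  have \<eta>: "0 < \<eta>" using \<epsilon> Lpos B(1) by (simp add: \<eta>_def)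
  show ?thesis
  proof (rule that[OF \<eta>])
    fix w :: "real \<Rightarrow> real" and u :: 'h
    assume w[measurable]: "w \<in> borel_measurable borel" and wb: "\<And>y. \<bar>w y\<bar> \<le> \<rho>"
      and small: "\<And>x. \<bar>LINT \<omega>|M. w (Y \<omega>) * indicator {..x} (Y \<omega>)\<bar> \<le> \<eta>"
    have int_s: "integrable M (\<lambda>\<omega>. s u (Y \<omega>))" by (rule integrable_bounded_comp[OF _ s_bound]) measurable
    note i1 = integrable_bounded_mult[OF w wb integrable_square_inner[of u]]
    note i2 = integrable_bounded_mult[OF w wb int_s]
    have 1: "\<bar>LINT \<omega>|M. w (Y \<omega>) * (u \<bullet> m (Y \<omega>))\<^sup>2 - w (Y \<omega>) * s u (Y \<omega>)\<bar> \<le> 2 * \<epsilon> / 3 * (norm u)\<^sup>2"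
    proof -
      have "\<bar>LINT \<omega>|M. w (Y \<omega>) * (u \<bullet> m (Y \<omega>))\<^sup>2 - w (Y \<omega>) * s u (Y \<omega>)\<bar>
          \<le> (LINT \<omega>|M. \<rho> * ((norm u)\<^sup>2 * (\<epsilon> / (3 * \<rho>) + T k \<omega>)))"
      proof (rule integral_abs_bound[THEN order_trans], rule integral_mono)
        show "integrable M (\<lambda>\<omega>. \<bar>w (Y \<omega>) * (u \<bullet> m (Y \<omega>))\<^sup>2 - w (Y \<omega>) * s u (Y \<omega>)\<bar>)"
          using i1 i2 by simp
        show "integrable M (\<lambda>\<omega>. \<rho> * ((norm u)\<^sup>2 * (\<epsilon> / (3 * \<rho>) + T k \<omega>)))" using T_int by simp
        fix \<omega>
        have "\<bar>w (Y \<omega>) * (u \<bullet> m (Y \<omega>))\<^sup>2 - w (Y \<omega>) * s u (Y \<omega>)\<bar> = \<bar>w (Y \<omega>)\<bar> * \<bar>(u \<bullet> m (Y \<omega>))\<^sup>2 - s u (Y \<omega>)\<bar>"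
          by (simp add: right_diff_distrib[symmetric] abs_mult)
        also have "\<dots> \<le> \<rho> * ((norm u)\<^sup>2 * (\<epsilon> / (3 * \<rho>) + T k \<omega>))"
          using approx[of u "Y \<omega>"] wb[of "Y \<omega>"] \<rho> by (intro mult_mono) (auto simp: T_def)
        finally show "\<bar>w (Y \<omega>) * (u \<bullet> m (Y \<omega>))\<^sup>2 - w (Y \<omega>) * s u (Y \<omega>)\<bar> \<le> \<rho> * ((norm u)\<^sup>2 * (\<epsilon> / (3 * \<rho>) + T k \<omega>))" .
      qed
      also have "\<dots> = \<rho> * ((norm u)\<^sup>2 * (\<epsilon> / (3 * \<rho>) + integral\<^sup>L M (T k)))"
        using T_int by (simp add: prob_space)
      also have "\<dots> \<le> \<rho> * ((norm u)\<^sup>2 * (\<epsilon> / (3 * \<rho>) + \<epsilon> / (3 * \<rho>)))"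
        using k(2) \<rho> by (intro mult_left_mono add_left_mono) auto
      also have "\<dots> = 2 * \<epsilon> / 3 * (norm u)\<^sup>2" using \<rho> by (simp add: field_simps)
      finally show ?thesis .
    qed
    have cell_small: "\<bar>LINT \<omega>|M. w (Y \<omega>) * indicator (cell j) (Y \<omega>)\<bar> \<le> 2 * \<eta>" for j
    proof -
      have i: "integrable M (\<lambda>\<omega>. w (Y \<omega>) * indicator {..x} (Y \<omega>))" for x
        by (rule integrable_bounded_mult[OF w wb integrable_bounded_comp[of _ 1]])
          (auto split: split_indicator)
      have "(LINT \<omega>|M. w (Y \<omega>) * indicator (cell j) (Y \<omega>))
          = (LINT \<omega>|M. w (Y \<omega>) * indicator {..g * of_int j} (Y \<omega>) - w (Y \<omega>) * indicator {..g * (of_int j - 1)} (Y \<omega>))"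
      proof (rule Bochner_Integration.integral_cong[OF refl])
        fix \<omega>
        have "g * (of_int j - 1) \<le> g * of_int j" using g(1) by simp
        then show "w (Y \<omega>) * indicator (cell j) (Y \<omega>)
            = w (Y \<omega>) * indicator {..g * of_int j} (Y \<omega>) - w (Y \<omega>) * indicator {..g * (of_int j - 1)} (Y \<omega>)"
          by (auto simp: cell_def split: split_indicator)
      qed
      also have "\<dots> = (LINT \<omega>|M. w (Y \<omega>) * indicator {..g * of_int j} (Y \<omega>))
          - (LINT \<omega>|M. w (Y \<omega>) * indicator {..g * (of_int j - 1)} (Y \<omega>))"
        by (rule Bochner_Integration.integral_diff[OF i i])
      finally show ?thesis using small[of "g * of_int j"] small[of "g * (of_int j - 1)"] by linarith
    qed
    have 2: "\<bar>LINT \<omega>|M. w (Y \<omega>) * s u (Y \<omega>)\<bar> \<le> \<epsilon> / 3 * (norm u)\<^sup>2"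
    proof -
      have i: "integrable M (\<lambda>\<omega>. w (Y \<omega>) * indicator (cell j) (Y \<omega>))" for j
        by (rule integrable_bounded_mult[OF w wb integrable_bounded_comp[of _ 1]])
          (auto split: split_indicator)
      have "(LINT \<omega>|M. w (Y \<omega>) * s u (Y \<omega>))
          = (LINT \<omega>|M. (\<Sum>j\<in>?J. (u \<bullet> m (g * of_int j))\<^sup>2 * (w (Y \<omega>) * indicator (cell j) (Y \<omega>))))"
        unfolding s_def sum_distrib_left by (simp only: mult.left_commute)
      also have "\<dots> = (\<Sum>j\<in>?J. (u \<bullet> m (g * of_int j))\<^sup>2 * (LINT \<omega>|M. w (Y \<omega>) * indicator (cell j) (Y \<omega>)))"
        using i by (subst Bochner_Integration.integral_sum) auto
      also have "\<bar>\<dots>\<bar> \<le> (\<Sum>j\<in>?J. ((norm u)\<^sup>2 * B\<^sup>2) * (2 * \<eta>))"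
      proof (rule sum_abs[THEN order_trans], rule sum_mono)
        fix j assume j: "j \<in> ?J"
        have "\<bar>(u \<bullet> m (g * of_int j))\<^sup>2\<bar> \<le> (norm u)\<^sup>2 * B\<^sup>2"
          using mB[OF j] by (auto intro!: order_trans[OF square_inner_le] mult_left_mono power_mono)
        then show "\<bar>(u \<bullet> m (g * of_int j))\<^sup>2 * (LINT \<omega>|M. w (Y \<omega>) * indicator (cell j) (Y \<omega>))\<bar>
            \<le> ((norm u)\<^sup>2 * B\<^sup>2) * (2 * \<eta>)"
          unfolding abs_mult using cell_small[of j] by (intro mult_mono) auto
      qed
      also have "\<dots> = (2 * real L) * (((norm u)\<^sup>2 * B\<^sup>2) * (2 * \<eta>))" by simp
      also have "\<dots> = \<epsilon> / 3 * (norm u)\<^sup>2" using Lpos B(1) by (simp add: \<eta>_def field_simps)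
      finally show ?thesis .
    qed
    have "(LINT \<omega>|M. w (Y \<omega>) * (u \<bullet> m (Y \<omega>))\<^sup>2 - w (Y \<omega>) * s u (Y \<omega>))
        = (LINT \<omega>|M. w (Y \<omega>) * (u \<bullet> m (Y \<omega>))\<^sup>2) - (LINT \<omega>|M. w (Y \<omega>) * s u (Y \<omega>))"
      by (rule Bochner_Integration.integral_diff[OF i1 i2])
    then show "\<bar>LINT \<omega>|M. w (Y \<omega>) * (u \<bullet> m (Y \<omega>))\<^sup>2\<bar> \<le> \<epsilon> * (norm u)\<^sup>2"
      using 1 2 by (simp add: field_simps)
  qed
qed

end

section \<open>Deterministic slices at approximate quantiles\<close>

text \<open>The slices of a sample for arbitrary cut points in place of order statistics, so that random and
  deterministic cuts can be treated alike.\<close>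

definition cut_slice :: "nat \<Rightarrow> (nat \<Rightarrow> real) \<Rightarrow> nat \<Rightarrow> real set" where
  "cut_slice H b h = {t. (h = 1 \<or> b (h - 1) < t) \<and> (h = H \<or> t \<le> b h)}"

text \<open>The same cut points with the two infinite ends added, as in \<open>gamma_partition\<close>.\<close>

definition ecut :: "nat \<Rightarrow> (nat \<Rightarrow> real) \<Rightarrow> nat \<Rightarrow> ereal" where
  "ecut H b h = (if h = 0 then - \<infinity> else if h \<ge> H then \<infinity> else ereal (b h))"

lemma slice_eq_cut_slice: "slice H c y h = cut_slice H (\<lambda>h. order_stat (H * c) y (c * h)) h"
  by (simp add: slice_def cut_slice_def)

lemma cut_slice_Suc:
  assumes "h < H"
  shows "cut_slice H b (Suc h) = {y. ecut H b h < ereal y \<and> ereal y \<le> ecut H b (Suc h)}"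
  using assms by (auto simp: cut_slice_def ecut_def)

lemma cut_slice_borel[measurable]: "cut_slice H b h \<in> sets borel"
  unfolding cut_slice_def by measurable

lemma closed_slice_borel[measurable]: "closed_slice a h \<in> sets borel"
  unfolding closed_slice_def by measurable

context inverse_regression begin

definition F :: "real \<Rightarrow> real" where "F y = prob {\<omega> \<in> space M. Y \<omega> \<le> y}"

lemma F_eq_cdf: "F = cdf (distr M borel Y)"
  by (auto simp: F_def cdf_def measure_distr fun_eq_iff intro!: arg_cong[where f = prob])

lemma F_mono: "x \<le> y \<Longrightarrow> F x \<le> F y"
  unfolding F_def by (intro finite_measure_mono) auto

lemma F_quantile:
  assumes "0 < p" "p < 1"
  obtains q where "F q = p"
proof -
  interpret D: real_distribution "distr M borel Y" by (rule real_distribution_distr) simp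
  have "measure (distr M borel Y) {y} = 0" for y
    using no_atoms[of y] by (simp add: measure_distr vimage_def Int_def conj_commute)
  then have cont: "isCont F x" for x by (simp add: F_eq_cdf D.isCont_cdf)
  have "\<forall>\<^sub>F x in at_top. p < F x"
    using D.cdf_lim_at_top_prob assms unfolding F_eq_cdf by (intro order_tendstoD(1)) auto
  then obtain b where b: "\<And>x. b \<le> x \<Longrightarrow> p < F x" by (auto simp: eventually_at_top_linorder)
  have "\<forall>\<^sub>F x in at_bot. F x < p"
    using D.cdf_lim_at_bot assms unfolding F_eq_cdf by (intro order_tendstoD(2)) auto
  then obtain a where a: "\<And>x. x \<le> a \<Longrightarrow> F x < p" by (auto simp: eventually_at_bot_linorder)
  have "F (min a b) \<le> p" "p \<le> F b" using a[of "min a b"] b[of b] by auto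
  then obtain q where "F q = p" using IVT[of F "min a b" p b] cont by auto
  then show ?thesis by (rule that)
qed

definition near_quantiles :: "real \<Rightarrow> nat \<Rightarrow> (nat \<Rightarrow> real) \<Rightarrow> bool" where
  "near_quantiles \<gamma> H b \<longleftrightarrow> (\<forall>h. 0 < h \<and> h < H \<longrightarrow> \<bar>F (b h) - real h / real H\<bar> \<le> \<gamma> / (2 * real H))"

definition slice_prob :: "nat \<Rightarrow> (nat \<Rightarrow> real) \<Rightarrow> nat \<Rightarrow> real" where
  "slice_prob H b h = prob (Y -` cut_slice H b h \<inter> space M)"

definition ecut_prob :: "nat \<Rightarrow> (nat \<Rightarrow> real) \<Rightarrow> nat \<Rightarrow> real" where
  "ecut_prob H b h = prob {\<omega> \<in> space M. ereal (Y \<omega>) \<le> ecut H b h}"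

definition central_form :: "'h \<Rightarrow> real" where "central_form u = (LINT \<omega>|M. (u \<bullet> m (Y \<omega>))\<^sup>2)"

definition slice_form :: "nat \<Rightarrow> (nat \<Rightarrow> real) \<Rightarrow> 'h \<Rightarrow> real" where
  "slice_form H b u = (1 / real H) * (\<Sum>h<H. (integral\<^sup>L (cond_law M Y (cut_slice H b (Suc h))) X \<bullet> u)\<^sup>2)"

lemma ecut_prob_near:
  assumes "near_quantiles \<gamma> H b" "0 < \<gamma>" "h \<le> H" "0 < H"
  shows "\<bar>ecut_prob H b h - real h / real H\<bar> \<le> \<gamma> / (2 * real H)"
proof -
  consider "h = 0" | "h = H" | "0 < h" "h < H" using assms(3) by linarith
  then show ?thesis
  proof cases
    case 3
    then have "ecut_prob H b h = F (b h)" by (simp add: ecut_prob_def ecut_def F_def)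
    then show ?thesis using assms(1) 3 by (simp add: near_quantiles_def)
  qed (use assms in \<open>auto simp: ecut_prob_def ecut_def prob_space\<close>)
qed

lemma AE_closed_slice:
  assumes "h < H"
  shows "AE \<omega> in M. Y \<omega> \<in> closed_slice (ecut H b) h \<longleftrightarrow> Y \<omega> \<in> cut_slice H b (Suc h)"
proof (cases "h = 0")
  case True
  then show ?thesis using assms by (auto simp: closed_slice_def cut_slice_Suc ecut_def)
next
  case False
  have "AE \<omega> in M. Y \<omega> \<noteq> b h"
    using no_atoms[of "b h"] by (subst AE_iff_measurable[OF _ refl]) (auto simp: emeasure_eq_measure)
  then show ?thesis
    by (rule eventually_mono) (use False assms in \<open>auto simp: closed_slice_def cut_slice_Suc ecut_def\<close>)
qed

context
  fixes \<gamma> :: real and H :: nat and b :: "nat \<Rightarrow> real"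
  assumes near: "near_quantiles \<gamma> H b" and \<gamma>: "0 < \<gamma>" "\<gamma> < 1" and H: "0 < H"
begin

lemma ecut_strict: "h < H \<Longrightarrow> ecut H b h < ecut H b (Suc h)"
proof (rule ccontr)
  assume h: "h < H" and "\<not> ecut H b h < ecut H b (Suc h)"
  then have le: "ecut H b (Suc h) \<le> ecut H b h" by simp
  have "ecut_prob H b (Suc h) \<le> ecut_prob H b h"
    unfolding ecut_prob_def by (intro finite_measure_mono) (auto intro: order_trans[OF _ le])
  moreover have "ecut_prob H b h < ecut_prob H b (Suc h)"
  proof -
    have "\<bar>ecut_prob H b h - real h / real H\<bar> \<le> \<gamma> / (2 * real H)"
      "\<bar>ecut_prob H b (Suc h) - real (Suc h) / real H\<bar> \<le> \<gamma> / (2 * real H)"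
      using h H by (auto intro!: ecut_prob_near[OF near \<gamma>(1)] simp del: of_nat_Suc)
    moreover have "real (Suc h) / real H = real h / real H + 1 / real H" by (simp add: add_divide_distrib)
    moreover have "2 * (\<gamma> / (2 * real H)) < 1 / real H" using \<gamma> H by (simp add: field_simps)
    ultimately show ?thesis by linarith
  qed
  ultimately show False by simp
qed

lemma ecut_mono: "i \<le> j \<Longrightarrow> j \<le> H \<Longrightarrow> ecut H b i \<le> ecut H b j"
proof (induction j rule: dec_induct)
  case (step j) then show ?case using ecut_strict[of j] by simp
qed simp

lemma slice_prob_eq: "h < H \<Longrightarrow> slice_prob H b (Suc h) = ecut_prob H b (Suc h) - ecut_prob H b h"
proof -
  assume h: "h < H"
  have "Y -` cut_slice H b (Suc h) \<inter> space M
      = {\<omega> \<in> space M. ereal (Y \<omega>) \<le> ecut H b (Suc h)} - {\<omega> \<in> space M. ereal (Y \<omega>) \<le> ecut H b h}"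
    by (auto simp: cut_slice_Suc[OF h])
  then show ?thesis unfolding slice_prob_def ecut_prob_def
    using ecut_strict[OF h] by (simp, subst finite_measure_Diff) (auto intro: order_trans less_imp_le)
qed

lemma slice_prob_near:
  assumes h: "h < H"
  shows "\<bar>slice_prob H b (Suc h) - 1 / real H\<bar> \<le> \<gamma> / real H"
proof -
  have "\<bar>ecut_prob H b h - real h / real H\<bar> \<le> \<gamma> / (2 * real H)"
    "\<bar>ecut_prob H b (Suc h) - real (Suc h) / real H\<bar> \<le> \<gamma> / (2 * real H)"
    using h H by (auto intro!: ecut_prob_near[OF near \<gamma>(1)] simp del: of_nat_Suc)
  moreover have "real (Suc h) / real H = real h / real H + 1 / real H" by (simp add: add_divide_distrib)
  moreover have "2 * (\<gamma> / (2 * real H)) = \<gamma> / real H" by simp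
  ultimately show ?thesis using slice_prob_eq[OF h] by linarith
qed

lemma slice_prob_lower: "h < H \<Longrightarrow> (1 - \<gamma>) / real H \<le> slice_prob H b (Suc h)"
  using slice_prob_near[of h] by (simp add: diff_divide_distrib)

lemma slice_prob_pos: "h < H \<Longrightarrow> 0 < slice_prob H b (Suc h)"
  using slice_prob_lower[of h] \<gamma> H by (smt (verit) divide_pos_pos of_nat_0_less_iff)

lemma gamma_partition_ecut: "gamma_partition \<gamma> M Y H (ecut H b)"
proof -
  have "prob (Y -` closed_slice (ecut H b) h \<inter> space M) = slice_prob H b (Suc h)" if "h < H" for h
    unfolding slice_prob_def using AE_closed_slice[OF that]
    by (intro measure_eq_AE) (auto elim: eventually_mono)
  moreover have "(1 - \<gamma>) / real H \<le> slice_prob H b (Suc h)" "slice_prob H b (Suc h) \<le> (1 + \<gamma>) / real H"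
    if "h < H" for h
    using slice_prob_near[OF that] by (auto simp: diff_divide_distrib add_divide_distrib)
  ultimately show ?thesis
    using ecut_strict H by (auto simp: gamma_partition_def) (auto simp: ecut_def)
qed

lemma slice_cover: obtains k where "k < H" "y \<in> cut_slice H b (Suc k)"
proof -
  let ?P = "\<lambda>k. k < H \<and> ecut H b k < ereal y"
  have P0: "?P 0" using H by (simp add: ecut_def)
  obtain k where k: "?P k" "\<And>j. ?P j \<Longrightarrow> j \<le> k"
    using ex_has_greatest_nat[of ?P 0 id H] P0 by auto
  have "ereal y \<le> ecut H b (Suc k)"
  proof (cases "Suc k < H")
    case True
    then show ?thesis using k(2)[of "Suc k"] by (auto simp: not_less[symmetric])
  next
    case False
    then show ?thesis by (simp add: ecut_def)
  qed
  then show ?thesis using k(1) that[of k] by (simp add: cut_slice_Suc)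
qed

lemma slice_unique:
  assumes "h < H" "k < H" "y \<in> cut_slice H b (Suc h)" "y \<in> cut_slice H b (Suc k)"
  shows "h = k"
proof -
  have "\<not> h < k" if "h < H" "k < H" "y \<in> cut_slice H b (Suc h)" "y \<in> cut_slice H b (Suc k)" for h k
  proof
    assume "h < k"
    then have "ecut H b (Suc h) \<le> ecut H b k" using that by (intro ecut_mono) auto
    then show False using that by (auto simp: cut_slice_Suc dest: order.strict_trans1 order.strict_trans2 leD)
  qed
  from this[of h k] this[of k h] assms show ?thesis by auto
qed

lemma sum_slice_indicator:
  fixes r :: "nat \<Rightarrow> real"
  assumes "k < H" "y \<in> cut_slice H b (Suc k)"
  shows "(\<Sum>h<H. r h * indicator (cut_slice H b (Suc h)) y) = r k"
proof -
  have "(\<Sum>h<H. r h * indicator (cut_slice H b (Suc h)) y) = (\<Sum>h<H. if h = k then r k else 0)"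
  proof (rule sum.cong[OF refl])
    fix h assume "h \<in> {..<H}"
    then have "y \<in> cut_slice H b (Suc h) \<longleftrightarrow> h = k" using slice_unique[of h k y] assms by blast
    then show "r h * indicator (cut_slice H b (Suc h)) y = (if h = k then r k else 0)"
      by (cases "h = k") simp_all
  qed
  then show ?thesis using assms(1) by simp
qed

text \<open>The density, minus one, of the measure that gives every slice mass \<open>1/H\<close> with respect to the law of
  \<open>Y\<close>.\<close>

definition slice_weight :: "real \<Rightarrow> real" where
  "slice_weight y = (\<Sum>h<H. (1 / (real H * slice_prob H b (Suc h)) - 1) * indicator (cut_slice H b (Suc h)) y)"

lemma slice_weight_measurable[measurable]: "slice_weight \<in> borel_measurable borel"
  unfolding slice_weight_def by measurable

lemma slice_weight_coeff:
  assumes h: "h < H"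
  shows "\<bar>1 / (real H * slice_prob H b (Suc h)) - 1\<bar> \<le> \<gamma> / (1 - \<gamma>)"
proof -
  let ?p = "slice_prob H b (Suc h)"
  have p: "0 < ?p" by (rule slice_prob_pos[OF h])
  have "1 / (real H * ?p) - 1 = (1 / real H - ?p) / ?p" using p H by (simp add: field_simps)
  then have "\<bar>1 / (real H * ?p) - 1\<bar> = \<bar>?p - 1 / real H\<bar> / ?p" using p by (simp add: abs_minus_commute)
  also have "\<dots> \<le> (\<gamma> / real H) / ((1 - \<gamma>) / real H)"
    using slice_prob_near[OF h] slice_prob_lower[OF h] \<gamma> H by (intro frac_le) auto
  finally show ?thesis using H by simp
qed

lemma slice_weight_bound: "\<bar>slice_weight y\<bar> \<le> \<gamma> / (1 - \<gamma>)"
proof -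
  obtain k where k: "k < H" "y \<in> cut_slice H b (Suc k)" by (rule slice_cover)
  have "slice_weight y = 1 / (real H * slice_prob H b (Suc k)) - 1"
    unfolding slice_weight_def by (rule sum_slice_indicator[OF k])
  then show ?thesis using slice_weight_coeff[OF k(1)] by simp
qed

text \<open>Full slices below \<open>x\<close> contribute \<open>1/H\<close> minus their probability each, which telescopes to
  \<open>k/H\<close> minus the distribution function at a cut; the slice that contains \<open>x\<close> contributes at most
  \<open>\<gamma>/H\<close>.\<close>

lemma slice_weight_cdf_small:
  "\<bar>LINT \<omega>|M. slice_weight (Y \<omega>) * indicator {..x} (Y \<omega>)\<bar> \<le> 2 / real H"
proof -
  obtain k where k: "k < H" "x \<in> cut_slice H b (Suc k)" by (rule slice_cover)
  define r where "r h = 1 / (real H * slice_prob H b (Suc h)) - 1" for h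
  define A where "A h = prob (Y -` (cut_slice H b (Suc h) \<inter> {..x}) \<inter> space M)" for h
  have "(LINT \<omega>|M. slice_weight (Y \<omega>) * indicator {..x} (Y \<omega>))
      = (LINT \<omega>|M. (\<Sum>h<H. r h * indicator (cut_slice H b (Suc h) \<inter> {..x}) (Y \<omega>)))"
    by (simp only: slice_weight_def r_def sum_distrib_right indicator_inter_arith mult.assoc)
  also have "\<dots> = (\<Sum>h<H. r h * A h)"
    by (subst Bochner_Integration.integral_sum)
      (auto intro!: integrable_bounded_comp[of _ 1] sum.cong simp: A_def integral_indicator_Y split: split_indicator)
  also have "\<dots> = (\<Sum>h<k. r h * A h) + r k * A k + (\<Sum>h\<in>{Suc k..<H}. r h * A h)"
  proof -
    have "(\<Sum>h<H. r h * A h) = (\<Sum>h<k. r h * A h) + (\<Sum>h\<in>{k..<H}. r h * A h)"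
      using sum.atLeastLessThan_concat[of 0 k H "\<lambda>h. r h * A h"] k(1) by (simp add: lessThan_atLeast0)
    then show ?thesis by (simp only: sum.atLeast_Suc_lessThan[OF k(1)] add.assoc)
  qed
  also have "(\<Sum>h\<in>{Suc k..<H}. r h * A h) = 0"
  proof (rule sum.neutral, safe)
    fix h assume h: "h \<in> {Suc k..<H}"
    have "cut_slice H b (Suc h) \<inter> {..x} = {}"
    proof -
      have "ecut H b (Suc k) \<le> ecut H b h" using h by (intro ecut_mono) auto
      then have "ereal x \<le> ecut H b h" using k by (auto simp: cut_slice_Suc)
      then show ?thesis using h by (auto simp: cut_slice_Suc) (meson ereal_less_eq(3) leD order_trans)
    qed
    then show "r h * A h = 0" by (simp add: A_def)
  qed
  also have "(\<Sum>h<k. r h * A h) = (\<Sum>h<k. 1 / real H - (ecut_prob H b (Suc h) - ecut_prob H b h))"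
  proof (rule sum.cong[OF refl])
    fix h assume "h \<in> {..<k}"
    then have h: "h < k" "h < H" using k by auto
    have "cut_slice H b (Suc h) \<subseteq> {..x}"
    proof -
      have "ecut H b (Suc h) \<le> ecut H b k" using h k by (intro ecut_mono) auto
      then have "ecut H b (Suc h) \<le> ereal x" using k by (auto simp: cut_slice_Suc)
      then show ?thesis using h by (auto simp: cut_slice_Suc) (meson ereal_less_eq(3) order_trans)
    qed
    then have "A h = slice_prob H b (Suc h)" by (simp add: A_def slice_prob_def Int_absorb2)
    then show "r h * A h = 1 / real H - (ecut_prob H b (Suc h) - ecut_prob H b h)"
      using slice_prob_pos[OF h(2)] H by (simp add: r_def slice_prob_eq[OF h(2), symmetric] field_simps)
  qed
  also have "\<dots> = real k / real H - (ecut_prob H b k - ecut_prob H b 0)"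
    by (simp only: sum_subtractf[of "\<lambda>_. 1 / real H"] sum_lessThan_telescope[of "ecut_prob H b"]) simp
  also have "ecut_prob H b 0 = 0" by (simp add: ecut_prob_def ecut_def)
  finally have eq: "(LINT \<omega>|M. slice_weight (Y \<omega>) * indicator {..x} (Y \<omega>))
      = real k / real H - ecut_prob H b k + r k * A k" by simp
  have "\<bar>r k * A k\<bar> \<le> \<bar>r k * slice_prob H b (Suc k)\<bar>"
    unfolding abs_mult A_def slice_prob_def
    by (intro mult_left_mono) (auto intro!: finite_measure_mono)
  also have "r k * slice_prob H b (Suc k) = 1 / real H - slice_prob H b (Suc k)"
    using slice_prob_pos[OF k(1)] H by (simp add: r_def field_simps)
  also have "\<bar>\<dots>\<bar> \<le> \<gamma> / real H" using slice_prob_near[OF k(1)] by (simp add: abs_minus_commute)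
  finally have "\<bar>r k * A k\<bar> \<le> \<gamma> / real H" .
  moreover have "\<bar>ecut_prob H b k - real k / real H\<bar> \<le> \<gamma> / (2 * real H)"
    using ecut_prob_near[OF near \<gamma>(1)] k H by auto
  moreover have "\<gamma> / real H + \<gamma> / (2 * real H) \<le> 2 / real H" using \<gamma> H by (simp add: field_simps)
  ultimately show ?thesis unfolding eq by linarith
qed

text \<open>Within a slice the squared mean is the mean square minus the variance. Summed with weights
  \<open>1/H\<close>, the mean squares give the integral of \<open>(u \<bullet> m(Y))\<^sup>2\<close> against the density \<open>1 + slice_weight\<close>.\<close>

lemma slice_form_eq:
  "slice_form H b u = central_form u + (LINT \<omega>|M. slice_weight (Y \<omega>) * (u \<bullet> m (Y \<omega>))\<^sup>2)
     - 1 / real H * (\<Sum>h<H. var_real (cond_law M Y (closed_slice (ecut H b) h)) (\<lambda>\<omega>. u \<bullet> m (Y \<omega>)))"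
proof -
  let ?S = "\<lambda>h. cut_slice H b (Suc h)"
  let ?p = "\<lambda>h. slice_prob H b (Suc h)"
  let ?g = "\<lambda>\<omega>. u \<bullet> m (Y \<omega>)"
  define I where "I h = (LINT \<omega>|M. indicator (?S h) (Y \<omega>) * (?g \<omega>)\<^sup>2)" for h
  define J where "J h = (LINT \<omega>|M. indicator (?S h) (Y \<omega>) * ?g \<omega>)" for h
  have ig: "integrable M ?g" by (rule integrable_inner_right) (rule integrable_mY)
  have ind: "integrable M (\<lambda>\<omega>. indicator (?S h) (Y \<omega>) * f \<omega>)" if "integrable M f" for h and f :: "'w \<Rightarrow> real"
    by (rule integrable_bounded_mult[OF _ _ that, of _ 1]) (auto split: split_indicator)
  have prob_ind: "(LINT \<omega>|M. indicator (?S h) (Y \<omega>)) = ?p h" for h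
    by (simp add: integral_indicator_Y slice_prob_def)
  have closed: "integral\<^sup>L (cond_law M Y (closed_slice (ecut H b) h)) f
      = (1 / ?p h) * (LINT \<omega>|M. indicator (?S h) (Y \<omega>) * f \<omega>)"
    if h: "h < H" and [measurable]: "f \<in> borel_measurable M" for h and f :: "'w \<Rightarrow> real"
  proof -
    have "prob (Y -` closed_slice (ecut H b) h \<inter> space M) = ?p h"
      unfolding slice_prob_def using AE_closed_slice[OF h]
      by (intro measure_eq_AE) (auto elim: eventually_mono)
    moreover have "(LINT \<omega>|M. indicator (closed_slice (ecut H b) h) (Y \<omega>) * f \<omega>)
        = (LINT \<omega>|M. indicator (?S h) (Y \<omega>) * f \<omega>)"
      by (intro integral_cong_AE) (measurable, rule eventually_mono[OF AE_closed_slice[OF h, of b]],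
          simp add: indicator_def)
    ultimately show ?thesis by (simp add: integral_cond_law)
  qed
  have var: "var_real (cond_law M Y (closed_slice (ecut H b) h)) ?g = I h / ?p h - (J h / ?p h)\<^sup>2" if h: "h < H" for h
  proof -
    let ?c = "J h / ?p h"
    have c: "integral\<^sup>L (cond_law M Y (closed_slice (ecut H b) h)) ?g = ?c"
      using closed[OF h, of ?g] by (simp add: J_def)
    have "(LINT \<omega>|M. indicator (?S h) (Y \<omega>) * (?g \<omega> - ?c)\<^sup>2)
        = (LINT \<omega>|M. indicator (?S h) (Y \<omega>) * (?g \<omega>)\<^sup>2 - 2 * ?c * (indicator (?S h) (Y \<omega>) * ?g \<omega>)
            + ?c\<^sup>2 * indicator (?S h) (Y \<omega>))"
      by (intro Bochner_Integration.integral_cong) (auto simp: power2_eq_square algebra_simps)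
    also have "\<dots> = I h - 2 * ?c * J h + ?c\<^sup>2 * ?p h"
      using ind[OF integrable_square_inner] ind[OF ig] ind[of "\<lambda>_. 1"] by (simp add: I_def J_def prob_ind)
    also have "\<dots> = ?p h * (I h / ?p h - (J h / ?p h)\<^sup>2)"
      using slice_prob_pos[OF h] by (simp add: field_simps power2_eq_square)
    finally have "var_real (cond_law M Y (closed_slice (ecut H b) h)) ?g
        = (1 / ?p h) * (?p h * (I h / ?p h - (J h / ?p h)\<^sup>2))"
      unfolding var_real_def c by (subst closed[OF h]) auto
    then show ?thesis using slice_prob_pos[OF h] by simp
  qed
  have mean: "integral\<^sup>L (cond_law M Y (?S h)) X \<bullet> u = J h / ?p h" for h
  proof -
    have "integral\<^sup>L (cond_law M Y (?S h)) X = (1 / ?p h) *\<^sub>R (LINT \<omega>|M. indicator (?S h) (Y \<omega>) *\<^sub>R m (Y \<omega>))"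
      by (simp add: integral_cond_law integral_indicator_m slice_prob_def)
    then have "integral\<^sup>L (cond_law M Y (?S h)) X \<bullet> u = (1 / ?p h) * (u \<bullet> (LINT \<omega>|M. indicator (?S h) (Y \<omega>) *\<^sub>R m (Y \<omega>)))"
      by (simp add: inner_commute)
    also have "u \<bullet> (LINT \<omega>|M. indicator (?S h) (Y \<omega>) *\<^sub>R m (Y \<omega>)) = J h"
      unfolding J_def by (subst integral_inner_right[symmetric]) (use integrable_indicator_m in auto)
    finally show ?thesis by simp
  qed
  have tot: "central_form u = (\<Sum>h<H. I h)"
  proof -
    have "central_form u = (LINT \<omega>|M. (\<Sum>h<H. indicator (?S h) (Y \<omega>) * (?g \<omega>)\<^sup>2))"
      unfolding central_form_def
    proof (rule Bochner_Integration.integral_cong[OF refl])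
      fix \<omega>
      obtain k where k: "k < H" "Y \<omega> \<in> ?S k" by (rule slice_cover)
      have "(\<Sum>h<H. indicator (?S h) (Y \<omega>)) = (1::real)" using sum_slice_indicator[OF k, of "\<lambda>_. 1"] by simp
      then show "(?g \<omega>)\<^sup>2 = (\<Sum>h<H. indicator (?S h) (Y \<omega>) * (?g \<omega>)\<^sup>2)"
        by (simp add: sum_distrib_right[symmetric])
    qed
    also have "\<dots> = (\<Sum>h<H. I h)"
      unfolding I_def by (rule Bochner_Integration.integral_sum) (rule ind[OF integrable_square_inner])
    finally show ?thesis .
  qed
  have w: "(LINT \<omega>|M. slice_weight (Y \<omega>) * (?g \<omega>)\<^sup>2) = (\<Sum>h<H. (1 / (real H * ?p h) - 1) * I h)"
  proof -
    have "(LINT \<omega>|M. slice_weight (Y \<omega>) * (?g \<omega>)\<^sup>2)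
        = (LINT \<omega>|M. (\<Sum>h<H. (1 / (real H * ?p h) - 1) * (indicator (?S h) (Y \<omega>) * (?g \<omega>)\<^sup>2)))"
      by (simp only: slice_weight_def sum_distrib_right mult.assoc)
    then show ?thesis unfolding I_def
      using ind[OF integrable_square_inner] by (subst (asm) Bochner_Integration.integral_sum) auto
  qed
  have "slice_form H b u = 1 / real H * (\<Sum>h<H. I h / ?p h - var_real (cond_law M Y (closed_slice (ecut H b) h)) ?g)"
    unfolding slice_form_def mean using var by (intro arg_cong[where f = "(*) (1 / real H)"] sum.cong) auto
  also have "\<dots> = (\<Sum>h<H. 1 / (real H * ?p h) * I h)
      - 1 / real H * (\<Sum>h<H. var_real (cond_law M Y (closed_slice (ecut H b) h)) ?g)"
    by (simp add: sum_subtractf right_diff_distrib sum_distrib_left)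
  also have "(\<Sum>h<H. 1 / (real H * ?p h) * I h) = central_form u + (LINT \<omega>|M. slice_weight (Y \<omega>) * (?g \<omega>)\<^sup>2)"
    unfolding tot w by (simp add: sum.distrib[symmetric] algebra_simps)
  finally show ?thesis .
qed

end

text \<open>The deterministic core of the argument. The map \<open>P\<close> stands for the projection onto the range of the
  covariance of the curve: the weight term depends on \<open>u\<close> only through \<open>P u\<close>, and the lower bound \<open>l\<close> turns the
  absolute error \<open>(2/\<tau>) l \<bar>P u\<bar>\<^sup>2\<close> into a relative one.\<close>

lemma slice_form_close:
  assumes wss: "weak_sliced_stable \<gamma> K \<tau> M Y m" and \<gamma>: "0 < \<gamma>" "\<gamma> < 1"
    and l: "0 < l" "\<And>u. l * (norm (P u))\<^sup>2 \<le> central_form u"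
    and P: "\<And>u. AE \<omega> in M. u \<bullet> m (Y \<omega>) = P u \<bullet> m (Y \<omega>)"
  obtains H0 where "K \<le> H0"
    "\<And>H b u. H0 < H \<Longrightarrow> near_quantiles \<gamma> H b \<Longrightarrow> norm u = 1 \<Longrightarrow>
      \<bar>slice_form H b u - central_form u\<bar> \<le> 3 / \<tau> * central_form u"
proof -
  have \<tau>: "1 < \<tau>" and stable: "\<And>H a u. K \<le> H \<Longrightarrow> gamma_partition \<gamma> M Y H a \<Longrightarrow> norm u = 1 \<Longrightarrow>
      1 / real H * (\<Sum>h<H. var_real (cond_law M Y (closed_slice a h)) (\<lambda>\<omega>. u \<bullet> m (Y \<omega>)))
        \<le> 1 / \<tau> * var_real M (\<lambda>\<omega>. u \<bullet> m (Y \<omega>))"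
    using wss by (auto simp: weak_sliced_stable_def)
  have "0 < 2 / \<tau> * l" "0 < \<gamma> / (1 - \<gamma>)" using \<tau> l \<gamma> by auto
  from weighted_moment_small[OF this] obtain \<eta> where \<eta>: "0 < \<eta>"
    "\<And>w u. w \<in> borel_measurable borel \<Longrightarrow> (\<And>y. \<bar>w y\<bar> \<le> \<gamma> / (1 - \<gamma>)) \<Longrightarrow>
       (\<And>x. \<bar>LINT \<omega>|M. w (Y \<omega>) * indicator {..x} (Y \<omega>)\<bar> \<le> \<eta>) \<Longrightarrow>
       \<bar>LINT \<omega>|M. w (Y \<omega>) * (u \<bullet> m (Y \<omega>))\<^sup>2\<bar> \<le> 2 / \<tau> * l * (norm u)\<^sup>2" by blast
  \<comment> \<open>Beyond this many slices the bound \<open>2/H\<close> on half-line integrals of the weight drops below \<open>\<eta>\<close>.\<close>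
  obtain n :: nat where n: "2 / \<eta> < real n" using reals_Archimedean2 by blast
  have EmY: "(LINT \<omega>|M. u \<bullet> m (Y \<omega>)) = 0" for u
  proof -
    have "(LINT \<omega>|M. m (Y \<omega>)) = 0" using integral_indicator_m[of UNIV] mean_zero by simp
    then show ?thesis using integrable_mY by simp
  qed
  show ?thesis
  proof (rule that[of "max K n"])
    fix H b and u :: 'h assume H: "max K n < H" and near: "near_quantiles \<gamma> H b" and u: "norm u = 1"
    have Hpos: "0 < H" using H by simp
    have "2 / real H \<le> \<eta>"
    proof -
      have "2 < \<eta> * real n" using n \<eta>(1) by (simp add: field_simps)
      also have "\<dots> \<le> \<eta> * real H" using H \<eta>(1) by (intro mult_left_mono) auto
      finally show ?thesis using Hpos by (simp add: field_simps)
    qed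
    then have "\<bar>LINT \<omega>|M. slice_weight H b (Y \<omega>) * (P u \<bullet> m (Y \<omega>))\<^sup>2\<bar> \<le> 2 / \<tau> * l * (norm (P u))\<^sup>2"
      using slice_weight_cdf_small[OF near \<gamma> Hpos]
      by (intro \<eta>(2) slice_weight_measurable[OF near \<gamma> Hpos] slice_weight_bound[OF near \<gamma> Hpos])
        (rule order_trans)
    also have "\<dots> \<le> 2 / \<tau> * central_form u" using l(2)[of u] \<tau> by (simp add: mult.assoc divide_right_mono)
    also have "(LINT \<omega>|M. slice_weight H b (Y \<omega>) * (P u \<bullet> m (Y \<omega>))\<^sup>2)
        = (LINT \<omega>|M. slice_weight H b (Y \<omega>) * (u \<bullet> m (Y \<omega>))\<^sup>2)"
      using P[of u] slice_weight_measurable[OF near \<gamma> Hpos]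
      by (intro integral_cong_AE) (auto elim!: eventually_mono)
    finally have 1: "\<bar>LINT \<omega>|M. slice_weight H b (Y \<omega>) * (u \<bullet> m (Y \<omega>))\<^sup>2\<bar> \<le> 2 / \<tau> * central_form u" .
    let ?v = "1 / real H * (\<Sum>h<H. var_real (cond_law M Y (closed_slice (ecut H b) h)) (\<lambda>\<omega>. u \<bullet> m (Y \<omega>)))"
    have 2: "?v \<le> 1 / \<tau> * central_form u"
      using stable[OF _ gamma_partition_ecut[OF near \<gamma> Hpos] u] H
      by (simp add: var_real_def EmY central_form_def)
    have 3: "0 \<le> ?v" unfolding var_real_def by (intro mult_nonneg_nonneg sum_nonneg integral_nonneg) auto
    have "3 / \<tau> * central_form u = 2 / \<tau> * central_form u + 1 / \<tau> * central_form u"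
      using \<tau> by (simp add: field_simps)
    then show "\<bar>slice_form H b u - central_form u\<bar> \<le> 3 / \<tau> * central_form u"
      using 1 2 3 slice_form_eq[OF near \<gamma> Hpos, of u] by linarith
  qed simp
qed

end

section \<open>Order statistics and independent samples\<close>

definition count_le :: "nat \<Rightarrow> (nat \<Rightarrow> real) \<Rightarrow> real \<Rightarrow> nat" where
  "count_le n y q = card {i. i < n \<and> y i \<le> q}"

definition ranking :: "nat \<Rightarrow> (nat \<Rightarrow> real) \<Rightarrow> nat list" where
  "ranking n y = sort_key y [0..<n]"

lemma ranking_props:
  "length (ranking n y) = n" "distinct (ranking n y)" "set (ranking n y) = {..<n}" "sorted (map y (ranking n y))"
  by (auto simp: ranking_def)

lemma ranking_bij: "bij_betw (\<lambda>p. ranking n y ! p) {..<n} {..<n}"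
  by (rule bij_betw_nth) (auto simp: ranking_props)

text \<open>The positions that carry a value at most \<open>q\<close> form an initial segment of the ranking, and its length
  is the number of such observations. The later facts about order statistics rest on this one, and ties
  are allowed.\<close>

lemma ranking_le_iff:
  assumes "p < n"
  shows "y (ranking n y ! p) \<le> q \<longleftrightarrow> p < count_le n y q"
proof -
  let ?l = "ranking n y"
  let ?K = "{p. p < n \<and> y (?l ! p) \<le> q}"
  have mono: "y (?l ! i) \<le> y (?l ! j)" if "i \<le> j" "j < n" for i j
    using sorted_nth_mono[OF ranking_props(4), of i j y n] that by (simp add: ranking_props)
  have "bij_betw (\<lambda>p. ?l ! p) ?K {i. i < n \<and> y i \<le> q}"
  proof (rule bij_betw_subset[OF ranking_bij[of n y]])
    show "(\<lambda>p. ?l ! p) ` ?K = {i. i < n \<and> y i \<le> q}"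
    proof
      show "(\<lambda>p. ?l ! p) ` ?K \<subseteq> {i. i < n \<and> y i \<le> q}"
        using nth_mem[of _ ?l] by (auto simp: ranking_props)
      show "{i. i < n \<and> y i \<le> q} \<subseteq> (\<lambda>p. ?l ! p) ` ?K"
      proof
        fix i assume i: "i \<in> {i. i < n \<and> y i \<le> q}"
        then have "i \<in> set ?l" by (simp add: ranking_props)
        then obtain p where "p < n" "?l ! p = i" unfolding in_set_conv_nth ranking_props(1) by blast
        with i show "i \<in> (\<lambda>p. ?l ! p) ` ?K" by auto
      qed
    qed
  qed auto
  then have card: "card ?K = count_le n y q" unfolding count_le_def by (rule bij_betw_same_card)
  show ?thesis
  proof
    assume "y (?l ! p) \<le> q"
    then have "{..p} \<subseteq> ?K" using assms mono by (auto intro: order_trans)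
    then have "card {..p} \<le> card ?K" by (intro card_mono) auto
    then show "p < count_le n y q" using card by simp
  next
    assume "p < count_le n y q"
    show "y (?l ! p) \<le> q"
    proof (rule ccontr)
      assume "\<not> ?thesis"
      then have "?K \<subseteq> {..<p}" using mono by (force simp: not_less[symmetric])
      then have "card ?K \<le> card {..<p}" by (intro card_mono) auto
      then show False using card \<open>p < count_le n y q\<close> by simp
    qed
  qed
qed

lemma count_le_le: "count_le n y q \<le> n"
  unfolding count_le_def using card_mono[of "{..<n}" "{i. i < n \<and> y i \<le> q}"] by auto

lemma order_stat_eq: "order_stat n y k = y (ranking n y ! (k - 1))"
  by (simp add: order_stat_def order_index_def ranking_def)

lemma order_stat_le_iff:
  assumes "0 < k" "k \<le> n"
  shows "order_stat n y k \<le> q \<longleftrightarrow> k \<le> count_le n y q"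
  using ranking_le_iff[of "k - 1" n y q] assms by (auto simp: order_stat_eq)

lemma slice_mean_eq:
  assumes "0 < h"
  shows "slice_mean H c x y h = (1 / real c) *\<^sub>R (\<Sum>p\<in>{c * (h - 1)..<c * h}. x (ranking (H * c) y ! p))"
proof -
  have "(\<Sum>j=1..c. x (ranking (H * c) y ! (c * (h - 1) + j - 1)))
      = (\<Sum>p\<in>{c * (h - 1)..<c * h}. x (ranking (H * c) y ! p))"
  proof (rule sum.reindex_bij_witness[of _ "\<lambda>p. p - c * (h - 1) + 1" "\<lambda>j. c * (h - 1) + j - 1"])
    have "c * h = c * (h - 1) + c" using assms by (cases h) auto
    then show "c * (h - 1) + j - 1 \<in> {c * (h - 1)..<c * h}" if "j \<in> {1..c}" for j using that by auto
    show "p - c * (h - 1) + 1 \<in> {1..c}" if "p \<in> {c * (h - 1)..<c * h}" for p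
      using that \<open>c * h = c * (h - 1) + c\<close> by auto
  qed auto
  then show ?thesis
    by (simp add: slice_mean_def concomitant_def order_index_def ranking_def)
qed

text \<open>Sorting depends on the keys only through comparisons, so it is measurable as a map into the
  countable set of lists.\<close>

lemma measurable_insort_key:
  fixes ys :: "nat \<Rightarrow> 'a \<Rightarrow> real"
  assumes [measurable]: "\<And>i. ys i \<in> borel_measurable N"
  shows "(\<lambda>\<omega>. insort_key (\<lambda>i. ys i \<omega>) x l) \<in> measurable N (count_space UNIV)"
proof (induction l)
  case (Cons a l)
  note [measurable] = Cons
  have "(\<lambda>\<omega>. if ys x \<omega> \<le> ys a \<omega> then x # a # l else a # insort_key (\<lambda>i. ys i \<omega>) x l)
      \<in> measurable N (count_space UNIV)"
    by measurable
  then show ?case by simp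
qed simp

lemma measurable_ranking:
  fixes ys :: "nat \<Rightarrow> 'a \<Rightarrow> real"
  assumes ys[measurable]: "\<And>i. ys i \<in> borel_measurable N"
  shows "(\<lambda>\<omega>. ranking n (\<lambda>i. ys i \<omega>)) \<in> measurable N (count_space UNIV)"
proof -
  have "(\<lambda>\<omega>. sort_key (\<lambda>i. ys i \<omega>) xs) \<in> measurable N (count_space UNIV)" for xs
  proof (induction xs)
    case (Cons x xs)
    have "(\<lambda>\<omega>. insort_key (\<lambda>i. ys i \<omega>) x (sort_key (\<lambda>i. ys i \<omega>) xs)) \<in> measurable N (count_space UNIV)"
      by (rule measurable_compose_countable[OF measurable_insort_key[OF ys] Cons])
    then show ?case by simp
  qed simp
  then show ?thesis by (simp add: ranking_def)
qed

lemma measurable_order_stat: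
  fixes ys :: "nat \<Rightarrow> 'a \<Rightarrow> real"
  assumes ys: "\<And>i. ys i \<in> borel_measurable N"
  shows "(\<lambda>\<omega>. order_stat n (\<lambda>i. ys i \<omega>) k) \<in> borel_measurable N"
  unfolding order_stat_eq
  by (rule measurable_compose_countable[OF ys])
    (rule measurable_compose[OF measurable_ranking[OF ys] measurable_count_space])

lemma sort_key_cong_on:
  fixes f g :: "'a \<Rightarrow> 'b::linorder"
  assumes "\<And>k. k \<in> set xs \<Longrightarrow> f k = g k"
  shows "sort_key f xs = sort_key g xs"
proof -
  have ins: "insort_key f x l = insort_key g x l" if "\<And>k. k \<in> insert x (set l) \<Longrightarrow> f k = g k" for x l
    using that by (induction l) auto
  from assms show ?thesis
  proof (induction xs)
    case (Cons x xs)
    have "sort_key f xs = sort_key g xs" by (rule Cons.IH) (use Cons.prems in auto)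
    moreover have "insort_key f x (sort_key g xs) = insort_key g x (sort_key g xs)"
      by (rule ins) (use Cons.prems in auto)
    ultimately show ?case by simp
  qed simp
qed

lemma ranking_cong: "(\<And>k. k < n \<Longrightarrow> y k = y' k) \<Longrightarrow> ranking n y = ranking n y'"
  unfolding ranking_def by (rule sort_key_cong_on) simp

lemma sum_ranking:
  fixes v :: "nat \<Rightarrow> 'b::real_vector"
  assumes "P \<subseteq> {..<n}"
  shows "(\<Sum>p\<in>P. v (ranking n y ! p)) = (\<Sum>i<n. (if i \<in> (\<lambda>p. ranking n y ! p) ` P then 1 else 0) *\<^sub>R v i)"
proof -
  have inj: "inj_on (\<lambda>p. ranking n y ! p) P"
    using ranking_bij[of n y] assms by (auto simp: bij_betw_def intro: inj_on_subset)
  have sub: "(\<lambda>p. ranking n y ! p) ` P \<subseteq> {..<n}"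
    using ranking_bij[of n y] assms by (auto simp: bij_betw_def)
  have "(\<Sum>p\<in>P. v (ranking n y ! p)) = (\<Sum>i\<in>(\<lambda>p. ranking n y ! p) ` P. v i)"
    by (simp add: sum.reindex[OF inj])
  also have "\<dots> = (\<Sum>i\<in>{..<n} \<inter> (\<lambda>p. ranking n y ! p) ` P. v i)" using sub by (simp add: Int_absorb1)
  also have "\<dots> = (\<Sum>i<n. if i \<in> (\<lambda>p. ranking n y ! p) ` P then v i else 0)"
    by (rule sum.inter_restrict) simp
  also have "\<dots> = (\<Sum>i<n. (if i \<in> (\<lambda>p. ranking n y ! p) ` P then 1 else 0) *\<^sub>R v i)"
    by (intro sum.cong) auto
  finally show ?thesis .
qed

lemma sum_ranking_count:
  fixes v :: "nat \<Rightarrow> 'b::real_vector"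
  shows "(\<Sum>i<n. indicator {..q} (y i) *\<^sub>R v i) = (\<Sum>p<count_le n y q. v (ranking n y ! p))"
proof -
  have "(\<Sum>p<count_le n y q. v (ranking n y ! p))
      = (\<Sum>i<n. (if i \<in> (\<lambda>p. ranking n y ! p) ` {..<count_le n y q} then 1 else 0) *\<^sub>R v i)"
    by (rule sum_ranking) (use count_le_le[of n y q] in auto)
  also have "\<dots> = (\<Sum>i<n. indicator {..q} (y i) *\<^sub>R v i)"
  proof (rule sum.cong[OF refl])
    fix i assume i: "i \<in> {..<n}"
    then have "i \<in> (\<lambda>p. ranking n y ! p) ` {..<n}" using ranking_bij[of n y] by (simp add: bij_betw_def)
    then obtain p where p: "p < n" "ranking n y ! p = i" by auto
    have inj: "inj_on (\<lambda>p. ranking n y ! p) {..<n}" using ranking_bij[of n y] by (simp add: bij_betw_def)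
    have "i \<in> (\<lambda>p. ranking n y ! p) ` {..<count_le n y q} \<longleftrightarrow> p < count_le n y q"
    proof
      assume "i \<in> (\<lambda>p. ranking n y ! p) ` {..<count_le n y q}"
      then obtain p' where p': "p' < count_le n y q" "ranking n y ! p' = i" by auto
      then have "p' < n" using count_le_le[of n y q] by simp
      then have "p' = p" using inj p p' by (auto simp: inj_on_def)
      then show "p < count_le n y q" using p' by simp
    qed (use p in auto)
    also have "\<dots> \<longleftrightarrow> y i \<le> q" using ranking_le_iff[OF p(1), of y q] p(2) by simp
    finally show "(if i \<in> (\<lambda>p. ranking n y ! p) ` {..<count_le n y q} then 1 else 0) *\<^sub>R v i
        = indicator {..q} (y i) *\<^sub>R v i" by (simp add: indicator_def)
  qed
  finally show ?thesis by simp
qed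

text \<open>The first sum runs over the \<open>k\<close> lowest ranked observations, the second over those not above \<open>q\<close>, which
  are also an initial segment of the ranking. They differ by a block of ranks, and all observations in that
  block lie in the window \<open>(q1, q2]\<close>, where \<open>v\<close> is bounded by \<open>B\<close>.\<close>

lemma ranking_window_bound:
  fixes v :: "real \<Rightarrow> 'b::real_normed_vector"
  assumes k: "0 < k" "k \<le> n" and q: "q1 \<le> q" "q \<le> q2"
    and os: "q1 < order_stat n y k" "order_stat n y k \<le> q2"
    and B: "\<And>t. q1 \<le> t \<Longrightarrow> t \<le> q2 \<Longrightarrow> norm (v t) \<le> B"
  shows "norm ((\<Sum>p<k. v (y (ranking n y ! p))) - (\<Sum>i<n. indicator {..q} (y i) *\<^sub>R v (y i)))
    \<le> B * \<bar>real (count_le n y q) - real k\<bar>"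
proof -
  let ?N = "count_le n y"
  let ?f = "\<lambda>p. v (y (ranking n y ! p))"
  have mono: "?N a \<le> ?N b" if "a \<le> b" for a b
    unfolding count_le_def using that by (intro card_mono) auto
  have b: "?N q1 < k" "k \<le> ?N q2" using os order_stat_le_iff[OF k, of y] by (auto simp: not_le[symmetric])
  have fB: "norm (?f p) \<le> B" if "?N q1 \<le> p" "p < ?N q2" for p
  proof -
    have p: "p < n" using that count_le_le[of n y q2] by simp
    have "y (ranking n y ! p) \<le> q2" "\<not> y (ranking n y ! p) \<le> q1"
      using ranking_le_iff[OF p, of y] that by auto
    then show ?thesis by (intro B) auto
  qed
  have block: "norm ((\<Sum>p<j. ?f p) - (\<Sum>p<i. ?f p)) \<le> B * (real j - real i)"
    if "i \<le> j" "?N q1 \<le> i" "j \<le> ?N q2" for i j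
  proof -
    have "(\<Sum>p<j. ?f p) = (\<Sum>p<i. ?f p) + (\<Sum>p\<in>{i..<j}. ?f p)"
      using sum.atLeastLessThan_concat[of 0 i j ?f] that(1) by (simp add: lessThan_atLeast0)
    then have "norm ((\<Sum>p<j. ?f p) - (\<Sum>p<i. ?f p)) = norm (\<Sum>p\<in>{i..<j}. ?f p)" by simp
    also have "\<dots> \<le> (\<Sum>p\<in>{i..<j}. B)" by (rule sum_norm_le) (use that in \<open>auto intro!: fB\<close>)
    also have "\<dots> = B * (real j - real i)" using that(1) by (simp add: of_nat_diff)
    finally show ?thesis .
  qed
  show ?thesis unfolding sum_ranking_count
  proof (cases "?N q \<le> k")
    case True
    then show "norm ((\<Sum>p<k. ?f p) - (\<Sum>p<?N q. ?f p)) \<le> B * \<bar>real (?N q) - real k\<bar>"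
      using block[of "?N q" k] b mono[OF q(1)] by simp
  next
    case False
    then show "norm ((\<Sum>p<k. ?f p) - (\<Sum>p<?N q. ?f p)) \<le> B * \<bar>real (?N q) - real k\<bar>"
      using block[of k "?N q"] b mono[OF q(2)] by (simp add: norm_minus_commute)
  qed
qed

lemma snd_borel: "snd \<in> borel_measurable (borel :: ('a::second_countable_topology \<times> 'b::second_countable_topology) measure)"
  by (intro borel_measurable_continuous_onI continuous_intros)

lemma fst_borel: "fst \<in> borel_measurable (borel :: ('a::second_countable_topology \<times> 'b::second_countable_topology) measure)"
  by (intro borel_measurable_continuous_onI continuous_intros)

locale inverse_regression_sample = inverse_regression M X Y m
  for M :: "'w measure" and X :: "'w \<Rightarrow> 'h::{real_inner, banach, second_countable_topology}" and Y m +
  fixes Xs :: "nat \<Rightarrow> 'w \<Rightarrow> 'h" and Ys :: "nat \<Rightarrow> 'w \<Rightarrow> real"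
  assumes sample_indep: "indep_vars (\<lambda>_. borel) (\<lambda>i \<omega>. (Xs i \<omega>, Ys i \<omega>)) UNIV"
    and sample_law: "\<And>i. distr M borel (\<lambda>\<omega>. (Xs i \<omega>, Ys i \<omega>)) = distr M borel (\<lambda>\<omega>. (X \<omega>, Y \<omega>))"
begin

lemma measurable_pair_sample[measurable]: "(\<lambda>\<omega>. (Xs i \<omega>, Ys i \<omega>)) \<in> borel_measurable M"
  using sample_indep by (auto simp: indep_vars_def)

lemma measurable_Xs[measurable]: "Xs i \<in> borel_measurable M"
  using measurable_compose[OF measurable_pair_sample fst_borel] by simp

lemma measurable_Ys[measurable]: "Ys i \<in> borel_measurable M"
  using measurable_compose[OF measurable_pair_sample snd_borel] by simp

lemma measurable_pair_XY[measurable]: "(\<lambda>\<omega>. (X \<omega>, Y \<omega>)) \<in> borel_measurable M"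
  by measurable

lemma integral_sample:
  fixes g :: "'h \<times> real \<Rightarrow> 'b::{banach, second_countable_topology}"
  assumes [measurable]: "g \<in> borel_measurable borel"
  shows "(LINT \<omega>|M. g (Xs i \<omega>, Ys i \<omega>)) = (LINT \<omega>|M. g (X \<omega>, Y \<omega>))"
    and "integrable M (\<lambda>\<omega>. g (Xs i \<omega>, Ys i \<omega>)) \<longleftrightarrow> integrable M (\<lambda>\<omega>. g (X \<omega>, Y \<omega>))"
proof -
  have "(LINT \<omega>|M. g (Xs i \<omega>, Ys i \<omega>)) = (LINT z|distr M borel (\<lambda>\<omega>. (Xs i \<omega>, Ys i \<omega>)). g z)"
    by (rule integral_distr[symmetric]) measurable
  also have "\<dots> = (LINT \<omega>|M. g (X \<omega>, Y \<omega>))" unfolding sample_law by (rule integral_distr) measurable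
  finally show "(LINT \<omega>|M. g (Xs i \<omega>, Ys i \<omega>)) = (LINT \<omega>|M. g (X \<omega>, Y \<omega>))" .
  have "integrable M (\<lambda>\<omega>. g (Xs i \<omega>, Ys i \<omega>)) \<longleftrightarrow> integrable (distr M borel (\<lambda>\<omega>. (Xs i \<omega>, Ys i \<omega>))) g"
    by (rule integrable_distr_eq[symmetric]) measurable
  also have "\<dots> \<longleftrightarrow> integrable M (\<lambda>\<omega>. g (X \<omega>, Y \<omega>))" unfolding sample_law by (rule integrable_distr_eq) measurable
  finally show "integrable M (\<lambda>\<omega>. g (Xs i \<omega>, Ys i \<omega>)) \<longleftrightarrow> integrable M (\<lambda>\<omega>. g (X \<omega>, Y \<omega>))" .
qed

definition law :: "('h \<times> real) measure" where "law = distr M borel (\<lambda>\<omega>. (X \<omega>, Y \<omega>))"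

lemma prob_space_law: "prob_space law"
  unfolding law_def by (rule prob_space_distr) measurable

definition sample :: "nat \<Rightarrow> 'w \<Rightarrow> nat \<Rightarrow> 'h \<times> real" where
  "sample n \<omega> = (\<lambda>i\<in>{..<n}. (Xs i \<omega>, Ys i \<omega>))"

lemma measurable_sample[measurable]: "sample n \<in> measurable M (Pi\<^sub>M {..<n} (\<lambda>_. borel))"
  unfolding sample_def by (intro measurable_restrict) measurable

lemma distr_sample:
  assumes "0 < n"
  shows "distr M (Pi\<^sub>M {..<n} (\<lambda>_. borel)) (sample n) = Pi\<^sub>M {..<n} (\<lambda>_. law)"
proof -
  have "indep_vars (\<lambda>_. borel) (\<lambda>i \<omega>. (Xs i \<omega>, Ys i \<omega>)) {..<n}"
    by (rule indep_vars_subset[OF sample_indep]) simp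
  moreover have "{..<n} \<noteq> {}" using assms by auto
  ultimately show ?thesis
    by (subst (asm) indep_vars_iff_distr_eq_PiM) (auto simp: sample_def[abs_def] sample_law law_def)
qed

text \<open>The weights may depend on the whole sample. Expanding the square, every cross term vanishes by
  Fubini: with all coordinates but the \<open>i\<close>-th fixed, the \<open>i\<close>-th term integrates to zero.\<close>

lemma weighted_sum_second_moment:
  fixes \<psi> :: "'h \<times> real \<Rightarrow> 'e::{real_inner, banach, second_countable_topology}"
    and W :: "nat \<Rightarrow> (nat \<Rightarrow> 'h \<times> real) \<Rightarrow> real"
  assumes \<psi>[measurable]: "\<psi> \<in> borel_measurable borel"
    and sq: "integrable M (\<lambda>\<omega>. (norm (\<psi> (X \<omega>, Y \<omega>)))\<^sup>2)"
    and W[measurable]: "\<And>i. W i \<in> borel_measurable (Pi\<^sub>M {..<n} (\<lambda>_. borel))"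
    and Wb: "\<And>i z. \<bar>W i z\<bar> \<le> 1"
    and orth: "\<And>i j z e. i < n \<Longrightarrow> z \<in> space (Pi\<^sub>M ({..<n} - {i}) (\<lambda>_. law)) \<Longrightarrow>
      (LINT a|law. W i (z(i := a)) * W j (z(i := a)) * (\<psi> a \<bullet> e)) = 0"
  shows "integrable M (\<lambda>\<omega>. (norm (\<Sum>i<n. W i (sample n \<omega>) *\<^sub>R \<psi> (Xs i \<omega>, Ys i \<omega>)))\<^sup>2)"
    and "(LINT \<omega>|M. (norm (\<Sum>i<n. W i (sample n \<omega>) *\<^sub>R \<psi> (Xs i \<omega>, Ys i \<omega>)))\<^sup>2)
      \<le> real n * (LINT \<omega>|M. (norm (\<psi> (X \<omega>, Y \<omega>)))\<^sup>2)"
proof -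
  define v where "v i \<omega> = \<psi> (Xs i \<omega>, Ys i \<omega>)" for i \<omega>
  define T where "T i j \<omega> = W i (sample n \<omega>) * W j (sample n \<omega>) * (v i \<omega> \<bullet> v j \<omega>)" for i j \<omega>
  have [measurable]: "v i \<in> borel_measurable M" for i unfolding v_def by measurable
  have [measurable]: "T i j \<in> borel_measurable M" for i j unfolding T_def by measurable
  have vsq: "integrable M (\<lambda>\<omega>. (norm (v i \<omega>))\<^sup>2)" "(LINT \<omega>|M. (norm (v i \<omega>))\<^sup>2) = (LINT \<omega>|M. (norm (\<psi> (X \<omega>, Y \<omega>)))\<^sup>2)" for i
    using integral_sample[of "\<lambda>z. (norm (\<psi> z))\<^sup>2" i] sq by (auto simp: v_def)
  have Tb: "\<bar>T i j \<omega>\<bar> \<le> (norm (v i \<omega>))\<^sup>2 + (norm (v j \<omega>))\<^sup>2" for i j \<omega>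
  proof -
    have "\<bar>T i j \<omega>\<bar> \<le> 1 * 1 * (norm (v i \<omega>) * norm (v j \<omega>))"
      unfolding T_def abs_mult by (intro mult_mono Wb Cauchy_Schwarz_ineq2) auto
    also have "\<dots> \<le> (norm (v i \<omega>))\<^sup>2 + (norm (v j \<omega>))\<^sup>2"
      using sum_squares_bound[of "norm (v i \<omega>)" "norm (v j \<omega>)"] mult_nonneg_nonneg[of "norm (v i \<omega>)" "norm (v j \<omega>)", OF norm_ge_zero norm_ge_zero] by linarith
    finally show ?thesis .
  qed
  have Ti: "integrable M (T i j)" for i j
    by (rule Bochner_Integration.integrable_bound[of _ "\<lambda>\<omega>. (norm (v i \<omega>))\<^sup>2 + (norm (v j \<omega>))\<^sup>2"])
      (use vsq Tb in auto)
  have cross: "integral\<^sup>L M (T i j) = 0" if i: "i < n" and j: "j < n" and ij: "i \<noteq> j" for i j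
  proof -
    interpret P: prob_space law by (rule prob_space_law)
    interpret PP: product_sigma_finite "\<lambda>_::nat. law" ..
    have sl: "sets law = sets borel" by (simp add: law_def)
    have sP: "sets (Pi\<^sub>M I (\<lambda>_. law)) = sets (Pi\<^sub>M I (\<lambda>_. borel))" for I :: "nat set"
      by (rule sets_PiM_cong) (auto simp: sl)
    define f where "f z = W i z * W j z * (\<psi> (z i) \<bullet> \<psi> (z j))" for z
    have fm[measurable]: "f \<in> borel_measurable (Pi\<^sub>M {..<n} (\<lambda>_. borel))"
    proof -
      have [measurable]: "(\<lambda>z. \<psi> (z k)) \<in> borel_measurable (Pi\<^sub>M {..<n} (\<lambda>_. borel))" if "k < n" for k
        using measurable_compose[OF measurable_component_singleton[of k "{..<n}" "\<lambda>_. borel"] \<psi>] that by simp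
      note this[OF i, measurable] this[OF j, measurable]
      show ?thesis unfolding f_def by measurable
    qed
    have Tf: "T i j \<omega> = f (sample n \<omega>)" for \<omega>
      using i j by (simp add: T_def f_def v_def sample_def)
    have n0: "0 < n" using i by simp
    have fint: "integrable (Pi\<^sub>M {..<n} (\<lambda>_. law)) f"
      unfolding distr_sample[OF n0, symmetric] using Ti[of i j] by (subst integrable_distr_eq) (auto simp: Tf[abs_def])
    have ins: "insert i ({..<n} - {i}) = {..<n}" using i by auto
    have "integral\<^sup>L M (T i j) = integral\<^sup>L (Pi\<^sub>M {..<n} (\<lambda>_. law)) f"
      unfolding distr_sample[OF n0, symmetric] by (subst integral_distr) (auto simp: Tf[abs_def])
    also have "\<dots> = (LINT z|Pi\<^sub>M ({..<n} - {i}) (\<lambda>_. law). LINT a|law. f (z(i := a)))"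
      using PP.product_integral_insert[of "{..<n} - {i}" i f] fint ins by simp
    also have "\<dots> = (LINT z|Pi\<^sub>M ({..<n} - {i}) (\<lambda>_. law). 0)"
    proof (rule Bochner_Integration.integral_cong[OF refl])
      fix z assume "z \<in> space (Pi\<^sub>M ({..<n} - {i}) (\<lambda>_. law))"
      from orth[OF i this, of j "\<psi> (z j)"] ij show "(LINT a|law. f (z(i := a))) = 0" by (simp add: f_def)
    qed
    finally show ?thesis by simp
  qed
  have eq: "(norm (\<Sum>i<n. W i (sample n \<omega>) *\<^sub>R v i \<omega>))\<^sup>2 = (\<Sum>i<n. \<Sum>j<n. T i j \<omega>)" for \<omega>
    unfolding power2_norm_eq_inner inner_sum_left inner_sum_right by (simp add: T_def mult_ac inner_commute)
  show "integrable M (\<lambda>\<omega>. (norm (\<Sum>i<n. W i (sample n \<omega>) *\<^sub>R \<psi> (Xs i \<omega>, Ys i \<omega>)))\<^sup>2)"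
    unfolding v_def[symmetric] eq using Ti by simp
  have "(LINT \<omega>|M. (norm (\<Sum>i<n. W i (sample n \<omega>) *\<^sub>R v i \<omega>))\<^sup>2) = (\<Sum>i<n. \<Sum>j<n. integral\<^sup>L M (T i j))"
    unfolding eq using Ti by simp
  also have "\<dots> = (\<Sum>i<n. \<Sum>j<n. if j = i then integral\<^sup>L M (T i i) else 0)"
    using cross by (intro sum.cong) auto
  also have "\<dots> = (\<Sum>i<n. integral\<^sup>L M (T i i))" by simp
  also have "\<dots> \<le> (\<Sum>i<n. LINT \<omega>|M. (norm (\<psi> (X \<omega>, Y \<omega>)))\<^sup>2)"
  proof (rule sum_mono)
    fix i
    have "integral\<^sup>L M (T i i) \<le> (LINT \<omega>|M. (norm (v i \<omega>))\<^sup>2)"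
    proof (rule integral_mono[OF Ti vsq(1)])
      fix \<omega>
      have "(W i (sample n \<omega>))\<^sup>2 \<le> 1" using Wb[of i "sample n \<omega>"] by (simp add: abs_square_le_1)
      then have "(W i (sample n \<omega>))\<^sup>2 * (norm (v i \<omega>))\<^sup>2 \<le> 1 * (norm (v i \<omega>))\<^sup>2" by (intro mult_right_mono) auto
      then show "T i i \<omega> \<le> (norm (v i \<omega>))\<^sup>2" by (simp add: T_def power2_eq_square power2_norm_eq_inner[symmetric])
    qed
    then show "integral\<^sup>L M (T i i) \<le> (LINT \<omega>|M. (norm (\<psi> (X \<omega>, Y \<omega>)))\<^sup>2)" by (simp add: vsq(2))
  qed
  finally show "(LINT \<omega>|M. (norm (\<Sum>i<n. W i (sample n \<omega>) *\<^sub>R \<psi> (Xs i \<omega>, Ys i \<omega>)))\<^sup>2)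
      \<le> real n * (LINT \<omega>|M. (norm (\<psi> (X \<omega>, Y \<omega>)))\<^sup>2)" by (simp add: v_def)
qed

lemma count_le_eq_sum: "real (count_le n (\<lambda>i. Ys i \<omega>) q) = (\<Sum>i<n. indicator {..q} (Ys i \<omega>))"
proof -
  have "(\<Sum>i<n. indicator {..q} (Ys i \<omega>) :: real) = (\<Sum>i\<in>{i. i < n \<and> Ys i \<omega> \<le> q}. 1)"
    by (intro sum.mono_neutral_cong_right) (auto simp: indicator_def)
  then show ?thesis by (simp add: count_le_def)
qed

lemma count_le_tail:
  assumes n: "0 < n" and t: "0 \<le> t"
  shows "prob {\<omega> \<in> space M. real n * F q + real n * t \<le> real (count_le n (\<lambda>i. Ys i \<omega>) q)} \<le> exp (- 2 * real n * t\<^sup>2)"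
    and "prob {\<omega> \<in> space M. real (count_le n (\<lambda>i. Ys i \<omega>) q) \<le> real n * F q - real n * t} \<le> exp (- 2 * real n * t\<^sup>2)"
proof -
  have g[measurable]: "(\<lambda>z. indicator {..q} (snd z) :: real) \<in> borel_measurable (borel :: ('h \<times> real) measure)"
    by (rule measurable_compose[OF snd_borel]) simp
  have ind: "indep_vars (\<lambda>_. borel) (\<lambda>i \<omega>. indicator {..q} (snd (Xs i \<omega>, Ys i \<omega>)) :: real) {..<n}"
    by (rule indep_vars_compose2[OF indep_vars_subset[OF sample_indep]]) (use g in auto)
  have mu: "F q = (LINT \<omega>|M. indicator {..q} (Y \<omega>))"
    by (simp add: integral_indicator_Y F_def vimage_def Int_def conj_commute)
  interpret Hf: Hoeffding_ineq_iid M "{..<n}" "\<lambda>i \<omega>. indicator {..q} (Ys i \<omega>)" "\<lambda>\<omega>. indicator {..q} (Y \<omega>)" 0 1 "F q"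
  proof unfold_locales
    show "indep_vars (\<lambda>_. borel) (\<lambda>i \<omega>. indicator {..q} (Ys i \<omega>) :: real) {..<n}" using ind by simp
    show "distr M borel (\<lambda>\<omega>. indicator {..q} (Ys i \<omega>) :: real) = distr M borel (\<lambda>\<omega>. indicator {..q} (Y \<omega>))" for i
    proof -
      have "distr (distr M borel (\<lambda>\<omega>. (Xs i \<omega>, Ys i \<omega>))) borel (\<lambda>z. indicator {..q} (snd z) :: real)
          = distr (distr M borel (\<lambda>\<omega>. (X \<omega>, Y \<omega>))) borel (\<lambda>z. indicator {..q} (snd z))"
        by (simp only: sample_law)
      then show ?thesis by (simp add: distr_distr o_def)
    qed
    show "AE x in M. indicator {..q} (Y x) \<in> {0..1::real}" by (auto split: split_indicator)
    show "F q \<equiv> LINT \<omega>|M. indicator {..q} (Y \<omega>)" using mu by simp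
  qed auto
  have nt: "0 \<le> real n * t" using t by simp
  have ne: "{..<n} \<noteq> {}" using n by auto
  have e: "- 2 * (real n * t)\<^sup>2 / (real n * (1 - 0)\<^sup>2) = - 2 * real n * t\<^sup>2" using n by (simp add: power2_eq_square)
  show "prob {\<omega> \<in> space M. real n * F q + real n * t \<le> real (count_le n (\<lambda>i. Ys i \<omega>) q)} \<le> exp (- 2 * real n * t\<^sup>2)"
    using Hf.Hoeffding_ineq_ge[OF nt _ ne] unfolding count_le_eq_sum e[symmetric] by simp
  show "prob {\<omega> \<in> space M. real (count_le n (\<lambda>i. Ys i \<omega>) q) \<le> real n * F q - real n * t} \<le> exp (- 2 * real n * t\<^sup>2)"
    using Hf.Hoeffding_ineq_le[OF nt _ ne] unfolding count_le_eq_sum e[symmetric] by simp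
qed

end

section \<open>The population estimate over random slices\<close>

lemma tensor_inner: "tensor x x u \<bullet> u = (x \<bullet> u)\<^sup>2"
  by (simp add: tensor_def power2_eq_square)

lemma Gamma_tilde_quadratic:
  assumes "0 < H"
  shows "Gamma_tilde M X Y H c y u \<bullet> u = (1 / real H) * (\<Sum>h<H.
    (integral\<^sup>L (cond_law M Y (cut_slice H (\<lambda>h. order_stat (H * c) y (c * h)) (Suc h))) X \<bullet> u)\<^sup>2)"
  unfolding Gamma_tilde_def slice_eq_cut_slice
  by (simp add: inner_sum_left tensor_inner sum.atLeast1_atMost_eq)

lemma norm_tensor_le: "norm ((v \<bullet> u) *\<^sub>R v) \<le> norm u * (norm (v::'h::real_inner))\<^sup>2"
  using mult_right_mono[OF Cauchy_Schwarz_ineq2[of v u] norm_ge_zero[of v]]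
  by (simp add: power2_eq_square mult_ac)

text \<open>By continuity it suffices to test the directions of a countable dense set of non-zero vectors.\<close>

lemma measurable_ball_unit_sphere:
  fixes g :: "'w \<Rightarrow> 'h::{real_normed_vector, second_countable_topology} \<Rightarrow> real"
  assumes [measurable]: "\<And>u. (\<lambda>\<omega>. g \<omega> u) \<in> borel_measurable M"
    and g: "\<And>\<omega>. continuous_on UNIV (g \<omega>)" and k: "continuous_on UNIV k"
  shows "{\<omega> \<in> space M. \<forall>u. norm u = 1 \<longrightarrow> \<bar>g \<omega> u\<bar> \<le> k u} \<in> sets M"
proof -
  obtain D :: "'h set" where D: "countable D" "\<And>S. open S \<Longrightarrow> S \<noteq> {} \<Longrightarrow> \<exists>d\<in>D. d \<in> S"
    using countable_dense_setE by blast
  have "(\<forall>u. norm u = 1 \<longrightarrow> \<bar>g \<omega> u\<bar> \<le> k u) \<longleftrightarrow> (\<forall>d\<in>D. d \<noteq> 0 \<longrightarrow> \<bar>g \<omega> (d /\<^sub>R norm d)\<bar> \<le> k (d /\<^sub>R norm d))" for \<omega>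
  proof
    assume R: "\<forall>d\<in>D. d \<noteq> 0 \<longrightarrow> \<bar>g \<omega> (d /\<^sub>R norm d)\<bar> \<le> k (d /\<^sub>R norm d)"
    show "\<forall>u. norm u = 1 \<longrightarrow> \<bar>g \<omega> u\<bar> \<le> k u"
    proof (intro allI impI, rule ccontr)
      fix u :: 'h assume u: "norm u = 1" "\<not> \<bar>g \<omega> u\<bar> \<le> k u"
      let ?f = "\<lambda>v. \<bar>g \<omega> (v /\<^sub>R norm v)\<bar> - k (v /\<^sub>R norm v)"
      have "continuous_on (- {0}) ?f"
        by (intro continuous_intros continuous_on_compose2[OF g] continuous_on_compose2[OF k]) auto
      then have "open (- {0} \<inter> ?f -` {0<..})" by (intro continuous_open_preimage) auto
      moreover have "u \<in> - {0} \<inter> ?f -` {0<..}" using u by auto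
      ultimately obtain d where "d \<in> D" "d \<in> - {0} \<inter> ?f -` {0<..}" using D(2) by blast
      with R show False by auto
    qed
  qed auto
  then have "{\<omega> \<in> space M. \<forall>u. norm u = 1 \<longrightarrow> \<bar>g \<omega> u\<bar> \<le> k u}
      = {\<omega> \<in> space M. \<forall>d\<in>D. d \<noteq> 0 \<longrightarrow> \<bar>g \<omega> (d /\<^sub>R norm d)\<bar> \<le> k (d /\<^sub>R norm d)}" by simp
  also have "\<dots> \<in> sets M"
    using D(1) by measurable
  finally show ?thesis .
qed

context inverse_regression begin

abbreviation curve_cov :: "'h \<Rightarrow> 'h" where "curve_cov \<equiv> cov_op M (\<lambda>\<omega>. m (Y \<omega>))"

lemma mean_mY: "(LINT \<omega>|M. m (Y \<omega>)) = 0"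
  using integral_indicator_m[of UNIV] mean_zero by simp

lemma cov_eq: "curve_cov u = (LINT \<omega>|M. (m (Y \<omega>) \<bullet> u) *\<^sub>R m (Y \<omega>))"
  by (simp add: cov_op_def mean_mY tensor_def)

lemma integrable_cov: "integrable M (\<lambda>\<omega>. (m (Y \<omega>) \<bullet> u) *\<^sub>R m (Y \<omega>))"
proof (rule Bochner_Integration.integrable_bound)
  show "integrable M (\<lambda>\<omega>. norm u * (norm (m (Y \<omega>)))\<^sup>2)" using m_second_moment by simp
  show "AE \<omega> in M. norm ((m (Y \<omega>) \<bullet> u) *\<^sub>R m (Y \<omega>)) \<le> norm (norm u * (norm (m (Y \<omega>)))\<^sup>2)"
    using norm_tensor_le[of "m (Y _)" u] by (auto simp del: norm_scaleR)
qed measurable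

lemma cov_inner: "curve_cov u \<bullet> v = (LINT \<omega>|M. (m (Y \<omega>) \<bullet> u) * (m (Y \<omega>) \<bullet> v))"
  unfolding cov_eq by (subst integral_inner_left[symmetric]) (use integrable_cov in auto)

lemma cov_quadratic: "curve_cov u \<bullet> u = central_form u"
  unfolding cov_inner central_form_def by (simp add: power2_eq_square inner_commute)

lemma cov_psd: "psd curve_cov"
  unfolding psd_def
proof (intro conjI allI)
  show "linear curve_cov"
  proof (rule linearI)
    fix u v and r :: real
    show "curve_cov (u + v) = curve_cov u + curve_cov v"
      unfolding cov_eq by (subst Bochner_Integration.integral_add[symmetric])
        (use integrable_cov in \<open>auto simp: inner_add_right scaleR_add_left\<close>)
    have "curve_cov (r *\<^sub>R u) = (LINT \<omega>|M. r *\<^sub>R ((m (Y \<omega>) \<bullet> u) *\<^sub>R m (Y \<omega>)))"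
      unfolding cov_eq by simp
    also have "\<dots> = r *\<^sub>R curve_cov u" unfolding cov_eq by (rule Bochner_Integration.integral_scaleR_right)
    finally show "curve_cov (r *\<^sub>R u) = r *\<^sub>R curve_cov u" .
  qed
  show "curve_cov u \<bullet> v = u \<bullet> curve_cov v" for u v
    unfolding inner_commute[of u "curve_cov v"] cov_inner by (simp add: mult.commute)
  show "0 \<le> curve_cov u \<bullet> u" for u unfolding cov_inner by (rule Bochner_Integration.integral_nonneg) simp
qed

lemma cov_bounded_linear: "bounded_linear curve_cov"
proof -
  have "norm (curve_cov u) \<le> norm u * (LINT \<omega>|M. (norm (m (Y \<omega>)))\<^sup>2)" for u
  proof -
    have "norm (curve_cov u) \<le> (LINT \<omega>|M. norm u * (norm (m (Y \<omega>)))\<^sup>2)"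
      unfolding cov_eq
    proof (rule integral_norm_bound[THEN order_trans], rule integral_mono)
      show "integrable M (\<lambda>\<omega>. norm ((m (Y \<omega>) \<bullet> u) *\<^sub>R m (Y \<omega>)))" using integrable_cov by (rule integrable_norm)
      show "integrable M (\<lambda>\<omega>. norm u * (norm (m (Y \<omega>)))\<^sup>2)" using m_second_moment by simp
      show "norm ((m (Y \<omega>) \<bullet> u) *\<^sub>R m (Y \<omega>)) \<le> norm u * (norm (m (Y \<omega>)))\<^sup>2" for \<omega>
        by (rule norm_tensor_le)
    qed
    then show ?thesis by simp
  qed
  then show ?thesis
    using cov_psd by (auto simp: psd_def bounded_linear_def bounded_linear_axioms_def)
qed

lemma central_form_continuous: "continuous_on UNIV central_form"
  unfolding cov_quadratic[symmetric]
  by (intro continuous_on_inner continuous_on_id linear_continuous_on cov_bounded_linear)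

text \<open>Almost surely \<open>m(Y)\<close> has no component along a given direction orthogonal to the range of its
  covariance, because the variance in that direction vanishes.\<close>

lemma AE_inner_m_proj:
  assumes E: "finite E" "orthonormal E" "span E = range curve_cov"
  shows "AE \<omega> in M. u \<bullet> m (Y \<omega>) = proj E u \<bullet> m (Y \<omega>)"
proof -
  let ?v = "u - proj E u"
  have "?v \<bullet> curve_cov ?v = 0" by (rule proj_residual[OF E(1,2)]) (simp add: E(3))
  then have "(LINT \<omega>|M. (?v \<bullet> m (Y \<omega>))\<^sup>2) = 0"
    using cov_quadratic[of ?v] by (simp add: central_form_def inner_commute)
  then have "AE \<omega> in M. (?v \<bullet> m (Y \<omega>))\<^sup>2 = 0"
    by (subst (asm) integral_nonneg_eq_0_iff_AE[OF integrable_square_inner]) auto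
  then show ?thesis by eventually_elim (simp add: inner_diff_left)
qed

lemma slice_mean_measurable:
  assumes [measurable]: "\<And>h. (\<lambda>\<omega>. b \<omega> h) \<in> borel_measurable N"
  shows "(\<lambda>\<omega>. integral\<^sup>L (cond_law M Y (cut_slice H (b \<omega>) h)) X) \<in> borel_measurable N"
proof -
  have [measurable]: "(\<lambda>(\<omega>, \<omega>'). indicator (cut_slice H (b \<omega>) h) (Y \<omega>') :: real) \<in> borel_measurable (N \<Otimes>\<^sub>M M)"
  proof -
    have "(\<lambda>(\<omega>, \<omega>'). if (h = 1 \<or> b \<omega> (h - 1) < Y \<omega>') \<and> (h = H \<or> Y \<omega>' \<le> b \<omega> h) then 1 else 0 :: real)
        \<in> borel_measurable (N \<Otimes>\<^sub>M M)"
      by measurable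
    then show ?thesis by (simp add: indicator_def cut_slice_def)
  qed
  have "(\<lambda>\<omega>. LINT \<omega>'|M. indicator (cut_slice H (b \<omega>) h) (Y \<omega>') *\<^sub>R X \<omega>') \<in> borel_measurable N"
    by (rule borel_measurable_lebesgue_integral) measurable
  moreover have "(\<lambda>\<omega>. LINT \<omega>'|M. indicator (cut_slice H (b \<omega>) h) (Y \<omega>') :: real) \<in> borel_measurable N"
    by (rule borel_measurable_lebesgue_integral) measurable
  ultimately show ?thesis by (simp add: integral_cond_law integral_indicator_Y)
qed

end

context inverse_regression_sample begin

abbreviation sample_cut :: "nat \<Rightarrow> nat \<Rightarrow> 'w \<Rightarrow> nat \<Rightarrow> real" where
  "sample_cut H c \<omega> h \<equiv> order_stat (H * c) (\<lambda>i. Ys i \<omega>) (c * h)"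

abbreviation sample_mean :: "nat \<Rightarrow> nat \<Rightarrow> 'w \<Rightarrow> nat \<Rightarrow> 'h" where
  "sample_mean H c \<omega> h \<equiv> slice_mean H c (\<lambda>i. Xs i \<omega>) (\<lambda>i. Ys i \<omega>) (Suc h)"

abbreviation close_event :: "nat \<Rightarrow> nat \<Rightarrow> real \<Rightarrow> 'w set" where
  "close_event H c k \<equiv> {\<omega> \<in> space M. \<forall>u. norm u = 1 \<longrightarrow>
     \<bar>(Gamma_tilde M X Y H c (\<lambda>i. Ys i \<omega>) u - curve_cov u) \<bullet> u\<bar> \<le> k * (curve_cov u \<bullet> u)}"

text \<open>With windows around the quantiles, this is the event on which the results about deterministic cuts
  apply to the cuts of the sample.\<close>

definition tame :: "nat \<Rightarrow> nat \<Rightarrow> (nat \<Rightarrow> real) \<Rightarrow> (nat \<Rightarrow> real) \<Rightarrow> 'w set" where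
  "tame H c q1 q2 = {\<omega> \<in> space M. \<forall>h\<in>{1..<H}.
     q1 h < sample_cut H c \<omega> h \<and> sample_cut H c \<omega> h \<le> q2 h}"

lemma order_stat_sample_measurable[measurable]:
  "(\<lambda>\<omega>. order_stat n (\<lambda>i. Ys i \<omega>) k) \<in> borel_measurable M"
  by (rule measurable_order_stat) measurable

lemma tame_measurable[measurable]: "tame H c q1 q2 \<in> sets M"
  unfolding tame_def by measurable

text \<open>If an order statistic leaves the window, the number of observations up to an endpoint deviates
  from its mean by at least \<open>n \<gamma>/(2H)\<close>, which Hoeffding's inequality makes unlikely; there are at most \<open>2H\<close>
  endpoints.\<close>

lemma prob_tame:
  assumes \<gamma>: "0 < \<gamma>" and H: "0 < H" "0 < c"
    and q: "\<And>h. 0 < h \<Longrightarrow> h < H \<Longrightarrow> F (q1 h) = real h / real H - \<gamma> / (2 * real H)"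
      "\<And>h. 0 < h \<Longrightarrow> h < H \<Longrightarrow> F (q2 h) = real h / real H + \<gamma> / (2 * real H)"
  shows "prob (space M - tame H c q1 q2) \<le> 2 * real H * exp (- (\<gamma>\<^sup>2 * real (H * c)) / (2 * (real H)\<^sup>2))"
proof -
  let ?n = "H * c"
  let ?N = "\<lambda>q \<omega>. count_le ?n (\<lambda>i. Ys i \<omega>) q"
  let ?t = "\<gamma> / (2 * real H)"
  let ?e = "exp (- (\<gamma>\<^sup>2 * real ?n) / (2 * (real H)\<^sup>2))"
  have n: "0 < ?n" using H by simp
  have t: "0 \<le> ?t" using \<gamma> by simp
  have e: "exp (- 2 * real ?n * ?t\<^sup>2) = ?e" by (simp add: power_divide power_mult_distrib field_simps)
  define A where "A h = {\<omega> \<in> space M. real (?N (q2 h) \<omega>) \<le> real ?n * F (q2 h) - real ?n * ?t}" for h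
  define B where "B h = {\<omega> \<in> space M. real ?n * F (q1 h) + real ?n * ?t \<le> real (?N (q1 h) \<omega>)}" for h
  have m: "A h \<in> sets M" "B h \<in> sets M" for h unfolding A_def B_def count_le_eq_sum by measurable
  have nh: "real ?n * (real h / real H) = real (c * h)" for h using H by simp
  have "space M - tame H c q1 q2 \<subseteq> (\<Union>h\<in>{1..<H}. A h \<union> B h)"
  proof
    fix \<omega> assume "\<omega> \<in> space M - tame H c q1 q2"
    then have w: "\<omega> \<in> space M" and "\<not> (\<forall>h\<in>{1..<H}. q1 h < sample_cut H c \<omega> h
        \<and> sample_cut H c \<omega> h \<le> q2 h)"
      unfolding tame_def by blast+
    then obtain h where "h \<in> {1..<H}" and nor: "\<not> (q1 h < sample_cut H c \<omega> h
        \<and> sample_cut H c \<omega> h \<le> q2 h)" by blast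
    then have h: "0 < h" "h < H" by simp_all
    from nor have or: "sample_cut H c \<omega> h \<le> q1 h \<or> \<not> sample_cut H c \<omega> h \<le> q2 h"
      by linarith
    have k: "0 < c * h" "c * h \<le> ?n" using h H by auto
    from or have "\<omega> \<in> A h \<union> B h"
    proof
      assume "sample_cut H c \<omega> h \<le> q1 h"
      then have "c * h \<le> ?N (q1 h) \<omega>" by (simp only: order_stat_le_iff[OF k])
      then have "real (c * h) \<le> real (?N (q1 h) \<omega>)" by (rule of_nat_mono)
      moreover have "real ?n * F (q1 h) + real ?n * ?t = real (c * h)"
        unfolding q(1)[OF h] nh[symmetric] by (simp add: right_diff_distrib)
      ultimately show ?thesis using w by (simp only: B_def Un_iff mem_Collect_eq) simp
    next
      assume "\<not> sample_cut H c \<omega> h \<le> q2 h"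
      then have "?N (q2 h) \<omega> \<le> c * h" by (simp only: order_stat_le_iff[OF k])
      then have "real (?N (q2 h) \<omega>) \<le> real (c * h)" by (rule of_nat_mono)
      moreover have "real ?n * F (q2 h) - real ?n * ?t = real (c * h)"
        unfolding q(2)[OF h] nh[symmetric] by (simp add: distrib_left)
      ultimately show ?thesis using w by (simp only: A_def Un_iff mem_Collect_eq) simp
    qed
    then show "\<omega> \<in> (\<Union>h\<in>{1..<H}. A h \<union> B h)" using h by auto
  qed
  then have "prob (space M - tame H c q1 q2) \<le> prob (\<Union>h\<in>{1..<H}. A h \<union> B h)"
    using m by (intro finite_measure_mono) auto
  also have "\<dots> \<le> (\<Sum>h\<in>{1..<H}. prob (A h \<union> B h))"
    using m by (intro finite_measure_subadditive_finite) auto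
  also have "\<dots> \<le> (\<Sum>h\<in>{1..<H}. 2 * ?e)"
  proof (rule sum_mono)
    fix h
    have "prob (A h \<union> B h) \<le> prob (A h) + prob (B h)" using m by (intro measure_Un_le)
    also have "\<dots> \<le> ?e + ?e"
      using count_le_tail[OF n t, of "q1 h"] count_le_tail[OF n t, of "q2 h"] unfolding e A_def B_def
      by (intro add_mono)
    finally show "prob (A h \<union> B h) \<le> 2 * ?e" by simp
  qed
  also have "\<dots> = real (H - 1) * (2 * ?e)" by simp
  also have "\<dots> \<le> real H * (2 * ?e)" by (intro mult_right_mono) auto
  finally show ?thesis by simp
qed

lemma tame_near_quantiles:
  assumes q: "\<And>h. 0 < h \<Longrightarrow> h < H \<Longrightarrow> F (q1 h) = real h / real H - \<gamma> / (2 * real H)"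
      "\<And>h. 0 < h \<Longrightarrow> h < H \<Longrightarrow> F (q2 h) = real h / real H + \<gamma> / (2 * real H)"
    and \<omega>: "\<omega> \<in> tame H c q1 q2"
  shows "near_quantiles \<gamma> H (\<lambda>h. sample_cut H c \<omega> h)"
  unfolding near_quantiles_def
proof (intro allI impI)
  fix h assume h: "0 < h \<and> h < H"
  let ?b = "sample_cut H c \<omega> h"
  have "q1 h \<le> ?b" "?b \<le> q2 h" using \<omega> h by (auto simp: tame_def intro: less_imp_le)
  then have "F (q1 h) \<le> F ?b" "F ?b \<le> F (q2 h)" by (auto intro: F_mono)
  then show "\<bar>F ?b - real h / real H\<bar> \<le> \<gamma> / (2 * real H)" using q h by auto
qed

lemma quantiles_exist:
  assumes \<gamma>: "\<bar>s\<bar> < 1" and H: "0 < H"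
  obtains q where "\<And>h. 0 < h \<Longrightarrow> h < H \<Longrightarrow> F (q h) = real h / real H + s / (2 * real H)"
proof -
  have "\<exists>q. F q = real h / real H + s / (2 * real H)" if h: "0 < h" "h < H" for h
  proof -
    have "real h / real H + s / (2 * real H) = (2 * real h + s) / (2 * real H)"
      using H by (simp add: field_simps)
    moreover have "0 < (2 * real h + s) / (2 * real H)" "(2 * real h + s) / (2 * real H) < 1"
      using h \<gamma> H by (auto simp: field_simps)
    ultimately show ?thesis by (metis F_quantile)
  qed
  then obtain q where "\<And>h. 0 < h \<Longrightarrow> h < H \<Longrightarrow> F (q h) = real h / real H + s / (2 * real H)" by metis
  then show ?thesis by (rule that)
qed

lemma Gamma_tilde_event_measurable:
  assumes H: "0 < H"
  shows "close_event H c k \<in> sets M"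
proof (rule measurable_ball_unit_sphere)
  fix u
  have [measurable]: "(\<lambda>\<omega>. integral\<^sup>L (cond_law M Y (cut_slice H (\<lambda>h. sample_cut H c \<omega> h) h)) X)
      \<in> borel_measurable M" for h
    by (rule slice_mean_measurable) measurable
  show "(\<lambda>\<omega>. (Gamma_tilde M X Y H c (\<lambda>i. Ys i \<omega>) u - curve_cov u) \<bullet> u) \<in> borel_measurable M"
    unfolding inner_diff_left Gamma_tilde_quadratic[OF H] by measurable
next
  fix \<omega>
  show "continuous_on UNIV (\<lambda>u. (Gamma_tilde M X Y H c (\<lambda>i. Ys i \<omega>) u - curve_cov u) \<bullet> u)"
    unfolding inner_diff_left Gamma_tilde_quadratic[OF H] cov_quadratic
    by (intro continuous_intros central_form_continuous)
next
  show "continuous_on UNIV (\<lambda>u. k * (curve_cov u \<bullet> u))"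
    unfolding cov_quadratic by (intro continuous_intros central_form_continuous)
qed

lemma Gamma_tilde_close_prob:
  assumes \<gamma>: "0 < \<gamma>" "\<gamma> < 1" and H: "0 < H" "0 < c"
    and close: "\<And>b u. near_quantiles \<gamma> H b \<Longrightarrow> norm u = 1 \<Longrightarrow> \<bar>slice_form H b u - central_form u\<bar> \<le> k * central_form u"
  shows "prob (close_event H c k)
     \<ge> 1 - 2 * real H * exp (- (\<gamma>\<^sup>2 * real (H * c)) / (2 * (real H)\<^sup>2))"
proof -
  obtain q1 where q1: "\<And>h. 0 < h \<Longrightarrow> h < H \<Longrightarrow> F (q1 h) = real h / real H + (- \<gamma>) / (2 * real H)"
    using quantiles_exist[of "- \<gamma>" H] \<gamma> H by auto
  obtain q2 where q2: "\<And>h. 0 < h \<Longrightarrow> h < H \<Longrightarrow> F (q2 h) = real h / real H + \<gamma> / (2 * real H)"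
    using quantiles_exist[of \<gamma> H] \<gamma> H by auto
  have q1': "F (q1 h) = real h / real H - \<gamma> / (2 * real H)" if "0 < h" "h < H" for h
    using q1[OF that] by simp
  let ?G = "close_event H c k"
  have "tame H c q1 q2 \<subseteq> ?G"
  proof
    fix \<omega> assume w: "\<omega> \<in> tame H c q1 q2"
    have "\<bar>(Gamma_tilde M X Y H c (\<lambda>i. Ys i \<omega>) u - curve_cov u) \<bullet> u\<bar> \<le> k * (curve_cov u \<bullet> u)" if "norm u = 1" for u
      using close[OF tame_near_quantiles[OF q1' q2 w] that]
      by (simp add: inner_diff_left Gamma_tilde_quadratic[OF H(1)] cov_quadratic slice_form_def)
    then show "\<omega> \<in> ?G" using w by (auto simp: tame_def)
  qed
  then have "prob (tame H c q1 q2) \<le> prob ?G"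
    by (intro finite_measure_mono Gamma_tilde_event_measurable H)
  moreover have "prob (space M - tame H c q1 q2) = 1 - prob (tame H c q1 q2)"
    by (rule prob_compl) measurable
  ultimately show ?thesis using prob_tame[OF \<gamma>(1) H q1' q2] by linarith
qed

end

section \<open>From slice means to projections\<close>

lemma tensor_diff_bound:
  fixes x y u :: "'h::real_inner"
  shows "norm (tensor x x u - tensor y y u) \<le> ((norm (x - y))\<^sup>2 + 2 * norm y * norm (x - y)) * norm u"
proof -
  have "tensor x x u - tensor y y u
      = ((x - y) \<bullet> u) *\<^sub>R (x - y) + ((x - y) \<bullet> u) *\<^sub>R y + (y \<bullet> u) *\<^sub>R (x - y)"
    by (simp add: tensor_def algebra_simps inner_diff_left)
  also have "norm \<dots> \<le> \<bar>(x - y) \<bullet> u\<bar> * norm (x - y) + \<bar>(x - y) \<bullet> u\<bar> * norm y + \<bar>y \<bullet> u\<bar> * norm (x - y)"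
    by (intro norm_triangle_le add_mono) auto
  also have "\<dots> \<le> (norm (x - y) * norm u) * norm (x - y) + (norm (x - y) * norm u) * norm y
      + (norm y * norm u) * norm (x - y)"
    by (intro add_mono mult_right_mono Cauchy_Schwarz_ineq2) auto
  finally show ?thesis by (simp add: power2_eq_square algebra_simps)
qed

text \<open>The common shape of \<open>Gamma_hat\<close> and of its deterministic counterpart.\<close>

definition mean_tensor :: "nat \<Rightarrow> (nat \<Rightarrow> 'h::real_inner) \<Rightarrow> 'h \<Rightarrow> 'h" where
  "mean_tensor H x u = (1 / real H) *\<^sub>R (\<Sum>h<H. tensor (x h) (x h) u)"

lemma mean_tensor_quadratic: "mean_tensor H x u \<bullet> u = (1 / real H) * (\<Sum>h<H. (x h \<bullet> u)\<^sup>2)"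
  by (simp add: mean_tensor_def inner_sum_left tensor_inner)

lemma psd_mean_tensor: "psd (mean_tensor H x)"
  unfolding psd_def
proof (intro conjI allI)
  show "linear (mean_tensor H x)"
    by (rule linearI) (simp_all add: mean_tensor_def tensor_def inner_add_right scaleR_add_left
        sum.distrib scaleR_add_right scaleR_sum_right mult.left_commute mult.commute)
  show "mean_tensor H x u \<bullet> v = u \<bullet> mean_tensor H x v" for u v
    by (simp add: mean_tensor_def tensor_def inner_sum_left inner_sum_right inner_commute mult_ac)
  show "0 \<le> mean_tensor H x u \<bullet> u" for u
    unfolding mean_tensor_quadratic by (intro mult_nonneg_nonneg sum_nonneg) auto
qed

lemma bounded_linear_mean_tensor: "bounded_linear (mean_tensor H x)"
  unfolding mean_tensor_def[abs_def] tensor_def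
  by (intro bounded_linear_const_scaleR bounded_linear_sum bounded_linear_scaleR_const
      bounded_linear_inner_right)

lemma mean_tensor_diff_bound:
  assumes "0 < H"
  shows "norm (mean_tensor H x u - mean_tensor H y u)
    \<le> (1 / real H) * (\<Sum>h<H. (norm (x h - y h))\<^sup>2 + 2 * norm (y h) * norm (x h - y h)) * norm u"
proof -
  have "mean_tensor H x u - mean_tensor H y u
      = (1 / real H) *\<^sub>R (\<Sum>h<H. tensor (x h) (x h) u - tensor (y h) (y h) u)"
    by (simp add: mean_tensor_def sum_subtractf scaleR_diff_right)
  also have "norm \<dots> = (1 / real H) * norm (\<Sum>h<H. tensor (x h) (x h) u - tensor (y h) (y h) u)"
    by simp
  also have "\<dots> \<le> (1 / real H) * (\<Sum>h<H. ((norm (x h - y h))\<^sup>2 + 2 * norm (y h) * norm (x h - y h)) * norm u)"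
    by (intro mult_left_mono sum_norm_le tensor_diff_bound) auto
  finally show ?thesis by (simp add: sum_distrib_right mult.assoc)
qed

lemma Gamma_hat_eq: "Gamma_hat H c x y = mean_tensor H (\<lambda>h. slice_mean H c x y (Suc h))"
  by (simp add: Gamma_hat_def mean_tensor_def fun_eq_iff sum.atLeast1_atMost_eq)

abbreviation projection_distance :: "'h::real_inner set \<Rightarrow> 'h set \<Rightarrow> real" where
  "projection_distance S T \<equiv> onorm (\<lambda>u. orth_proj S u - orth_proj T u)"

lemma projection_distance_orthonormal:
  assumes "finite E" "orthonormal E" "finite G" "orthonormal G"
  shows "0 \<le> projection_distance (span G) (span E)" "projection_distance (span G) (span E) \<le> 2"
proof -
  have T: "(\<lambda>u. orth_proj (span G) u - orth_proj (span E) u) = (\<lambda>u. proj G u - proj E u)"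
    by (simp add: orth_proj_span assms)
  show "0 \<le> projection_distance (span G) (span E)"
    unfolding T by (intro onorm_pos_le bounded_linear_sub bounded_linear_proj assms)
  have "norm (proj G u - proj E u) \<le> 2 * norm u" for u
    using norm_triangle_ineq4[of "proj G u" "proj E u"]
      norm_proj_le(1)[OF assms(3,4), of u] norm_proj_le(1)[OF assms(1,2), of u] by linarith
  then show "projection_distance (span G) (span E) \<le> 2" unfolding T by (intro onorm_bound) simp_all
qed

lemma top_eigenspace_orthonormal:
  assumes "top_eigenspace A d S"
  obtains \<mu> \<phi> where "eigensystem A \<mu> \<phi>" "S = span (\<phi> ` {..<d})"
    "finite (\<phi> ` {..<d})" "orthonormal (\<phi> ` {..<d})"
  using assms eigensystem_orthonormal(2) unfolding top_eigenspace_def by blast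

lemma projection_error_le_4:
  assumes E: "finite E" "orthonormal E" and S: "top_eigenspace A d S"
  shows "(projection_distance S (span E))\<^sup>2 \<le> 4"
proof -
  obtain \<mu> \<phi> where S: "S = span (\<phi> ` {..<d})" and G: "finite (\<phi> ` {..<d})" "orthonormal (\<phi> ` {..<d})"
    by (rule top_eigenspace_orthonormal[OF S])
  show ?thesis
    using power_mono[OF projection_distance_orthonormal(2)[OF E G] projection_distance_orthonormal(1)[OF E G], of 2]
    by (simp add: S)
qed

text \<open>If all deviations are at most one, the operators differ by a multiple of the sum of the deviations and
  the Davis-Kahan bound applies. Otherwise the sum of squares exceeds one, and the projections differ by at
  most two in norm anyway. Thus second moments of the deviations suffice later, although the operator
  difference also contains their squares.\<close>

lemma projection_error_bound:
  fixes x y :: "nat \<Rightarrow> 'h::real_inner"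
  assumes E: "finite E" "orthonormal E" "card E = d" "0 < d" and H: "0 < H"
    and null: "\<And>u. (\<And>e. e \<in> E \<Longrightarrow> u \<bullet> e = 0) \<Longrightarrow> mean_tensor H y u = 0"
    and \<rho>: "0 < \<rho>" "\<And>u. u \<in> span E \<Longrightarrow> \<rho> * (norm u)\<^sup>2 \<le> mean_tensor H y u \<bullet> u"
    and D: "\<And>h. h < H \<Longrightarrow> norm (y h) \<le> D"
    and S: "top_eigenspace (mean_tensor H x) d S"
  shows "(projection_distance S (span E))\<^sup>2
    \<le> (4 + 16 * (1 + 2 * D)\<^sup>2 / \<rho>\<^sup>2) * (\<Sum>h<H. (norm (x h - y h))\<^sup>2)"
proof -
  obtain \<mu> \<phi> where es: "eigensystem (mean_tensor H x) \<mu> \<phi>" and Seq: "S = span (\<phi> ` {..<d})"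
    and Fn: "finite (\<phi> ` {..<d})" "orthonormal (\<phi> ` {..<d})"
    by (rule top_eigenspace_orthonormal[OF S])
  let ?T = "\<lambda>u. orth_proj S u - orth_proj (span E) u"
  have T: "?T u = proj (\<phi> ` {..<d}) u - proj E u" for u
    by (simp add: Seq orth_proj_span[OF Fn] orth_proj_span[OF E(1,2)])
  let ?A = "\<Sum>h<H. (norm (x h - y h))\<^sup>2"
  have A0: "0 \<le> ?A" by (intro sum_nonneg) auto
  have D0: "0 \<le> D" using D[OF H] norm_ge_zero order_trans by blast
  have on0: "0 \<le> onorm ?T" unfolding Seq by (rule projection_distance_orthonormal(1)[OF E(1,2) Fn])
  have C: "0 \<le> 16 * (1 + 2 * D)\<^sup>2 / \<rho>\<^sup>2" by simp
  show ?thesis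
  proof (cases "\<forall>h<H. norm (x h - y h) \<le> 1")
    case True
    let ?\<delta> = "(1 / real H) * (\<Sum>h<H. (norm (x h - y h))\<^sup>2 + 2 * norm (y h) * norm (x h - y h))"
    have "norm (?T u) \<le> 4 * ?\<delta> / \<rho> * norm u" for u
      unfolding T
      by (rule davis_kahan[OF E psd_mean_tensor null \<rho> psd_mean_tensor bounded_linear_mean_tensor es
            mean_tensor_diff_bound[OF H]])
    moreover have "0 \<le> 4 * ?\<delta> / \<rho>"
      using \<rho>(1) H by (intro divide_nonneg_pos mult_nonneg_nonneg sum_nonneg add_nonneg_nonneg) auto
    ultimately have "onorm ?T \<le> 4 * ?\<delta> / \<rho>" by (intro onorm_bound)
    moreover have "?\<delta> \<le> (1 / real H) * (\<Sum>h<H. (1 + 2 * D) * norm (x h - y h))"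
    proof (intro mult_left_mono sum_mono)
      fix h assume h: "h \<in> {..<H}"
      have "norm (x h - y h) * norm (x h - y h) \<le> 1 * norm (x h - y h)"
        using True h by (intro mult_right_mono) auto
      moreover have "norm (y h) * norm (x h - y h) \<le> D * norm (x h - y h)"
        using D h by (intro mult_right_mono) auto
      ultimately show "(norm (x h - y h))\<^sup>2 + 2 * norm (y h) * norm (x h - y h) \<le> (1 + 2 * D) * norm (x h - y h)"
        by (simp add: power2_eq_square algebra_simps)
    qed simp
    ultimately have "onorm ?T \<le> 4 * ((1 / real H) * (\<Sum>h<H. (1 + 2 * D) * norm (x h - y h))) / \<rho>"
      using \<rho>(1) by (meson divide_right_mono less_imp_le mult_left_mono order_trans zero_le_numeral)
    also have "\<dots> = (4 * (1 + 2 * D) / \<rho>) * ((\<Sum>h<H. norm (x h - y h)) / real H)"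
      unfolding sum_distrib_left[symmetric] by (simp only: divide_inverse mult_ac mult_1_left)
    finally have "(onorm ?T)\<^sup>2 \<le> ((4 * (1 + 2 * D) / \<rho>) * ((\<Sum>h<H. norm (x h - y h)) / real H))\<^sup>2"
      using on0 by (intro power_mono)
    also have "\<dots> = 16 * (1 + 2 * D)\<^sup>2 / \<rho>\<^sup>2 * ((\<Sum>h<H. norm (x h - y h))\<^sup>2 / (real H)\<^sup>2)"
    proof -
      have "(4::real)\<^sup>2 = 16" by simp
      then show ?thesis by (simp only: power_mult_distrib power_divide)
    qed
    also have "\<dots> \<le> 16 * (1 + 2 * D)\<^sup>2 / \<rho>\<^sup>2 * ?A"
    proof (rule mult_left_mono[OF _ C])
      have "(\<Sum>h<H. norm (x h - y h))\<^sup>2 \<le> ?A * real (card {..<H})"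
        by (rule sum_squared_le_sum_of_squares)
      also have "\<dots> \<le> ?A * (real H)\<^sup>2"
        using H A0 by (intro mult_left_mono) (auto simp: power2_eq_square)
      finally show "(\<Sum>h<H. norm (x h - y h))\<^sup>2 / (real H)\<^sup>2 \<le> ?A" using H by (simp add: pos_divide_le_eq)
    qed
    finally show ?thesis using A0 by (simp add: distrib_right)
  next
    case False
    then obtain h where h: "h < H" "1 < norm (x h - y h)" by (auto simp: not_le)
    have "(onorm ?T)\<^sup>2 \<le> 4" by (rule projection_error_le_4[OF E(1,2) S])
    also have "4 \<le> 4 * ?A"
    proof -
      have "1 \<le> (norm (x h - y h))\<^sup>2" using h(2) by (simp add: one_le_power)
      also have "\<dots> \<le> ?A" using h(1) by (intro member_le_sum) auto
      finally show ?thesis by simp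
    qed
    also have "4 * ?A \<le> (4 + 16 * (1 + 2 * D)\<^sup>2 / \<rho>\<^sup>2) * ?A" using A0 C by (intro mult_right_mono) auto
    finally show ?thesis .
  qed
qed

section \<open>Mean square deviation of the sample slice means\<close>

lemma square_sum4_le: "(a + b + c + d)\<^sup>2 \<le> 4 * (a\<^sup>2 + b\<^sup>2 + c\<^sup>2 + (d::real)\<^sup>2)"
proof -
  have "4 * (a\<^sup>2 + b\<^sup>2 + c\<^sup>2 + d\<^sup>2) - (a + b + c + d)\<^sup>2
      = (a - b)\<^sup>2 + (a - c)\<^sup>2 + (a - d)\<^sup>2 + (b - c)\<^sup>2 + (b - d)\<^sup>2 + (c - d)\<^sup>2"
    by (simp add: power2_eq_square algebra_simps)
  moreover have "0 \<le> \<dots>" by (intro add_nonneg_nonneg) auto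
  ultimately show ?thesis by linarith
qed

lemma norm_diff_square_le:
  fixes x y :: "'h::real_normed_vector"
  shows "(norm (x - y))\<^sup>2 \<le> 2 * (norm x)\<^sup>2 + 2 * (norm y)\<^sup>2"
proof -
  have "(norm (x - y))\<^sup>2 \<le> (norm x + norm y)\<^sup>2" by (intro power_mono norm_triangle_ineq4) simp
  also have "\<dots> \<le> 2 * (norm x)\<^sup>2 + 2 * (norm y)\<^sup>2"
    using sum_squares_bound[of "norm x" "norm y"] by (simp add: power2_sum)
  finally show ?thesis .
qed

context inverse_regression begin

lemma central_form_scale: "central_form (r *\<^sub>R u) = r\<^sup>2 * central_form u"
  by (simp add: central_form_def power_mult_distrib)

lemma slice_form_scale: "slice_form H b (r *\<^sub>R u) = r\<^sup>2 * slice_form H b u"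
  by (simp add: slice_form_def power_mult_distrib sum_distrib_left mult.left_commute)

lemma slice_form_close_all:
  assumes "\<And>u. norm u = 1 \<Longrightarrow> \<bar>slice_form H b u - central_form u\<bar> \<le> k * central_form u"
  shows "\<bar>slice_form H b u - central_form u\<bar> \<le> k * central_form u"
proof (cases "u = 0")
  case True
  then show ?thesis using slice_form_scale[of H b 0 u] central_form_scale[of 0 u] by simp
next
  case False
  let ?v = "u /\<^sub>R norm u"
  have u: "u = norm u *\<^sub>R ?v" using False by simp
  have "\<bar>slice_form H b ?v - central_form ?v\<bar> \<le> k * central_form ?v" using False by (intro assms) simp
  then have "(norm u)\<^sup>2 * \<bar>slice_form H b ?v - central_form ?v\<bar> \<le> (norm u)\<^sup>2 * (k * central_form ?v)"
    by (intro mult_left_mono) auto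
  moreover have "slice_form H b u = (norm u)\<^sup>2 * slice_form H b ?v"
    by (subst u, rule slice_form_scale)
  moreover have "central_form u = (norm u)\<^sup>2 * central_form ?v"
    by (subst u, rule central_form_scale)
  ultimately show ?thesis by (simp add: right_diff_distrib[symmetric] abs_mult mult.left_commute)
qed

end

context inverse_regression_sample begin

abbreviation sample_rank :: "nat \<Rightarrow> 'w \<Rightarrow> nat list" where
  "sample_rank n \<omega> \<equiv> ranking n (\<lambda>i. Ys i \<omega>)"

abbreviation residual_var :: real where
  "residual_var \<equiv> (LINT \<omega>|M. (norm (X \<omega> - m (Y \<omega>)))\<^sup>2)"

lemma integral_law:
  fixes g :: "'h \<times> real \<Rightarrow> 'b::{banach, second_countable_topology}"
  assumes [measurable]: "g \<in> borel_measurable borel"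
  shows "integral\<^sup>L law g = (LINT \<omega>|M. g (X \<omega>, Y \<omega>))"
  unfolding law_def by (rule integral_distr) measurable

lemma iid_sum_second_moment:
  fixes \<psi> :: "'h \<times> real \<Rightarrow> 'e::{real_inner, banach, second_countable_topology}"
  assumes [measurable]: "\<psi> \<in> borel_measurable borel"
    and sq: "integrable M (\<lambda>\<omega>. (norm (\<psi> (X \<omega>, Y \<omega>)))\<^sup>2)"
    and int: "integrable M (\<lambda>\<omega>. \<psi> (X \<omega>, Y \<omega>))" and mean: "(LINT \<omega>|M. \<psi> (X \<omega>, Y \<omega>)) = 0"
  shows "integrable M (\<lambda>\<omega>. (norm (\<Sum>i<n. \<psi> (Xs i \<omega>, Ys i \<omega>)))\<^sup>2)"
    and "(LINT \<omega>|M. (norm (\<Sum>i<n. \<psi> (Xs i \<omega>, Ys i \<omega>)))\<^sup>2) \<le> real n * (LINT \<omega>|M. (norm (\<psi> (X \<omega>, Y \<omega>)))\<^sup>2)"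
proof -
  have orth: "(LINT a|law. 1 * 1 * (\<psi> a \<bullet> e)) = 0" for e
    using int mean by (simp add: integral_law)
  show "integrable M (\<lambda>\<omega>. (norm (\<Sum>i<n. \<psi> (Xs i \<omega>, Ys i \<omega>)))\<^sup>2)"
    using weighted_sum_second_moment(1)[of \<psi> "\<lambda>_ _. 1" n] sq orth by simp
  show "(LINT \<omega>|M. (norm (\<Sum>i<n. \<psi> (Xs i \<omega>, Ys i \<omega>)))\<^sup>2) \<le> real n * (LINT \<omega>|M. (norm (\<psi> (X \<omega>, Y \<omega>)))\<^sup>2)"
    using weighted_sum_second_moment(2)[of \<psi> "\<lambda>_ _. 1" n] sq orth by simp
qed

lemma measurable_coordinate_snd:
  "(\<lambda>z. snd (z k)) \<in> borel_measurable (Pi\<^sub>M I (\<lambda>_. borel :: ('h \<times> real) measure))"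
proof (cases "k \<in> I")
  case True
  from measurable_compose[OF measurable_component_singleton[OF True, of "\<lambda>_. borel"] snd_borel] show ?thesis by simp
next
  case False
  have "(\<lambda>z. snd (z k)) \<in> borel_measurable (Pi\<^sub>M I (\<lambda>_. borel :: ('h \<times> real) measure))
      \<longleftrightarrow> (\<lambda>z. snd (undefined :: 'h \<times> real)) \<in> borel_measurable (Pi\<^sub>M I (\<lambda>_. borel :: ('h \<times> real) measure))"
    using False by (intro measurable_cong) (auto simp: space_PiM PiE_def extensional_def)
  then show ?thesis by simp
qed

lemma residual_square_integrable: "integrable M (\<lambda>\<omega>. (norm (X \<omega> - m (Y \<omega>)))\<^sup>2)"
proof (rule Bochner_Integration.integrable_bound)
  show "integrable M (\<lambda>\<omega>. 2 * (norm (X \<omega>))\<^sup>2 + 2 * (norm (m (Y \<omega>)))\<^sup>2)"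
    using second_moment m_second_moment by simp
  show "AE \<omega> in M. norm ((norm (X \<omega> - m (Y \<omega>)))\<^sup>2) \<le> norm (2 * (norm (X \<omega>))\<^sup>2 + 2 * (norm (m (Y \<omega>)))\<^sup>2)"
    using norm_diff_square_le by auto
qed measurable

text \<open>Which observations enter the block is decided by the responses alone. With the other observations
  fixed, the weights therefore depend on the \<open>i\<close>-th observation only through its response, and the residual
  integrates to zero against every bounded function of the response.\<close>

lemma residual_block_second_moment:
  assumes P: "P \<subseteq> {..<n}"
  defines "R \<equiv> \<lambda>\<omega>. \<Sum>p\<in>P. Xs (sample_rank n \<omega> ! p) \<omega> - m (Ys (sample_rank n \<omega> ! p) \<omega>)"
  shows "integrable M (\<lambda>\<omega>. (norm (R \<omega>))\<^sup>2)"
    and "(LINT \<omega>|M. (norm (R \<omega>))\<^sup>2) \<le> real n * residual_var"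
proof -
  define \<psi> where "\<psi> z = fst z - m (snd z)" for z :: "'h \<times> real"
  have \<psi>[measurable]: "\<psi> \<in> borel_measurable borel"
    unfolding \<psi>_def using borel_measurable_diff[OF fst_borel measurable_compose[OF snd_borel m_measurable]] by simp
  define W where "W i z = (if i \<in> (\<lambda>p. ranking n (\<lambda>k. snd (z k)) ! p) ` P then 1 else 0 :: real)"
    for i and z :: "nat \<Rightarrow> 'h \<times> real"
  have W[measurable]: "W i \<in> borel_measurable (Pi\<^sub>M {..<n} (\<lambda>_. borel))" for i
  proof -
    have rk: "(\<lambda>z. ranking n (\<lambda>k. snd (z k))) \<in> measurable (Pi\<^sub>M {..<n} (\<lambda>_. borel :: ('h \<times> real) measure)) (count_space UNIV)"
      by (rule measurable_ranking) (rule measurable_coordinate_snd)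
    show ?thesis
      unfolding W_def by (rule measurable_compose[OF rk, of "\<lambda>l. if i \<in> (\<lambda>p. l ! p) ` P then 1 else 0"]) simp
  qed
  have orth: "(LINT a|law. W i (z(i := a)) * W j (z(i := a)) * (\<psi> a \<bullet> e)) = 0"
    if i: "i < n" and z: "z \<in> space (Pi\<^sub>M ({..<n} - {i}) (\<lambda>_. law))" for i j z e
  proof -
    define w where "w y = W i (z(i := (0, y))) * W j (z(i := (0, y)))" for y
    \<comment> \<open>The covariate of the \<open>i\<close>-th observation does not influence the ranking; 0 is a dummy value for it.\<close>
    have Wsnd: "W k (z(i := a)) = W k (z(i := (0, snd a)))" for k a
    proof -
      have "(\<lambda>k. snd ((z(i := a)) k)) = (\<lambda>k. snd ((z(i := (0, snd a))) k))" by auto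
      then show ?thesis unfolding W_def by simp
    qed
    have z': "z \<in> space (Pi\<^sub>M ({..<n} - {i}) (\<lambda>_. borel))" using z by (simp add: space_PiM law_def)
    have upd: "(\<lambda>y. z(i := (0, y))) \<in> measurable borel (Pi\<^sub>M {..<n} (\<lambda>_. borel :: ('h \<times> real) measure))"
    proof (rule measurable_fun_upd[where J = "{..<n} - {i}"])
      show "{..<n} = ({..<n} - {i}) \<union> {i}" using i by auto
      show "(\<lambda>y. z) \<in> measurable borel (Pi\<^sub>M ({..<n} - {i}) (\<lambda>_. borel))" using z' by (intro measurable_const)
      show "(\<lambda>y::real. (0::'h, y)) \<in> measurable borel borel"
        by (intro borel_measurable_continuous_onI continuous_intros)
    qed
    have w[measurable]: "w \<in> borel_measurable borel"
      unfolding w_def using measurable_compose[OF upd W] by measurable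
    have wb: "\<bar>w y\<bar> \<le> 1" for y by (simp add: w_def W_def)
    have wm[measurable]: "(\<lambda>a. w (snd a) * (\<psi> a \<bullet> e)) \<in> borel_measurable (borel :: ('h \<times> real) measure)"
      using measurable_compose[OF snd_borel w] by measurable
    have "(LINT a|law. W i (z(i := a)) * W j (z(i := a)) * (\<psi> a \<bullet> e)) = (LINT a|law. w (snd a) * (\<psi> a \<bullet> e))"
      unfolding w_def by (subst Wsnd[of i], subst Wsnd[of j]) simp
    also have "\<dots> = (LINT \<omega>|M. w (Y \<omega>) * ((X \<omega> - m (Y \<omega>)) \<bullet> e))"
      using integral_law[OF wm] by (simp add: \<psi>_def)
    also have "\<dots> = 0" by (rule residual_orthogonal[OF w wb])
    finally show ?thesis .
  qed
  have Wb: "\<bar>W i z\<bar> \<le> 1" for i z by (simp add: W_def)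
  have sq: "integrable M (\<lambda>\<omega>. (norm (\<psi> (X \<omega>, Y \<omega>)))\<^sup>2)" using residual_square_integrable by (simp add: \<psi>_def)
  have R: "R \<omega> = (\<Sum>i<n. W i (sample n \<omega>) *\<^sub>R \<psi> (Xs i \<omega>, Ys i \<omega>))" for \<omega>
  proof -
    have "ranking n (\<lambda>k. snd (sample n \<omega> k)) = sample_rank n \<omega>"
      by (rule ranking_cong) (simp add: sample_def)
    then show ?thesis unfolding R_def W_def
      using sum_ranking[OF P, of "\<lambda>i. Xs i \<omega> - m (Ys i \<omega>)" "\<lambda>i. Ys i \<omega>"] by (simp add: \<psi>_def)
  qed
  show "integrable M (\<lambda>\<omega>. (norm (R \<omega>))\<^sup>2)"
    unfolding R by (rule weighted_sum_second_moment(1)[OF \<psi> sq W Wb orth])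
  show "(LINT \<omega>|M. (norm (R \<omega>))\<^sup>2) \<le> real n * residual_var"
    unfolding R using weighted_sum_second_moment(2)[OF \<psi> sq W Wb orth] by (simp add: \<psi>_def)
qed

context
  fixes \<gamma> :: real and H c :: nat and q q1 q2 :: "nat \<Rightarrow> real" and B :: real
  assumes \<gamma>: "0 < \<gamma>" "\<gamma> < 1" and H: "0 < H" and c: "0 < c"
    and q: "\<And>h. 0 < h \<Longrightarrow> h < H \<Longrightarrow> F (q h) = real h / real H"
    and q1: "\<And>h. 0 < h \<Longrightarrow> h < H \<Longrightarrow> F (q1 h) = real h / real H - \<gamma> / (2 * real H)"
    and q2: "\<And>h. 0 < h \<Longrightarrow> h < H \<Longrightarrow> F (q2 h) = real h / real H + \<gamma> / (2 * real H)"
    and B: "\<And>h t. 0 < h \<Longrightarrow> h < H \<Longrightarrow> q1 h \<le> t \<Longrightarrow> t \<le> q2 h \<Longrightarrow> norm (m t) \<le> B"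
begin

lemma near_q: "near_quantiles \<gamma> H q"
  using q \<gamma> by (simp add: near_quantiles_def)

lemma ecut_prob_q: "k \<le> H \<Longrightarrow> ecut_prob H q k = real k / real H"
proof -
  assume "k \<le> H"
  then consider "k = 0" | "k = H" | "0 < k" "k < H" by linarith
  then show ?thesis
  proof cases
    case 3
    then show ?thesis using q by (simp add: ecut_prob_def ecut_def F_def)
  qed (use H in \<open>auto simp: ecut_prob_def ecut_def prob_space\<close>)
qed

definition ref_mean :: "nat \<Rightarrow> 'h" where
  "ref_mean h = integral\<^sup>L (cond_law M Y (cut_slice H q (Suc h))) X"

definition ref_int :: "nat \<Rightarrow> 'h" where
  "ref_int h = (LINT \<omega>|M. indicator (cut_slice H q (Suc h)) (Y \<omega>) *\<^sub>R m (Y \<omega>))"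

lemma ref_mean_eq:
  assumes "h < H"
  shows "ref_mean h = real H *\<^sub>R ref_int h"
proof -
  have "slice_prob H q (Suc h) = 1 / real H"
    using slice_prob_eq[OF near_q \<gamma> H assms] ecut_prob_q[of h] ecut_prob_q[of "Suc h"] assms
    by (simp add: add_divide_distrib)
  then show ?thesis
    by (simp add: ref_mean_def ref_int_def integral_cond_law integral_indicator_m slice_prob_def)
qed

abbreviation curve_var :: "nat \<Rightarrow> real" where
  "curve_var h \<equiv> (LINT \<omega>|M. (norm (indicator (cut_slice H q (Suc h)) (Y \<omega>) *\<^sub>R m (Y \<omega>) - ref_int h))\<^sup>2)"

definition res_block :: "nat \<Rightarrow> 'w \<Rightarrow> 'h" where
  "res_block h \<omega> = (\<Sum>p\<in>{c * h..<c * Suc h}. Xs (sample_rank (H * c) \<omega> ! p) \<omega>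
     - m (Ys (sample_rank (H * c) \<omega> ! p) \<omega>))"

text \<open>The centred number of observations up to the \<open>k\<close>-th cut; it is zero for \<open>k = 0\<close> and \<open>k = H\<close>, which
  makes the two outer slices no special case.\<close>

definition count_dev :: "nat \<Rightarrow> 'w \<Rightarrow> real" where
  "count_dev k \<omega> = (\<Sum>i<H * c. indicator {y. ereal y \<le> ecut H q k} (Ys i \<omega>) - real k / real H)"

definition curve_dev :: "nat \<Rightarrow> 'w \<Rightarrow> 'h" where
  "curve_dev h \<omega> = (\<Sum>i<H * c. indicator (cut_slice H q (Suc h)) (Ys i \<omega>) *\<^sub>R m (Ys i \<omega>) - ref_int h)"

lemma res_block_moment:
  assumes h: "h < H"
  shows "integrable M (\<lambda>\<omega>. (norm (res_block h \<omega>))\<^sup>2)"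
    and "(LINT \<omega>|M. (norm (res_block h \<omega>))\<^sup>2) \<le> real (H * c) * residual_var"
proof -
  have "c * Suc h \<le> c * H" using h by (intro mult_le_mono2) simp
  then have P: "{c * h..<c * Suc h} \<subseteq> {..<H * c}" by (auto simp: mult.commute)
  show "integrable M (\<lambda>\<omega>. (norm (res_block h \<omega>))\<^sup>2)"
    unfolding res_block_def by (rule residual_block_second_moment(1)[OF P])
  show "(LINT \<omega>|M. (norm (res_block h \<omega>))\<^sup>2) \<le> real (H * c) * residual_var"
    unfolding res_block_def by (rule residual_block_second_moment(2)[OF P])
qed

lemma count_dev_moment:
  assumes k: "k \<le> H"
  shows "integrable M (\<lambda>\<omega>. (count_dev k \<omega>)\<^sup>2)" and "(LINT \<omega>|M. (count_dev k \<omega>)\<^sup>2) \<le> real (H * c)"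
proof -
  let ?S = "{y. ereal y \<le> ecut H q k}"
  define \<psi> where "\<psi> z = indicator ?S (snd z) - real k / real H" for z :: "'h \<times> real"
  have S[measurable]: "?S \<in> sets borel" by measurable
  have \<psi>[measurable]: "\<psi> \<in> borel_measurable borel"
    unfolding \<psi>_def using measurable_compose[OF snd_borel borel_measurable_indicator[OF S]] by measurable
  have kH: "0 \<le> real k / real H" "real k / real H \<le> 1" using k H by auto
  have \<psi>b: "\<bar>\<psi> z\<bar> \<le> 1" for z using kH by (auto simp: \<psi>_def split: split_indicator)
  have int: "integrable M (\<lambda>\<omega>. \<psi> (X \<omega>, Y \<omega>))"
    by (rule integrable_const_bound[of _ 1]) (use \<psi>b in auto)
  have \<psi>2: "(norm (\<psi> z))\<^sup>2 \<le> 1" for z using \<psi>b[of z] by (simp add: abs_square_le_1)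
  have sq: "integrable M (\<lambda>\<omega>. (norm (\<psi> (X \<omega>, Y \<omega>)))\<^sup>2)"
    by (rule integrable_const_bound[of _ 1]) (use \<psi>2 in auto)
  have mean: "(LINT \<omega>|M. \<psi> (X \<omega>, Y \<omega>)) = 0"
  proof -
    have "Y -` ?S \<inter> space M = {\<omega> \<in> space M. ereal (Y \<omega>) \<le> ecut H q k}" by auto
    then have "(LINT \<omega>|M. indicator ?S (Y \<omega>) :: real) = real k / real H"
      by (simp add: integral_indicator_Y ecut_prob_q[OF k, symmetric] ecut_prob_def)
    moreover have "integrable M (\<lambda>\<omega>. indicator ?S (Y \<omega>) :: real)"
      by (rule integrable_const_bound[of _ 1]) auto
    ultimately show ?thesis by (simp add: \<psi>_def prob_space)
  qed
  have eq: "(norm (\<Sum>i<H * c. \<psi> (Xs i \<omega>, Ys i \<omega>)))\<^sup>2 = (count_dev k \<omega>)\<^sup>2" for \<omega>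
    by (simp add: count_dev_def \<psi>_def)
  show "integrable M (\<lambda>\<omega>. (count_dev k \<omega>)\<^sup>2)"
    using iid_sum_second_moment(1)[OF \<psi> sq int mean, of "H * c"] unfolding eq .
  have "(LINT \<omega>|M. (count_dev k \<omega>)\<^sup>2) \<le> real (H * c) * (LINT \<omega>|M. (norm (\<psi> (X \<omega>, Y \<omega>)))\<^sup>2)"
    using iid_sum_second_moment(2)[OF \<psi> sq int mean, of "H * c"] unfolding eq .
  also have "\<dots> \<le> real (H * c) * 1"
  proof (intro mult_left_mono)
    have "(LINT \<omega>|M. (norm (\<psi> (X \<omega>, Y \<omega>)))\<^sup>2) \<le> (LINT \<omega>|M. 1)" by (rule integral_mono[OF sq]) (use \<psi>2 in auto)
    then show "(LINT \<omega>|M. (norm (\<psi> (X \<omega>, Y \<omega>)))\<^sup>2) \<le> 1" by (simp add: prob_space)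
  qed simp
  finally show "(LINT \<omega>|M. (count_dev k \<omega>)\<^sup>2) \<le> real (H * c)" by simp
qed

lemma curve_dev_moment:
  shows "integrable M (\<lambda>\<omega>. (norm (curve_dev h \<omega>))\<^sup>2)"
    and "(LINT \<omega>|M. (norm (curve_dev h \<omega>))\<^sup>2)
      \<le> real (H * c) * curve_var h"
proof -
  let ?S = "cut_slice H q (Suc h)"
  define \<psi> where "\<psi> z = indicator ?S (snd z) *\<^sub>R m (snd z) - ref_int h" for z :: "'h \<times> real"
  have im: "(\<lambda>y. indicator ?S y *\<^sub>R m y - ref_int h) \<in> borel_measurable borel" by measurable
  have \<psi>[measurable]: "\<psi> \<in> borel_measurable borel"
    unfolding \<psi>_def by (rule measurable_compose[OF snd_borel im])
  have i1: "integrable M (\<lambda>\<omega>. indicator ?S (Y \<omega>) *\<^sub>R m (Y \<omega>))"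
    by (rule integrable_indicator_m) measurable
  then have int: "integrable M (\<lambda>\<omega>. \<psi> (X \<omega>, Y \<omega>))" by (simp add: \<psi>_def)
  have mean: "(LINT \<omega>|M. \<psi> (X \<omega>, Y \<omega>)) = 0" using i1 by (simp add: \<psi>_def ref_int_def prob_space)
  have sq: "integrable M (\<lambda>\<omega>. (norm (\<psi> (X \<omega>, Y \<omega>)))\<^sup>2)"
  proof (rule Bochner_Integration.integrable_bound)
    show "integrable M (\<lambda>\<omega>. 2 * (norm (m (Y \<omega>)))\<^sup>2 + 2 * (norm (ref_int h))\<^sup>2)" using m_second_moment by simp
    have "(norm (\<psi> (X \<omega>, Y \<omega>)))\<^sup>2 \<le> 2 * (norm (m (Y \<omega>)))\<^sup>2 + 2 * (norm (ref_int h))\<^sup>2" for \<omega>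
    proof -
      have "(norm (\<psi> (X \<omega>, Y \<omega>)))\<^sup>2 \<le> 2 * (norm (indicator ?S (Y \<omega>) *\<^sub>R m (Y \<omega>)))\<^sup>2 + 2 * (norm (ref_int h))\<^sup>2"
        unfolding \<psi>_def snd_conv by (rule norm_diff_square_le)
      then show ?thesis by (rule order_trans) (auto split: split_indicator)
    qed
    then show "AE \<omega> in M. norm ((norm (\<psi> (X \<omega>, Y \<omega>)))\<^sup>2) \<le> norm (2 * (norm (m (Y \<omega>)))\<^sup>2 + 2 * (norm (ref_int h))\<^sup>2)"
      by auto
  qed measurable
  show "integrable M (\<lambda>\<omega>. (norm (curve_dev h \<omega>))\<^sup>2)"
    using iid_sum_second_moment(1)[OF \<psi> sq int mean, of "H * c"] by (simp add: curve_dev_def \<psi>_def)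
  show "(LINT \<omega>|M. (norm (curve_dev h \<omega>))\<^sup>2)
      \<le> real (H * c) * curve_var h"
    using iid_sum_second_moment(2)[OF \<psi> sq int mean, of "H * c"] by (simp add: curve_dev_def \<psi>_def)
qed

text \<open>A sample slice holds the observations ranked between \<open>c h\<close> and \<open>c (h + 1)\<close>. After splitting off the
  residuals, the sum of \<open>m(Y)\<close> over these ranks is compared with the sum over the observations that fall
  between the quantiles; the discrepancy at each of the two cuts is handled by \<open>ranking_window_bound\<close>, and it
  is zero at the infinite cuts.\<close>

lemma slice_mean_deviation:
  assumes \<omega>: "\<omega> \<in> tame H c q1 q2" and h: "h < H"
  shows "norm (sample_mean H c \<omega> h - ref_mean h)
    \<le> (1 / real c) * (norm (res_block h \<omega>) + B * \<bar>count_dev (Suc h) \<omega>\<bar> + B * \<bar>count_dev h \<omega>\<bar> + norm (curve_dev h \<omega>))"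
proof -
  let ?n = "H * c"
  let ?y = "\<lambda>i. Ys i \<omega>"
  let ?l = "ranking ?n ?y"
  define f where "f p = m (?y (?l ! p))" for p
  define S where "S k = (\<Sum>i<?n. indicator {y. ereal y \<le> ecut H q k} (?y i) *\<^sub>R m (?y i))" for k
  define U where "U k = (\<Sum>p<c * k. f p) - S k" for k
  have U: "norm (U k) \<le> B * \<bar>count_dev k \<omega>\<bar>" if k: "k \<le> H" for k
  proof -
    consider "k = 0" | "k = H" | "0 < k" "k < H" using k by linarith
    then show ?thesis
    proof cases
      case 1
      then show ?thesis by (simp add: U_def S_def ecut_def count_dev_def)
    next
      case 2
      have "(\<Sum>p<?n. m (?y (?l ! p))) = (\<Sum>i<?n. m (?y i))"
        by (rule sum.reindex_bij_betw[OF ranking_bij])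
      then have "U k = 0" using 2 H by (simp add: U_def S_def f_def ecut_def mult.commute)
      moreover have "count_dev k \<omega> = 0" using 2 H by (simp add: count_dev_def ecut_def)
      ultimately show ?thesis by simp
    next
      case 3
      have F12: "F (q1 k) < F (q k)" "F (q k) < F (q2 k)" using q[OF 3] q1[OF 3] q2[OF 3] \<gamma> H by auto
      have le: "q1 k \<le> q k" "q k \<le> q2 k"
        using F12 F_mono[of "q k" "q1 k"] F_mono[of "q2 k" "q k"] by (auto simp: not_less[symmetric] intro: ccontr)
      have ck: "0 < c * k" "c * k \<le> ?n" using 3 c by auto
      have os: "q1 k < sample_cut H c \<omega> k" "sample_cut H c \<omega> k \<le> q2 k"
        using \<omega> 3 by (auto simp: tame_def)
      have S: "S k = (\<Sum>i<?n. indicator {..q k} (?y i) *\<^sub>R m (?y i))"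
        unfolding S_def using 3 by (intro sum.cong) (auto simp: ecut_def indicator_def)
      have "count_dev k \<omega> = (\<Sum>i<?n. indicator {..q k} (?y i)) - real ?n * (real k / real H)"
        unfolding count_dev_def using 3 by (simp add: ecut_def sum_subtractf indicator_def)
      also have "real ?n * (real k / real H) = real (c * k)" using H by simp
      also have "(\<Sum>i<?n. indicator {..q k} (?y i)) = real (count_le ?n ?y (q k))" by (rule count_le_eq_sum[symmetric])
      finally have cd: "count_dev k \<omega> = real (count_le ?n ?y (q k)) - real (c * k)" .
      show ?thesis unfolding U_def S f_def cd
        by (rule ranking_window_bound[OF ck le os B[OF 3]])
    qed
  qed
  have Sdiff: "S (Suc h) - S h = (\<Sum>i<?n. indicator (cut_slice H q (Suc h)) (?y i) *\<^sub>R m (?y i))"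
    unfolding S_def sum_subtractf[symmetric]
  proof (rule sum.cong[OF refl])
    fix i
    have "ecut H q h \<le> ecut H q (Suc h)" using ecut_strict[OF near_q \<gamma> H h] by simp
    then have "indicator {y. ereal y \<le> ecut H q (Suc h)} (?y i) - indicator {y. ereal y \<le> ecut H q h} (?y i)
        = (indicator (cut_slice H q (Suc h)) (?y i) :: real)"
      by (auto simp: cut_slice_Suc[OF h] indicator_def)
    then show "indicator {y. ereal y \<le> ecut H q (Suc h)} (?y i) *\<^sub>R m (?y i)
        - indicator {y. ereal y \<le> ecut H q h} (?y i) *\<^sub>R m (?y i)
        = indicator (cut_slice H q (Suc h)) (?y i) *\<^sub>R m (?y i)" by (simp add: scaleR_diff_left[symmetric])
  qed
  have cdv: "curve_dev h \<omega> = S (Suc h) - S h - real ?n *\<^sub>R ref_int h"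
    unfolding Sdiff curve_dev_def by (simp add: sum_subtractf sum_constant_scaleR)
  have fsum: "(\<Sum>p\<in>{c * h..<c * Suc h}. f p) = (\<Sum>p<c * Suc h. f p) - (\<Sum>p<c * h. f p)"
    using sum.atLeastLessThan_concat[of 0 "c * h" "c * Suc h" f, symmetric] by (simp add: lessThan_atLeast0)
  have "(\<Sum>p\<in>{c * h..<c * Suc h}. Xs (?l ! p) \<omega>) = res_block h \<omega> + (\<Sum>p\<in>{c * h..<c * Suc h}. f p)"
    by (simp add: res_block_def f_def sum_subtractf)
  also have "\<dots> = res_block h \<omega> + U (Suc h) - U h + curve_dev h \<omega> + real ?n *\<^sub>R ref_int h"
    unfolding fsum cdv U_def by simp
  finally have sm: "sample_mean H c \<omega> h
      = (1 / real c) *\<^sub>R (res_block h \<omega> + U (Suc h) - U h + curve_dev h \<omega> + real ?n *\<^sub>R ref_int h)"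
    by (simp add: slice_mean_eq)
  have "sample_mean H c \<omega> h - ref_mean h
      = (1 / real c) *\<^sub>R (res_block h \<omega> + U (Suc h) - U h + curve_dev h \<omega>)"
    unfolding sm ref_mean_eq[OF h] using c by (simp add: scaleR_add_right)
  also have "norm \<dots> = (1 / real c) * norm (res_block h \<omega> + U (Suc h) - U h + curve_dev h \<omega>)" by simp
  also have "\<dots> \<le> (1 / real c) * (norm (res_block h \<omega>) + norm (U (Suc h)) + norm (U h) + norm (curve_dev h \<omega>))"
  proof (rule mult_left_mono)
    show "norm (res_block h \<omega> + U (Suc h) - U h + curve_dev h \<omega>)
        \<le> norm (res_block h \<omega>) + norm (U (Suc h)) + norm (U h) + norm (curve_dev h \<omega>)"
      using norm_triangle_ineq[of "res_block h \<omega> + U (Suc h) - U h" "curve_dev h \<omega>"]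
        norm_triangle_ineq4[of "res_block h \<omega> + U (Suc h)" "U h"] norm_triangle_ineq[of "res_block h \<omega>" "U (Suc h)"]
      by linarith
  qed simp
  also have "\<dots> \<le> (1 / real c) * (norm (res_block h \<omega>) + B * \<bar>count_dev (Suc h) \<omega>\<bar> + B * \<bar>count_dev h \<omega>\<bar> + norm (curve_dev h \<omega>))"
    using U[of "Suc h"] U[of h] h by (intro mult_left_mono add_mono) auto
  finally show ?thesis .
qed

definition slice_mean_dominator :: "'w \<Rightarrow> real" where
  "slice_mean_dominator \<omega> = (\<Sum>h<H. 4 / (real c)\<^sup>2 * ((norm (res_block h \<omega>))\<^sup>2 + B\<^sup>2 * (count_dev (Suc h) \<omega>)\<^sup>2
     + B\<^sup>2 * (count_dev h \<omega>)\<^sup>2 + (norm (curve_dev h \<omega>))\<^sup>2))"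

lemma slice_mean_dominator_nonneg: "0 \<le> slice_mean_dominator \<omega>"
  unfolding slice_mean_dominator_def by (intro sum_nonneg mult_nonneg_nonneg add_nonneg_nonneg) auto

text \<open>The right-hand side is a fixed function of the sample whose integral can be computed term by term,
  in contrast to the random slice means on the left.\<close>

lemma slice_mean_dominated:
  assumes \<omega>: "\<omega> \<in> tame H c q1 q2"
  shows "(\<Sum>h<H. (norm (sample_mean H c \<omega> h - ref_mean h))\<^sup>2)
    \<le> slice_mean_dominator \<omega>"
  unfolding slice_mean_dominator_def
proof (rule sum_mono)
  fix h assume "h \<in> {..<H}"
  then have h: "h < H" by simp
  let ?a = "norm (res_block h \<omega>)" and ?b = "B * \<bar>count_dev (Suc h) \<omega>\<bar>" and ?c = "B * \<bar>count_dev h \<omega>\<bar>"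
    and ?d = "norm (curve_dev h \<omega>)"
  have "(norm (sample_mean H c \<omega> h - ref_mean h))\<^sup>2
      \<le> ((1 / real c) * (?a + ?b + ?c + ?d))\<^sup>2"
    by (intro power_mono slice_mean_deviation[OF \<omega> h]) simp
  also have "\<dots> = 1 / (real c)\<^sup>2 * (?a + ?b + ?c + ?d)\<^sup>2" by (simp add: power_mult_distrib power_divide)
  also have "\<dots> \<le> 1 / (real c)\<^sup>2 * (4 * (?a\<^sup>2 + ?b\<^sup>2 + ?c\<^sup>2 + ?d\<^sup>2))" by (intro mult_left_mono square_sum4_le) simp
  also have "\<dots> = 4 / (real c)\<^sup>2 * (?a\<^sup>2 + B\<^sup>2 * (count_dev (Suc h) \<omega>)\<^sup>2 + B\<^sup>2 * (count_dev h \<omega>)\<^sup>2 + ?d\<^sup>2)"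
    by (simp add: power_mult_distrib)
  finally show "(norm (sample_mean H c \<omega> h - ref_mean h))\<^sup>2
      \<le> 4 / (real c)\<^sup>2 * (?a\<^sup>2 + B\<^sup>2 * (count_dev (Suc h) \<omega>)\<^sup>2 + B\<^sup>2 * (count_dev h \<omega>)\<^sup>2 + ?d\<^sup>2)" .
qed

definition moment_const :: real where
  "moment_const = (\<Sum>h<H. 4 * (residual_var + B\<^sup>2 + B\<^sup>2
     + curve_var h))"

lemma moment_const_nonneg: "0 \<le> moment_const"
  unfolding moment_const_def
  by (intro sum_nonneg mult_nonneg_nonneg add_nonneg_nonneg Bochner_Integration.integral_nonneg) auto

lemma slice_mean_dominator_integral:
  shows "integrable M slice_mean_dominator"
    and "integral\<^sup>L M slice_mean_dominator \<le> (real H)\<^sup>2 * moment_const / real (H * c)"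
proof -
  let ?g = "\<lambda>h \<omega>. (norm (res_block h \<omega>))\<^sup>2 + B\<^sup>2 * (count_dev (Suc h) \<omega>)\<^sup>2
     + B\<^sup>2 * (count_dev h \<omega>)\<^sup>2 + (norm (curve_dev h \<omega>))\<^sup>2"
  have i: "integrable M (?g h)" if "h < H" for h
    using that res_block_moment(1)[of h] count_dev_moment(1)[of h] count_dev_moment(1)[of "Suc h"] curve_dev_moment(1)[of h]
    by simp
  show "integrable M slice_mean_dominator"
    unfolding slice_mean_dominator_def[abs_def]
    by (intro Bochner_Integration.integrable_sum integrable_mult_right i) simp
  have "integral\<^sup>L M slice_mean_dominator = (\<Sum>h<H. 4 / (real c)\<^sup>2 * integral\<^sup>L M (?g h))"
  proof -
    have "integral\<^sup>L M slice_mean_dominator = (\<Sum>h<H. LINT \<omega>|M. 4 / (real c)\<^sup>2 * ?g h \<omega>)"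
      unfolding slice_mean_dominator_def[abs_def]
      by (rule Bochner_Integration.integral_sum) (intro integrable_mult_right i, simp)
    then show ?thesis by (simp only: integral_mult_right_zero)
  qed
  also have "\<dots> \<le> (\<Sum>h<H. 4 / (real c)\<^sup>2 * (real (H * c) * (residual_var + B\<^sup>2 + B\<^sup>2
     + curve_var h)))"
  proof (intro sum_mono mult_left_mono)
    fix h assume "h \<in> {..<H}"
    then have h: "h < H" by simp
    have "integral\<^sup>L M (?g h) = (LINT \<omega>|M. (norm (res_block h \<omega>))\<^sup>2) + B\<^sup>2 * (LINT \<omega>|M. (count_dev (Suc h) \<omega>)\<^sup>2)
        + B\<^sup>2 * (LINT \<omega>|M. (count_dev h \<omega>)\<^sup>2) + (LINT \<omega>|M. (norm (curve_dev h \<omega>))\<^sup>2)"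
      using h res_block_moment(1)[of h] count_dev_moment(1)[of h] count_dev_moment(1)[of "Suc h"] curve_dev_moment(1)[of h]
      by simp
    also have "\<dots> \<le> real (H * c) * residual_var + B\<^sup>2 * real (H * c) + B\<^sup>2 * real (H * c)
        + real (H * c) * curve_var h"
      using h by (intro add_mono mult_left_mono res_block_moment(2) count_dev_moment(2) curve_dev_moment(2)) auto
    finally show "integral\<^sup>L M (?g h) \<le> real (H * c) * (residual_var + B\<^sup>2 + B\<^sup>2
        + curve_var h)"
      by (simp only: distrib_left mult.commute[of "B\<^sup>2"])
  qed simp
  also have "\<dots> = (real (H * c) / (real c)\<^sup>2) * moment_const"
    unfolding moment_const_def sum_distrib_left
    by (intro sum.cong refl) (simp only: times_divide_eq_left times_divide_eq_right mult_ac)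
  also have "real (H * c) / (real c)\<^sup>2 = (real H)\<^sup>2 / real (H * c)"
    using H c by (simp add: field_simps power2_eq_square)
  finally show "integral\<^sup>L M slice_mean_dominator \<le> (real H)\<^sup>2 * moment_const / real (H * c)" by simp
qed

end

end

section \<open>Rate of the projection error\<close>

lemma exp_minus_le_inverse:
  assumes "0 < (x::real)"
  shows "exp (- x) \<le> 1 / x"
proof -
  have "x \<le> exp x" using exp_ge_add_one_self[of x] by linarith
  then show ?thesis using le_imp_inverse_le[OF _ assms] by (simp add: exp_minus inverse_eq_divide)
qed

context inverse_regression_sample begin

text \<open>The reference operator is built from the slices at the exact quantiles. It is independent of \<open>c\<close>, and so
  are the constants; the exceptional event is paid for by \<open>exp(-x) \<le> 1/x\<close>.\<close>

lemma projection_rate: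
  assumes \<gamma>: "0 < \<gamma>" "\<gamma> < 1" and H: "0 < H"
    and E: "finite E" "orthonormal E" "span E = range curve_cov" "card E = d" "0 < d"
    and l: "0 < l" "\<And>u. l * (norm (proj E u))\<^sup>2 \<le> central_form u"
    and close: "\<And>b u. near_quantiles \<gamma> H b \<Longrightarrow> norm u = 1 \<Longrightarrow> \<bar>slice_form H b u - central_form u\<bar> \<le> 1 / 2 * central_form u"
  shows "\<exists>C'>0. \<forall>c>0. \<forall>Shat.
      (\<forall>\<omega>\<in>space M. top_eigenspace (Gamma_hat H c (\<lambda>i. Xs i \<omega>) (\<lambda>i. Ys i \<omega>)) d (Shat \<omega>)) \<longrightarrow>
      (\<lambda>\<omega>. projection_distance (Shat \<omega>) (span E)) \<in> borel_measurable M \<longrightarrow>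
      (LINT \<omega>|M. (projection_distance (Shat \<omega>) (span E))\<^sup>2) \<le> C' / real (H * c)"
proof -
  obtain q where "\<And>h. 0 < h \<Longrightarrow> h < H \<Longrightarrow> F (q h) = real h / real H + 0 / (2 * real H)"
    using quantiles_exist[of 0 H] H by auto
  then have q: "F (q h) = real h / real H" if "0 < h" "h < H" for h using that by simp
  obtain q1 where "\<And>h. 0 < h \<Longrightarrow> h < H \<Longrightarrow> F (q1 h) = real h / real H + (- \<gamma>) / (2 * real H)"
    using quantiles_exist[of "- \<gamma>" H] \<gamma> H by auto
  then have q1: "F (q1 h) = real h / real H - \<gamma> / (2 * real H)" if "0 < h" "h < H" for h using that by simp
  obtain q2 where q2: "\<And>h. 0 < h \<Longrightarrow> h < H \<Longrightarrow> F (q2 h) = real h / real H + \<gamma> / (2 * real H)"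
    using quantiles_exist[of \<gamma> H] \<gamma> H by auto
  obtain B where B: "\<And>h t. 0 < h \<Longrightarrow> h < H \<Longrightarrow> q1 h \<le> t \<Longrightarrow> t \<le> q2 h \<Longrightarrow> norm (m t) \<le> B"
  proof -
    let ?W = "\<Union>h\<in>{0<..<H}. {q1 h..q2 h}"
    have "compact (m ` ?W)"
      by (intro compact_continuous_image continuous_on_subset[OF m_continuous] compact_UN) auto
    then obtain B where B: "\<forall>x\<in>m ` ?W. norm x \<le> B"
      using compact_imp_bounded bounded_iff by blast
    have "norm (m t) \<le> B" if "0 < h" "h < H" "q1 h \<le> t" "t \<le> q2 h" for h t
    proof -
      have "t \<in> ?W" using that by auto
      then show ?thesis using B by blast
    qed
    then show ?thesis by (rule that)
  qed
  let ?y = "ref_mean H q"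
  let ?A = "mean_tensor H ?y"
  have near: "near_quantiles \<gamma> H q" using q \<gamma> by (simp add: near_quantiles_def)
  have Aq: "?A u \<bullet> u = slice_form H q u" for u
    by (simp add: mean_tensor_quadratic slice_form_def ref_mean_def[OF \<gamma> H zero_less_one q q1 q2 B])
  have cl: "\<bar>?A u \<bullet> u - central_form u\<bar> \<le> 1 / 2 * central_form u" for u
    unfolding Aq by (rule slice_form_close_all) (rule close[OF near])
  define \<rho> where "\<rho> = l / 2"
  have \<rho>: "0 < \<rho>" using l by (simp add: \<rho>_def)
  have lower: "\<rho> * (norm u)\<^sup>2 \<le> ?A u \<bullet> u" if "u \<in> span E" for u
  proof -
    have "l * (norm u)\<^sup>2 \<le> central_form u" using l(2)[of u] by (simp add: proj_id[OF E(1,2) that])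
    moreover have "\<rho> * (norm u)\<^sup>2 = l * (norm u)\<^sup>2 / 2" by (simp add: \<rho>_def)
    ultimately show ?thesis using cl[of u] by linarith
  qed
  have null: "?A u = 0" if u: "\<And>e. e \<in> E \<Longrightarrow> u \<bullet> e = 0" for u
  proof (rule psd_null[OF psd_mean_tensor])
    have "u \<bullet> curve_cov u = 0" by (rule orth_span[OF u]) (auto simp: E(3))
    then have "central_form u = 0" using cov_quadratic[of u] by (simp add: inner_commute)
    then show "?A u \<bullet> u = 0" using cl[of u] by simp
  qed
  define D where "D = (\<Sum>h<H. norm (?y h))"
  have D: "norm (?y h) \<le> D" if "h < H" for h
    unfolding D_def using that by (intro member_le_sum) auto
  define C1 where "C1 = 4 + 16 * (1 + 2 * D)\<^sup>2 / \<rho>\<^sup>2"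
  have C1: "0 < C1" unfolding C1_def by (intro add_pos_nonneg) auto
  define K where "K = moment_const H q B"
  have K: "0 \<le> K" unfolding K_def by (rule moment_const_nonneg[OF \<gamma> H zero_less_one q q1 q2 B])
  define C' where "C' = 16 * real H ^ 3 / \<gamma>\<^sup>2 + C1 * ((real H)\<^sup>2 * K)"
  have C': "0 < C'" unfolding C'_def using \<gamma> H C1 K by (intro add_pos_nonneg) auto
  show ?thesis
  proof (intro exI[of _ C'] conjI C' allI impI)
    fix c :: nat and Shat :: "'w \<Rightarrow> 'h set"
    assume c: "0 < c"
      and tops: "\<forall>\<omega>\<in>space M. top_eigenspace (Gamma_hat H c (\<lambda>i. Xs i \<omega>) (\<lambda>i. Ys i \<omega>)) d (Shat \<omega>)"
      and meas: "(\<lambda>\<omega>. projection_distance (Shat \<omega>) (span E)) \<in> borel_measurable M"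
    have top: "top_eigenspace (Gamma_hat H c (\<lambda>i. Xs i \<omega>) (\<lambda>i. Ys i \<omega>)) d (Shat \<omega>)" if "\<omega> \<in> space M" for \<omega>
      using tops that by blast
    note ctx = \<gamma> H c q q1 q2 B
    let ?n = "H * c"
    let ?err = "\<lambda>\<omega>. (projection_distance (Shat \<omega>) (span E))\<^sup>2"
    let ?G = "tame H c q1 q2"
    let ?dom = "slice_mean_dominator H c q B"
    have dom0: "0 \<le> ?dom \<omega>" for \<omega>
      by (rule slice_mean_dominator_nonneg[OF ctx])
    have bound: "?err \<omega> \<le> 4 * indicator (space M - ?G) \<omega> + C1 * ?dom \<omega>" if w: "\<omega> \<in> space M" for \<omega>
    proof (cases "\<omega> \<in> ?G")
      case True
      have "?err \<omega> \<le> C1 * (\<Sum>h<H. (norm (sample_mean H c \<omega> h - ?y h))\<^sup>2)"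
        unfolding C1_def using top[OF w]
        by (intro projection_error_bound[OF E(1,2,4,5) H null \<rho> lower D]) (auto simp: Gamma_hat_eq)
      also have "\<dots> \<le> C1 * ?dom \<omega>"
        using C1 slice_mean_dominated[OF ctx True] by (intro mult_left_mono) auto
      finally show ?thesis by (simp add: indicator_def)
    next
      case False
      have "?err \<omega> \<le> 4" by (rule projection_error_le_4[OF E(1,2) top[OF w]])
      then show ?thesis using False w C1 dom0[of \<omega>] by (simp add: indicator_def add_increasing2)
    qed
    have idom: "integrable M ?dom" by (rule slice_mean_dominator_integral(1)[OF ctx])
    have iG: "integrable M (indicator (space M - ?G) :: 'w \<Rightarrow> real)"
      by (rule integrable_const_bound[of _ 1]) auto
    have "(LINT \<omega>|M. ?err \<omega>) \<le> (LINT \<omega>|M. 4 * indicator (space M - ?G) \<omega> + C1 * ?dom \<omega>)"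
    proof (rule integral_mono)
      show "integrable M ?err"
      proof (rule integrable_const_bound[of _ 4])
        show "AE \<omega> in M. norm (?err \<omega>) \<le> 4"
        proof (rule AE_I2)
          fix \<omega> assume "\<omega> \<in> space M"
          from projection_error_le_4[OF E(1,2) top[OF this]] show "norm (?err \<omega>) \<le> 4" by simp
        qed
      qed (use meas in measurable)
      show "integrable M (\<lambda>\<omega>. 4 * indicator (space M - ?G) \<omega> + C1 * ?dom \<omega>)" using idom iG by simp
    qed (rule bound)
    also have "\<dots> = 4 * prob (space M - ?G) + C1 * integral\<^sup>L M ?dom" using idom iG by simp
    also have "\<dots> \<le> 4 * (4 * real H ^ 3 / (\<gamma>\<^sup>2 * real ?n)) + C1 * ((real H)\<^sup>2 * K / real ?n)"
    proof (intro add_mono mult_left_mono)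
      let ?x = "\<gamma>\<^sup>2 * real ?n / (2 * (real H)\<^sup>2)"
      have x: "0 < ?x" using \<gamma> H c by simp
      have "exp (- ?x) \<le> 1 / ?x" by (rule exp_minus_le_inverse[OF x])
      then have "2 * real H * exp (- ?x) \<le> 2 * real H * (1 / ?x)" by (intro mult_left_mono) auto
      also have "\<dots> = 4 * real H ^ 3 / (\<gamma>\<^sup>2 * real ?n)" by (simp add: power2_eq_square power3_eq_cube)
      finally show "prob (space M - ?G) \<le> 4 * real H ^ 3 / (\<gamma>\<^sup>2 * real ?n)"
        using prob_tame[OF \<gamma>(1) H c q1 q2] by simp
      show "integral\<^sup>L M ?dom \<le> (real H)\<^sup>2 * K / real ?n"
        unfolding K_def by (rule slice_mean_dominator_integral(2)[OF ctx])
    qed (use C1 in auto)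
    also have "\<dots> = C' / real ?n" unfolding C'_def using \<gamma> H c by (simp add: field_simps)
    finally show "(LINT \<omega>|M. ?err \<omega>) \<le> C' / real ?n" .
  qed
qed

end

theorem theorem1:
  fixes M :: "'w measure" and X :: "'w \<Rightarrow> l2" and Y \<epsilon> :: "'w \<Rightarrow> real"
    and f :: "(real ^ 'd::finite) \<times> real \<Rightarrow> real" and \<beta> :: "'d \<Rightarrow> l2"
    and m :: "real \<Rightarrow> l2" and \<Gamma> \<Gamma>e :: "l2 \<Rightarrow> l2"
    and lam :: "nat \<Rightarrow> real" and \<phi> :: "nat \<Rightarrow> l2"
    and \<gamma> \<tau> c1 :: real and K :: nat
    and Xs :: "nat \<Rightarrow> 'w \<Rightarrow> l2" and Ys :: "nat \<Rightarrow> 'w \<Rightarrow> real"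
  assumes M: "prob_space M"
    and X: "X \<in> borel_measurable M" and Y: "Y \<in> borel_measurable M" and \<epsilon>: "\<epsilon> \<in> borel_measurable M"
    and indep: "prob_space.indep_set M {X -` A \<inter> space M | A. A \<in> sets borel}
                                       {\<epsilon> -` A \<inter> space M | A. A \<in> sets borel}"
    and model: "AE \<omega> in M. Y \<omega> = f (\<chi> i. \<beta> i \<bullet> X \<omega>, \<epsilon> \<omega>)"
    and no_atoms: "\<And>y. measure M {\<omega> \<in> space M. Y \<omega> = y} = 0"
    and mean_zero: "integral\<^sup>L M X = 0"
    and fourth_moment: "integrable M (\<lambda>\<omega>. norm (X \<omega>) ^ 4)"
    and \<Gamma>_def: "\<Gamma> = cov_op M X" and nonsingular: "inj \<Gamma>"
    and eigen: "eigensystem \<Gamma> lam \<phi>" "\<And>i. 0 < lam i"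
    and \<gamma>: "0 < \<gamma>" "\<gamma> < 1"
    and m: "cond_mean_curve M X Y m"
    and \<Gamma>e_def: "\<Gamma>e = cov_op M (\<lambda>\<omega>. m (Y \<omega>))"
    and WSSC: "weak_sliced_stable \<gamma> K \<tau> M Y m"
    and c1: "0 < c1" "\<And>i. (LINT \<omega>|M. (X \<omega> \<bullet> \<phi> i) ^ 4) / (lam i)\<^sup>2 \<le> c1"
    and rank: "dim (range \<Gamma>e) = CARD('d)"
    and \<tau>: "\<tau> > 6 * onorm \<Gamma>e / lambda_min_pos \<Gamma>e"
    and sample_indep: "prob_space.indep_vars M (\<lambda>_. borel) (\<lambda>i \<omega>. (Xs i \<omega>, Ys i \<omega>)) UNIV"
    and sample_law: "\<And>i. distr M borel (\<lambda>\<omega>. (Xs i \<omega>, Ys i \<omega>)) = distr M borel (\<lambda>\<omega>. (X \<omega>, Y \<omega>))"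
  shows "\<exists>C>0. \<exists>H0\<ge>K.
    (\<forall>H>H0. CARD('d) \<le> H \<longrightarrow> (\<exists>N. \<forall>n c. 0 < c \<and> n = H * c \<and> N \<le> n \<and> real n > 1 + 4 * real H / \<gamma> \<longrightarrow>
       measure M {\<omega> \<in> space M. \<forall>u. norm u = 1 \<longrightarrow>
           \<bar>(Gamma_tilde M X Y H c (\<lambda>i. Ys i \<omega>) u - \<Gamma>e u) \<bullet> u\<bar> \<le> 3 / \<tau> * (\<Gamma>e u \<bullet> u)}
         \<ge> 1 - C * (real H)\<^sup>2 * sqrt (real n + 1) * exp (- (\<gamma>\<^sup>2 * (real n + 1)) / (32 * (real H)\<^sup>2)))) \<and>
    (\<forall>H>H0. CARD('d) \<le> H \<longrightarrow> (\<exists>C'>0. \<exists>N. \<forall>n c. 0 < c \<and> n = H * c \<and> N \<le> n \<and> real n > 1 + 4 * real H / \<gamma> \<longrightarrow>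
       (\<forall>Shat :: 'w \<Rightarrow> l2 set.
          (\<forall>\<omega>\<in>space M. top_eigenspace (Gamma_hat H c (\<lambda>i. Xs i \<omega>) (\<lambda>i. Ys i \<omega>)) CARD('d) (Shat \<omega>)) \<and>
          (\<lambda>\<omega>. onorm (\<lambda>u. orth_proj (Shat \<omega>) u - orth_proj (closure (range \<Gamma>e)) u)) \<in> borel_measurable M
          \<longrightarrow>
          (LINT \<omega>|M. (onorm (\<lambda>u. orth_proj (Shat \<omega>) u - orth_proj (closure (range \<Gamma>e)) u))\<^sup>2)
            \<le> C' / real n)))"
proof -
  interpret prob_space M by (rule M)
  have sq: "integrable M (\<lambda>\<omega>. (norm (X \<omega>))\<^sup>2)"
  proof (rule Bochner_Integration.integrable_bound[of _ "\<lambda>\<omega>. 1 + norm (X \<omega>) ^ 4"])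
    show "integrable M (\<lambda>\<omega>. 1 + norm (X \<omega>) ^ 4)" using fourth_moment by simp
    have "x\<^sup>2 \<le> 1 + x ^ 4" for x :: real
    proof -
      have "0 \<le> (x\<^sup>2 - 1)\<^sup>2" by simp
      then have "2 * x\<^sup>2 \<le> 1 + x ^ 4" by (simp add: power2_eq_square power4_eq_xxxx algebra_simps)
      then show ?thesis using zero_le_power2[of x] by linarith
    qed
    then show "AE \<omega> in M. norm ((norm (X \<omega>))\<^sup>2) \<le> norm (1 + norm (X \<omega>) ^ 4)" by auto
  qed (use X in measurable)
  have m_cont: "continuous_on UNIV m" using WSSC by (simp add: weak_sliced_stable_def)
  interpret S: inverse_regression_sample M X Y m Xs Ys
    by unfold_locales (use X Y no_atoms mean_zero sq m m_cont sample_indep sample_law in auto)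
  let ?d = "CARD('d)"
  obtain B where B: "B \<subseteq> range \<Gamma>e" "range \<Gamma>e \<subseteq> span B" "card B = dim (range \<Gamma>e)"
    by (rule basis_exists[of "range \<Gamma>e"])
  have d: "0 < ?d" by simp
  have finB: "finite B" using B(3) rank d by (intro card_ge_0_finite) simp
  have nz: "range \<Gamma>e \<noteq> {0}"
  proof
    assume "range \<Gamma>e = {0}"
    then have "dim (range \<Gamma>e) \<le> card ({} :: l2 set)" by (intro dim_le_card) auto
    then show False using rank d by simp
  qed
  obtain E where E: "finite E" "orthonormal E" "span E = range \<Gamma>e"
    and low: "\<And>u. lambda_min_pos \<Gamma>e * (norm (proj E u))\<^sup>2 \<le> \<Gamma>e u \<bullet> u"
    and lpos: "0 < lambda_min_pos \<Gamma>e" and lle: "lambda_min_pos \<Gamma>e \<le> onorm \<Gamma>e"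
    using lambda_min_pos_coercive[OF S.cov_psd S.cov_bounded_linear finB, folded \<Gamma>e_def, OF B(2) nz] by blast
  have cE: "card E = ?d"
    using dim_span_eq_card_independent[OF orthonormal_independent[OF E(1,2)]] E(3) rank by simp
  have clS: "closure (range \<Gamma>e) = span E" using closed_span_orthonormal[OF E(1,2)] E(3) by simp
  \<comment> \<open>The norm dominates every eigenvalue, so the assumption on \<open>\<tau>\<close> entails \<open>\<tau> > 6\<close>.\<close>
  have "6 \<le> 6 * onorm \<Gamma>e / lambda_min_pos \<Gamma>e" using lpos lle by (simp add: field_simps)
  then have \<tau>6: "6 < \<tau>" using \<tau> by linarith
  have low': "lambda_min_pos \<Gamma>e * (norm (proj E u))\<^sup>2 \<le> S.central_form u" for u
    using low[of u] by (simp add: \<Gamma>e_def S.cov_quadratic)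
  have central0: "0 \<le> S.central_form u" for u
    using S.cov_psd unfolding S.cov_quadratic[symmetric] psd_def by blast
  obtain H0 where H0: "K \<le> H0" and close: "\<And>H b u. H0 < H \<Longrightarrow> S.near_quantiles \<gamma> H b \<Longrightarrow> norm u = 1 \<Longrightarrow>
      \<bar>S.slice_form H b u - S.central_form u\<bar> \<le> 3 / \<tau> * S.central_form u"
    using S.slice_form_close[OF WSSC \<gamma> lpos low' S.AE_inner_m_proj[OF E(1,2) E(3)[unfolded \<Gamma>e_def]]] by blast
  show ?thesis
  proof (rule exI[of _ "2::real"], rule conjI[rotated], rule exI[of _ H0], intro conjI allI impI)
    show "(0::real) < 2" by simp
    show "K \<le> H0" by (rule H0)
  next
    fix H assume H: "H0 < H"
    then have Hpos: "0 < H" by simp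
    show "\<exists>N. \<forall>n c. 0 < c \<and> n = H * c \<and> N \<le> n \<and> real n > 1 + 4 * real H / \<gamma> \<longrightarrow>
       measure M {\<omega> \<in> space M. \<forall>u. norm u = 1 \<longrightarrow>
           \<bar>(Gamma_tilde M X Y H c (\<lambda>i. Ys i \<omega>) u - \<Gamma>e u) \<bullet> u\<bar> \<le> 3 / \<tau> * (\<Gamma>e u \<bullet> u)}
         \<ge> 1 - 2 * (real H)\<^sup>2 * sqrt (real n + 1) * exp (- (\<gamma>\<^sup>2 * (real n + 1)) / (32 * (real H)\<^sup>2))"
    proof (intro exI[of _ 0] allI impI, elim conjE)
      fix n c :: nat assume c: "0 < c" and n: "n = H * c"
      have "0 < n" using c Hpos n by simp
      then have n1: "1 \<le> real n" by linarith
      let ?e1 = "exp (- (\<gamma>\<^sup>2 * real (H * c)) / (2 * (real H)\<^sup>2))"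
      let ?e2 = "exp (- (\<gamma>\<^sup>2 * (real n + 1)) / (32 * (real H)\<^sup>2))"
      \<comment> \<open>The exponent from Hoeffding, \<open>n/2\<close>, exceeds \<open>(n + 1)/32\<close> as soon as \<open>n \<ge> 1\<close>.\<close>
      have e: "?e1 \<le> ?e2"
      proof -
        have "\<gamma>\<^sup>2 * (real n + 1) / (32 * (real H)\<^sup>2) \<le> \<gamma>\<^sup>2 * (16 * real n) / (32 * (real H)\<^sup>2)"
          using n1 by (intro divide_right_mono mult_left_mono) auto
        moreover have "\<gamma>\<^sup>2 * (16 * real n) / (32 * (real H)\<^sup>2) = \<gamma>\<^sup>2 * real (H * c) / (2 * (real H)\<^sup>2)"
          unfolding n by simp
        ultimately show ?thesis unfolding exp_le_cancel_iff minus_divide_left[symmetric] by linarith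
      qed
      have "2 * real H * ?e1 \<le> 2 * (real H)\<^sup>2 * sqrt (real n + 1) * ?e2"
      proof (rule mult_mono[OF _ e])
        have "2 * real H * 1 \<le> 2 * (real H)\<^sup>2 * sqrt (real n + 1)"
          using Hpos by (intro mult_mono) (auto simp: power2_eq_square)
        then show "2 * real H \<le> 2 * (real H)\<^sup>2 * sqrt (real n + 1)" by simp
      qed auto
      then show "1 - 2 * (real H)\<^sup>2 * sqrt (real n + 1) * ?e2
          \<le> measure M {\<omega> \<in> space M. \<forall>u. norm u = 1 \<longrightarrow>
           \<bar>(Gamma_tilde M X Y H c (\<lambda>i. Ys i \<omega>) u - \<Gamma>e u) \<bullet> u\<bar> \<le> 3 / \<tau> * (\<Gamma>e u \<bullet> u)}"
        using S.Gamma_tilde_close_prob[OF \<gamma> Hpos c, of "3 / \<tau>"] close[OF H] unfolding \<Gamma>e_def by force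
    qed
  next
    fix H assume H: "H0 < H"
    then have Hpos: "0 < H" by simp
    have close2: "\<bar>S.slice_form H b u - S.central_form u\<bar> \<le> 1 / 2 * S.central_form u"
      if "S.near_quantiles \<gamma> H b" "norm u = 1" for b u
    proof -
      have "3 / \<tau> \<le> 1 / 2" using \<tau>6 by (simp add: field_simps)
      then have "3 / \<tau> * S.central_form u \<le> 1 / 2 * S.central_form u"
        using central0[of u] by (rule mult_right_mono)
      then show ?thesis using close[OF H that] by linarith
    qed
    have "\<exists>C'>0. \<forall>c>0. \<forall>Shat.
      (\<forall>\<omega>\<in>space M. top_eigenspace (Gamma_hat H c (\<lambda>i. Xs i \<omega>) (\<lambda>i. Ys i \<omega>)) ?d (Shat \<omega>)) \<longrightarrow>
      (\<lambda>\<omega>. projection_distance (Shat \<omega>) (span E)) \<in> borel_measurable M \<longrightarrow>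
      (LINT \<omega>|M. (projection_distance (Shat \<omega>) (span E))\<^sup>2) \<le> C' / real (H * c)"
      by (rule S.projection_rate[OF \<gamma> Hpos E(1,2) E(3)[unfolded \<Gamma>e_def] cE d lpos low' close2])
    then obtain C' where C': "0 < C'" and rate: "\<And>c Shat. 0 < c \<Longrightarrow>
      \<forall>\<omega>\<in>space M. top_eigenspace (Gamma_hat H c (\<lambda>i. Xs i \<omega>) (\<lambda>i. Ys i \<omega>)) ?d (Shat \<omega>) \<Longrightarrow>
      (\<lambda>\<omega>. projection_distance (Shat \<omega>) (span E)) \<in> borel_measurable M \<Longrightarrow>
      (LINT \<omega>|M. (projection_distance (Shat \<omega>) (span E))\<^sup>2) \<le> C' / real (H * c)"
      by auto
    show "\<exists>C'>0. \<exists>N. \<forall>n c. 0 < c \<and> n = H * c \<and> N \<le> n \<and> real n > 1 + 4 * real H / \<gamma> \<longrightarrow>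
       (\<forall>Shat :: 'w \<Rightarrow> l2 set.
          (\<forall>\<omega>\<in>space M. top_eigenspace (Gamma_hat H c (\<lambda>i. Xs i \<omega>) (\<lambda>i. Ys i \<omega>)) ?d (Shat \<omega>)) \<and>
          (\<lambda>\<omega>. onorm (\<lambda>u. orth_proj (Shat \<omega>) u - orth_proj (closure (range \<Gamma>e)) u)) \<in> borel_measurable M
          \<longrightarrow>
          (LINT \<omega>|M. (onorm (\<lambda>u. orth_proj (Shat \<omega>) u - orth_proj (closure (range \<Gamma>e)) u))\<^sup>2)
            \<le> C' / real n)"
      unfolding clS
    proof (intro exI[of _ C'] exI[of _ "0::nat"] conjI allI impI C', elim conjE)
      fix n c :: nat and Shat :: "'w \<Rightarrow> l2 set"
      assume c: "0 < c" and n: "n = H * c"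
        and top: "\<forall>\<omega>\<in>space M. top_eigenspace (Gamma_hat H c (\<lambda>i. Xs i \<omega>) (\<lambda>i. Ys i \<omega>)) ?d (Shat \<omega>)"
        and meas: "(\<lambda>\<omega>. projection_distance (Shat \<omega>) (span E)) \<in> borel_measurable M"
      show "(LINT \<omega>|M. (projection_distance (Shat \<omega>) (span E))\<^sup>2) \<le> C' / real n"
        unfolding n by (rule rate[OF c top meas])
    qed
  qed
qed

end
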